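(* Let $\Omega=\Omega(\hat{\mathbb{C}}\setminus\{(0),1,\infty\})$. Then the conformal map $\psi:\Omega\to\mathbb{D}$ is the elliptic nome function $$z=\psi(\omega)=q(\omega)=e^{-\pi\frac{\mathbb{K}(1-\omega)}{\mathbb{K}(\omega)}},$$ and $\omega=\phi(z)$, where $\phi=\psi^{-1}$ is the inverse elliptic nome function; for small $z$, $$\phi(z)=16z-128z^2+704z^3+\cdots.$$
   Context: $\mathbb{D}$ is the open unit disk, $\hat{\mathbb{C}}=\mathbb{C}\cup\{\infty\}$. $\mathbb{K}(m)=\frac{\pi}{2}\,{}_2F_1(\tfrac12,\tfrac12;1;m)$ is the complete elliptic integral of the first kind, as a function of $m=k^2$. $\Omega(\hat{\mathbb{C}}\setminus\{(0),1,\infty\})$ is the Riemann surface "with fixed origin": its points are equivalence classes of curves originating at $0$, modulo homotopies in $\hat{\mathbb{C}}\setminus\{0,1,\infty\}$ (endpoints fixed; the curves start at $0$ and otherwise avoid $0,1,\infty$), together with the origin itself on the first sheet. Thus on the first sheet $0$ is a regular point of the surface and only $1,\infty$ are punctures, while on all other sheets $0,1,\infty$ are punctures. The expression for $q$ is continued analytically to all of $\Omega$, with $q(0)=0$ on the first sheet. *)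

theory Defs
  imports "HOL-Complex_Analysis.Complex_Analysis"
begin

section \<open>The Riemann surface with fixed origin\<close>

text \<open>
  The Riemann sphere minus \<open>{0, 1, \<infinity>}\<close> is the complex plane minus \<open>{0, 1}\<close>, so curves are
  complex valued. They start at \<open>0\<close> and avoid \<open>0\<close> and \<open>1\<close> afterwards; the second disjunct adds the
  constant curve, whose class is the origin on the first sheet. A curve that returns to \<open>0\<close> is not
  admitted, so that \<open>0\<close> is a puncture on every other sheet.
\<close>

definition origin_curves :: "(real \<Rightarrow> complex) set" where
  "origin_curves = {\<gamma>. path \<gamma> \<and> pathstart \<gamma> = 0 \<and>
     ((\<forall>t\<in>{0<..1}. \<gamma> t \<notin> {0, 1}) \<or> (\<forall>t\<in>{0..1}. \<gamma> t = 0))}"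

text \<open>
  All intermediate curves of a homotopy are required to be in \<open>origin_curves\<close>: they touch \<open>0\<close> at
  time \<open>0\<close> only. Hence \<open>homotopic_paths\<close> for a fixed target set is not applicable.
\<close>

definition curve_rel :: "((real \<Rightarrow> complex) \<times> (real \<Rightarrow> complex)) set" where
  "curve_rel = {(\<gamma>, \<delta>). homotopic_with_canon
     (\<lambda>\<eta>. \<eta> \<in> origin_curves \<and> pathfinish \<eta> = pathfinish \<gamma>) {0..1} UNIV \<gamma> \<delta>}"

definition curve_class :: "(real \<Rightarrow> complex) \<Rightarrow> (real \<Rightarrow> complex) set" where
  "curve_class \<gamma> = curve_rel `` {\<gamma>}"

definition Omega :: "(real \<Rightarrow> complex) set set" where
  "Omega = origin_curves // curve_rel"

definition Omega_origin :: "(real \<Rightarrow> complex) set" where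
  "Omega_origin = curve_class (\<lambda>t. 0)"

definition Omega_proj :: "(real \<Rightarrow> complex) set \<Rightarrow> complex" where
  "Omega_proj P = pathfinish (SOME \<gamma>. \<gamma> \<in> P)"

text \<open>
  Continuing \<open>\<gamma>\<close> along the segment from its endpoint to a nearby point \<open>w\<close> gives the local
  inverses of \<open>Omega_proj\<close>, i.e. the inverse charts of \<open>Omega\<close>. Only the constant curve ends at \<open>0\<close>;
  there \<open>w\<close> is reached by the segment from \<open>0\<close> itself, since concatenating would
  produce a curve that is constantly \<open>0\<close> for a while.
\<close>

definition curve_extend :: "(real \<Rightarrow> complex) \<Rightarrow> complex \<Rightarrow> (real \<Rightarrow> complex)" where
  "curve_extend \<gamma> w =
     (if pathfinish \<gamma> = 0 then linepath 0 w else \<gamma> +++ linepath (pathfinish \<gamma>) w)"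

definition Omega_open :: "(real \<Rightarrow> complex) set set \<Rightarrow> bool" where
  "Omega_open W \<longleftrightarrow> W \<subseteq> Omega \<and>
     (\<forall>\<gamma>\<in>origin_curves. curve_class \<gamma> \<in> W \<longrightarrow>
        (\<exists>r>0. \<forall>w\<in>ball (pathfinish \<gamma>) r. curve_class (curve_extend \<gamma> w) \<in> W))"

definition Omega_topology :: "(real \<Rightarrow> complex) set topology" where
  "Omega_topology = topology Omega_open"

definition Omega_holomorphic :: "((real \<Rightarrow> complex) set \<Rightarrow> complex) \<Rightarrow> bool" where
  "Omega_holomorphic f \<longleftrightarrow>
     (\<forall>\<gamma>\<in>origin_curves. (\<lambda>w. f (curve_class (curve_extend \<gamma> w))) analytic_on {pathfinish \<gamma>})"

text \<open>
  A conformal map onto the unit disk is a biholomorphic one. \<open>Omega_proj\<close> is a local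
  coordinate everywhere, so a continuous map into \<open>Omega\<close> is holomorphic iff its composition with
  \<open>Omega_proj\<close> is.
\<close>

definition conformal_onto_disk :: "((real \<Rightarrow> complex) set \<Rightarrow> complex) \<Rightarrow> bool" where
  "conformal_onto_disk \<psi> \<longleftrightarrow>
     homeomorphic_map Omega_topology (top_of_set (ball 0 1)) \<psi> \<and>
     Omega_holomorphic \<psi> \<and>
     (\<lambda>z. Omega_proj (the_inv_into Omega \<psi> z)) holomorphic_on ball 0 1"

text \<open>
  The usual normalization \<open>\<psi>(0) = 0\<close>, \<open>\<psi>'(0) > 0\<close> of ``the'' conformal map, with the derivative
  taken in the coordinate \<open>\<omega>\<close> of the first sheet.
\<close>

definition normalized_at_origin :: "((real \<Rightarrow> complex) set \<Rightarrow> complex) \<Rightarrow> bool" where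
  "normalized_at_origin \<psi> \<longleftrightarrow> \<psi> Omega_origin = 0 \<and>
     (\<exists>c::real. c > 0 \<and>
        ((\<lambda>w. \<psi> (curve_class (linepath 0 w))) has_field_derivative of_real c) (at 0))"


section \<open>The elliptic nome function\<close>

text \<open>Parameter convention \<open>m = k\<^sup>2\<close>. The power series is meaningful for \<open>norm m < 1\<close> only.\<close>

definition ellipticK :: "complex \<Rightarrow> complex" where
  "ellipticK m = of_real pi / 2 * eval_fps (fps_hypergeo [1/2, 1/2] [1] 1) m"

text \<open>
  The formula for the nome involves both \<open>K(\<omega>)\<close> and \<open>K(1 - \<omega>)\<close>, hence is given by the power series
  on the intersection of the unit disks about \<open>0\<close> and \<open>1\<close>. From there, on the first
  sheet, it is continued analytically to all of \<open>Omega\<close>.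
\<close>

definition elliptic_nome :: "((real \<Rightarrow> complex) set \<Rightarrow> complex) \<Rightarrow> bool" where
  "elliptic_nome q \<longleftrightarrow>
     Omega_holomorphic q \<and> q Omega_origin = 0 \<and>
     (\<forall>\<omega>\<in>ball 0 1 \<inter> ball 1 1. q (curve_class (linepath 0 \<omega>)) =
        exp (- of_real pi * (ellipticK (1 - \<omega>) / ellipticK \<omega>)))"


section \<open>Well-definedness\<close>

lemma equiv_curve_rel: "equiv origin_curves curve_rel"
proof (rule equivI)
  show "curve_rel \<subseteq> origin_curves \<times> origin_curves"
    unfolding curve_rel_def by (auto dest: homotopic_with_imp_property)
  show "refl_on origin_curves curve_rel"
    unfolding refl_on_def curve_rel_def by (auto simp: origin_curves_def path_def)
  show "sym curve_rel"
  proof (rule symI)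
    fix p q assume "(p, q) \<in> curve_rel"
    hence h: "homotopic_with_canon
       (\<lambda>\<eta>. \<eta> \<in> origin_curves \<and> pathfinish \<eta> = pathfinish p) {0..1} UNIV p q"
      by (simp add: curve_rel_def)
    hence "pathfinish q = pathfinish p" by (auto dest: homotopic_with_imp_property)
    thus "(q, p) \<in> curve_rel" using homotopic_with_symD[OF h] by (simp add: curve_rel_def)
  qed
  show "trans curve_rel"
  proof (rule transI)
    fix p q r assume "(p, q) \<in> curve_rel" and qr: "(q, r) \<in> curve_rel"
    hence h: "homotopic_with_canon
       (\<lambda>\<eta>. \<eta> \<in> origin_curves \<and> pathfinish \<eta> = pathfinish p) {0..1} UNIV p q"
      by (simp add: curve_rel_def)
    hence "pathfinish q = pathfinish p" by (auto dest: homotopic_with_imp_property)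
    thus "(p, r) \<in> curve_rel" using homotopic_with_trans[OF h] qr by (simp add: curve_rel_def)
  qed
qed

lemma curve_class_in_Omega: "\<gamma> \<in> origin_curves \<Longrightarrow> curve_class \<gamma> \<in> Omega"
  unfolding curve_class_def Omega_def by (rule quotientI)

lemma Omega_proj_curve_class:
  assumes "\<gamma> \<in> origin_curves"
  shows "Omega_proj (curve_class \<gamma>) = pathfinish \<gamma>"
proof -
  have "\<gamma> \<in> curve_class \<gamma>"
    unfolding curve_class_def using equiv_class_self[OF equiv_curve_rel assms] .
  hence "(SOME \<delta>. \<delta> \<in> curve_class \<gamma>) \<in> curve_class \<gamma>" by (rule someI[of "\<lambda>\<delta>. \<delta> \<in> curve_class \<gamma>"])
  thus ?thesis
    unfolding Omega_proj_def by (auto simp: curve_class_def curve_rel_def dest: homotopic_with_imp_property)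
qed

lemma curve_extend_in_origin_curves:
  assumes "\<gamma> \<in> origin_curves"
  shows "\<exists>r>0. \<forall>w\<in>ball (pathfinish \<gamma>) r. curve_extend \<gamma> w \<in> origin_curves"
proof (cases "pathfinish \<gamma> = 0")
  case True
  have "linepath 0 w \<in> origin_curves" if w: "norm w < 1" for w :: complex
  proof (cases "w = 0")
    case True thus ?thesis by (simp add: origin_curves_def linepath_refl path_def pathstart_def)
  next
    case False
    have "linepath 0 w t \<notin> {0, 1}" if t: "t \<in> {0<..1}" for t
    proof -
      have "norm (linepath 0 w t) = t * norm w" using t by (simp add: linepath_def)
      moreover have "t * norm w < 1"
        using t w mult_left_le_one_le[of "norm w" t] by auto
      ultimately have "linepath 0 w t \<noteq> 1" by (metis less_irrefl norm_one)
      thus ?thesis using False t by (auto simp: linepath_def)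
    qed
    thus ?thesis by (simp add: origin_curves_def)
  qed
  thus ?thesis using True by (intro exI[of _ 1]) (auto simp: curve_extend_def)
next
  case False
  define p where "p = pathfinish \<gamma>"
  have g: "path \<gamma>" "pathstart \<gamma> = 0" "\<forall>t\<in>{0<..1}. \<gamma> t \<notin> {0, 1}"
    using assms False by (auto simp: origin_curves_def pathfinish_def)
  have p: "p \<noteq> 0" "p \<noteq> 1" using g(3) by (auto simp: p_def pathfinish_def)
  have "open (- {0, 1::complex})" by (intro open_Compl) auto
  then obtain r where r: "r > 0" "ball p r \<subseteq> - {0, 1}"
    using p open_contains_ball[of "- {0, 1}"] by auto
  have "\<gamma> +++ linepath p w \<in> origin_curves" if w: "w \<in> ball p r" for w
  proof -
    have seg: "closed_segment p w \<subseteq> ball p r"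
      using w r(1) by (intro closed_segment_subset) auto
    have "(\<gamma> +++ linepath p w) t \<notin> {0, 1}" if t: "t \<in> {0<..1}" for t
    proof (cases "t \<le> 1/2")
      case True
      thus ?thesis using g(3) t by (auto simp: joinpaths_def)
    next
      case False
      hence "(\<gamma> +++ linepath p w) t \<in> closed_segment p w"
        using t by (auto simp: joinpaths_def intro!: linepath_in_path)
      thus ?thesis using seg r(2) by auto
    qed
    thus ?thesis using g by (simp add: origin_curves_def p_def)
  qed
  thus ?thesis using False r(1) by (intro exI[of _ r]) (auto simp: curve_extend_def p_def)
qed

lemma istopology_Omega_open: "istopology Omega_open"
  unfolding istopology_def
proof (intro conjI allI impI)
  fix S T assume S: "Omega_open S" and T: "Omega_open T"
  show "Omega_open (S \<inter> T)"
    unfolding Omega_open_def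
  proof (intro conjI ballI impI)
    show "S \<inter> T \<subseteq> Omega" using S by (auto simp: Omega_open_def)
    fix \<gamma> assume *: "\<gamma> \<in> origin_curves" "curve_class \<gamma> \<in> S \<inter> T"
    obtain r where "r > 0" "\<forall>w\<in>ball (pathfinish \<gamma>) r. curve_class (curve_extend \<gamma> w) \<in> S"
      using S * by (auto simp: Omega_open_def)
    moreover obtain s where "s > 0" "\<forall>w\<in>ball (pathfinish \<gamma>) s. curve_class (curve_extend \<gamma> w) \<in> T"
      using T * by (auto simp: Omega_open_def)
    ultimately show "\<exists>r>0. \<forall>w\<in>ball (pathfinish \<gamma>) r. curve_class (curve_extend \<gamma> w) \<in> S \<inter> T"
      by (intro exI[of _ "min r s"]) auto
  qed
next
  fix K assume K: "\<forall>S\<in>K. Omega_open S"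
  show "Omega_open (\<Union>K)"
    unfolding Omega_open_def
  proof (intro conjI ballI impI)
    show "\<Union>K \<subseteq> Omega" using K by (auto simp: Omega_open_def)
    fix \<gamma> assume g: "\<gamma> \<in> origin_curves" "curve_class \<gamma> \<in> \<Union>K"
    then obtain S where S: "S \<in> K" "curve_class \<gamma> \<in> S" by blast
    then obtain r where "r > 0" "\<forall>w\<in>ball (pathfinish \<gamma>) r. curve_class (curve_extend \<gamma> w) \<in> S"
      using K g(1) unfolding Omega_open_def by blast
    thus "\<exists>r>0. \<forall>w\<in>ball (pathfinish \<gamma>) r. curve_class (curve_extend \<gamma> w) \<in> \<Union>K"
      using S(1) by blast
  qed
qed

lemma openin_Omega_topology: "openin Omega_topology = Omega_open"
  unfolding Omega_topology_def by (rule topology_inverse'[OF istopology_Omega_open])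

lemma topspace_Omega_topology: "topspace Omega_topology = Omega"
proof
  show "topspace Omega_topology \<subseteq> Omega"
    using openin_topspace[of Omega_topology] by (simp add: openin_Omega_topology Omega_open_def)
  have "Omega_open Omega"
    unfolding Omega_open_def using curve_extend_in_origin_curves curve_class_in_Omega by blast
  thus "Omega \<subseteq> topspace Omega_topology"
    by (simp add: openin_subset flip: openin_Omega_topology)
qed

end

theory Submission
  imports Defs
begin

text \<open>
  Let \<open>F = \<^sub>2F\<^sub>1(1/2, 1/2; 1; _)\<close>, \<open>W(w) = - \<pi> F(1 - w) / F(w)\<close>, and write \<open>L(k) = 4k / (1 + k)\<^sup>2\<close> for Landen's
  transformation. The hypergeometric equation shows that \<open>exp W\<close> extends holomorphically to the unit disk,
  and \<open>W(k\<^sup>2) = 2 W(L(k))\<close> gives it the derivative \<open>1/16\<close> at \<open>0\<close>. Its local inverse \<open>\<phi>\<close> therefore satisfies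
  \<open>\<phi>(z) = L(\<kappa>(z))\<close> with \<open>\<kappa>(z)\<^sup>2 = \<phi>(z\<^sup>2)\<close>, which extends \<open>\<phi>\<close> from a disk of radius \<open>r\<^sup>2\<close> to one of radius \<open>r\<close>,
  hence to the whole unit disk, without new zeros and without the value \<open>1\<close>.

  That \<open>\<phi>\<close> is a covering of the plane without \<open>0\<close> and \<open>1\<close> by the punctured disk needs no modular group. Starting
  from a point \<open>x\<close> over a disk that avoids \<open>0\<close> and \<open>1\<close>, descend by Landen's transformation: this yields
  holomorphic functions on the disk which again avoid \<open>0\<close> and \<open>1\<close> and take at \<open>\<phi>(x)\<close> the values
  \<open>\<phi>(x\<^bsup>2^n\<^esup>) \<rightarrow> 0\<close>. By Schottky's theorem, applied to their reciprocals, they tend to \<open>0\<close> uniformly on a smaller disk.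
  So eventually the local inverse of \<open>\<phi>\<close> at \<open>0\<close> applies, and a \<open>2\<^sup>n\<close>-th root of the result is a branch of the
  inverse of \<open>\<phi>\<close> through \<open>x\<close> on a disk of fixed size.

  Curves from \<open>0\<close> consequently lift to the disk, and the endpoint of the lift is a bijection of \<open>\<Omega>\<close> onto the
  disk. It is the nome by the identity theorem, and the only normalized conformal map by Schwarz's lemma.
\<close>

section \<open>The hypergeometric function\<close>

text \<open>The closed form of the nome makes sense only on the lens, and what gets continued is not
  \<open>K\<close> but the inverse \<open>\<phi>\<close>. The descending Landen transformation
  squares the nome; hence \<open>\<phi>\<close> on a disk of radius r^2 determines
  \<open>\<phi>\<close> on radius r, and the same squaring drives every point of the disk towards 0,
  where \<open>\<phi>\<close> is invertible. Two numbers must come from the hypergeometric function: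
  Legendre's relation, whose constant 1/pi is the limit of n times the n-th coefficient, makes W -
  ln w regular at 0, and the functional equation then forces the derivative 1/16. Schottky's theorem
  yields a covering because it is uniform: its bound depends neither on the function nor on the
  number of descents, so all points over a disk have branches on one common smaller disk. The
  remaining obstacle is that curves start at a puncture of the base. Their initial piece is lifted
  by the local inverse at 0, and the covering takes over afterwards. In the disk, starting at 0 is
  what allows curves with different winding around 0 to be deformed into each other.\<close>

abbreviation (input) hyp_fps :: "complex fps" where
  "hyp_fps \<equiv> fps_hypergeo [1/2, 1/2] [1] 1"

text \<open>The squares of the central binomial coefficients, divided by 16^n. They are kept real
  because their sign, monotonicity and growth matter.\<close>

definition hyp_coeff :: "nat \<Rightarrow> real" where
  "hyp_coeff n = (pochhammer (1/2) n / fact n)\<^sup>2"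

definition hypF :: "complex \<Rightarrow> complex" where
  "hypF m = eval_fps hyp_fps m"

lemma ellipticK_hypF: "ellipticK m = of_real pi / 2 * hypF m"
  by (simp add: ellipticK_def hypF_def)

lemma hyp_fps_nth: "fps_nth hyp_fps n = of_real (hyp_coeff n)"
proof -
  have "of_real (pochhammer (1/2::real) n) = (pochhammer (1/2) n :: complex)"
    by (simp flip: pochhammer_of_real)
  moreover have "pochhammer (1::complex) n = fact n"
    by (simp add: pochhammer_fact)
  ultimately show ?thesis
    by (simp add: hyp_coeff_def power2_eq_square)
qed

lemma hyp_coeff_0 [simp]: "hyp_coeff 0 = 1"
  by (simp add: hyp_coeff_def)

lemma hyp_coeff_Suc: "real (Suc n) ^ 2 * hyp_coeff (Suc n) = (real n + 1/2)^2 * hyp_coeff n"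
proof -
  define f p where "f = (fact n :: real)" and "p = (pochhammer (1/2) n :: real)"
  have f: "f > 0" by (simp add: f_def)
  have "hyp_coeff (Suc n) = (p * (real n + 1/2) / (real (Suc n) * f))^2"
    by (simp add: hyp_coeff_def pochhammer_Suc f_def p_def add.commute)
  thus ?thesis using f by (simp add: hyp_coeff_def power_divide power_mult_distrib flip: f_def p_def)
qed

lemma hyp_coeff_pos: "hyp_coeff n > 0"
proof -
  have "pochhammer (1/2::real) n > 0" by (rule pochhammer_pos) simp
  thus ?thesis by (simp add: hyp_coeff_def)
qed

lemma hyp_coeff_decreasing: "hyp_coeff (Suc n) < hyp_coeff n"
proof -
  have "(real n + 1/2)^2 < real (Suc n) ^ 2" by (intro power_strict_mono) auto
  hence "real (Suc n) ^ 2 * hyp_coeff (Suc n) < real (Suc n) ^ 2 * hyp_coeff n"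
    unfolding hyp_coeff_Suc using hyp_coeff_pos[of n] by (intro mult_strict_right_mono)
  thus ?thesis by (simp add: mult_less_cancel_left)
qed

text \<open>The inverse square of \<open>Gamma_series'\<close> at 1/2 is
  \<open>n * hyp_coeff n\<close>, and Gamma(1/2)^2 = pi. The limit reappears as the constant of
  Legendre's relation.\<close>

lemma hyp_coeff_asymp: "(\<lambda>n. real n * hyp_coeff n) \<longlonglongrightarrow> 1 / pi"
proof -
  have "(\<lambda>n. 1 / (Gamma_series' (1/2::real) n)^2) \<longlonglongrightarrow> 1 / (Gamma (1/2))^2"
    by (intro tendsto_intros Gamma_series'_LIMSEQ) (auto simp: Gamma_one_half_real)
  moreover have "eventually (\<lambda>n. 1 / (Gamma_series' (1/2::real) n)^2 = real n * hyp_coeff n) sequentially"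
    using eventually_gt_at_top[of 0]
  proof eventually_elim
    case (elim n)
    have "exp (1/2 * ln (real n)) = sqrt (real n)"
      using elim by (simp add: powr_half_sqrt [symmetric] powr_def)
    moreover have "fact n = (real n * fact (n-1) :: real)" using elim by (simp add: fact_reduce)
    ultimately show ?case using elim
      by (simp add: Gamma_series'_def hyp_coeff_def power_divide power_mult_distrib field_simps power2_eq_square)
  qed
  ultimately have "(\<lambda>n. real n * hyp_coeff n) \<longlonglongrightarrow> 1 / (Gamma (1/2))^2"
    by (rule Lim_transform_eventually)
  thus ?thesis by (simp add: Gamma_one_half_real)
qed

lemma hyp_coeff_tendsto_0: "hyp_coeff \<longlonglongrightarrow> 0"
proof -
  have "(\<lambda>n. (real n * hyp_coeff n) * inverse (real n)) \<longlonglongrightarrow> (1/pi) * 0"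
    by (intro tendsto_mult hyp_coeff_asymp LIMSEQ_inverse_real_of_nat lim_inverse_n)
  moreover have "eventually (\<lambda>n. (real n * hyp_coeff n) * inverse (real n) = hyp_coeff n) sequentially"
    using eventually_gt_at_top[of 0] by eventually_elim simp
  ultimately show ?thesis using Lim_transform_eventually by fastforce
qed

lemma hyp_conv_radius: "fps_conv_radius hyp_fps = 1"
  unfolding fps_conv_radius_def
proof (rule conv_radius_ratio_limit_nonzero[of _ 1])
  have "norm (fps_nth hyp_fps n) / norm (fps_nth hyp_fps (Suc n)) = (real n + 1)^2 / (real n + 1/2)^2" for n
    using hyp_coeff_Suc[of n] hyp_coeff_pos[of n] hyp_coeff_pos[of "Suc n"]
    unfolding hyp_fps_nth by (simp add: field_simps)
  moreover have "(\<lambda>n. (real n + 1)^2 / (real n + 1/2)^2) \<longlonglongrightarrow> 1"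
  proof -
    have "(\<lambda>n. (1 + (1/2) * inverse (real n + 1/2))^2) \<longlonglongrightarrow> (1 + (1/2) * 0)^2"
      by (intro tendsto_intros tendsto_inverse_0_at_top filterlim_tendsto_add_at_top[OF tendsto_const filterlim_real_sequentially, of "1/2", simplified add.commute])
    moreover have "(1 + (1/2) * inverse (real n + 1/2))^2 = (real n + 1)^2 / (real n + 1/2)^2" for n
      by (subst power_divide [symmetric]) (simp add: field_simps)
    ultimately show ?thesis by simp
  qed
  ultimately show "(\<lambda>n. norm (fps_nth hyp_fps n) / norm (fps_nth hyp_fps (Suc n))) \<longlonglongrightarrow> 1"
    by presburger
qed (auto simp: one_ereal_def)

lemma hypF_sums:
  assumes "norm m < 1" shows "(\<lambda>n. of_real (hyp_coeff n) * m ^ n) sums hypF m"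
proof -
  have "ereal (norm m) < fps_conv_radius hyp_fps"
    using assms by (simp add: hyp_conv_radius one_ereal_def)
  from sums_eval_fps[OF this] show ?thesis
    by (simp only: hypF_def hyp_fps_nth)
qed

lemma hypF_holomorphic: "hypF holomorphic_on ball 0 1"
  unfolding hypF_def
  by (intro holomorphic_intros) (auto simp: hyp_conv_radius eball_def one_ereal_def)

lemma hypF_deriv: "norm m < 1 \<Longrightarrow> (hypF has_field_derivative deriv hypF m) (at m)"
  using holomorphic_derivI[OF hypF_holomorphic open_ball] by simp

lemma deriv_hypF_fps: "norm m < 1 \<Longrightarrow> deriv hypF m = eval_fps (fps_deriv hyp_fps) m"
  by (intro DERIV_imp_deriv) (auto simp: hypF_def[abs_def] hyp_conv_radius one_ereal_def intro!: has_field_derivative_eval_fps)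

lemma hypF_0 [simp]: "hypF 0 = 1"
  by (simp add: hypF_def eval_fps_at_0)

lemma deriv_hypF_sums:
  assumes "norm m < 1" shows "(\<lambda>n. of_real (real (Suc n) * hyp_coeff (Suc n)) * m ^ n) sums deriv hypF m"
proof -
  have "ereal (norm m) < fps_conv_radius (fps_deriv hyp_fps)"
    using assms less_le_trans[OF _ fps_conv_radius_deriv[of hyp_fps]]
    by (simp add: hyp_conv_radius one_ereal_def)
  from sums_eval_fps[OF this] show ?thesis
    unfolding deriv_hypF_fps[OF assms] fps_deriv_nth hyp_fps_nth of_real_mult by simp
qed

text \<open>The hypergeometric equation in the self-adjoint form (m (1 - m) F')' = F / 4; comparing
  coefficients gives the recursion \<open>hyp_coeff_Suc\<close>. Treating the flux m (1 - m) F' as a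
  unit lets the derivatives of Wronskians cancel without F''.\<close>

lemma hyp_ode_fps:
  "fps_deriv (fps_X * (1 - fps_X) * fps_deriv hyp_fps) = fps_const (1/4) * hyp_fps"
proof (rule fps_ext)
  fix n
  define a where "a = (\<lambda>n. complex_of_real (hyp_coeff n))"
  have nth: "fps_nth hyp_fps n = a n" for n by (simp only: hyp_fps_nth a_def)
  have rec: "of_nat (Suc n) ^ 2 * a (Suc n) = (of_nat n + 1/2)^2 * a n"
    using arg_cong[OF hyp_coeff_Suc[of n], of complex_of_real] by (simp add: a_def)
  have e: "fps_X * (1 - fps_X) * fps_deriv hyp_fps = fps_X * fps_deriv hyp_fps - fps_X * (fps_X * fps_deriv hyp_fps)"
    by (simp add: algebra_simps)
  have "fps_nth (fps_deriv (fps_X * (1 - fps_X) * fps_deriv hyp_fps)) n =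
     of_nat (Suc n) * (of_nat (Suc n) * a (Suc n) - of_nat n * a n)"
    unfolding e fps_deriv_nth fps_sub_nth fps_X_mult_nth nth by (cases n) (auto simp: nth)
  also have "\<dots> = 1/4 * a n" using rec by (simp add: power2_eq_square algebra_simps)
  also have "\<dots> = fps_nth (fps_const (1/4) * hyp_fps) n"
    by (simp only: fps_mult_left_const_nth nth)
  finally show "fps_nth (fps_deriv (fps_X * (1 - fps_X) * fps_deriv hyp_fps)) n = \<dots>" .
qed

lemma hypF_ode:
  assumes "norm m < 1"
  shows "((\<lambda>m. m * (1 - m) * deriv hypF m) has_field_derivative hypF m / 4) (at m)"
proof -
  define g where "g = fps_X * (1 - fps_X) * fps_deriv hyp_fps"
  have d: "fps_conv_radius (fps_deriv hyp_fps) \<ge> 1"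
    using fps_conv_radius_deriv[of hyp_fps] by (simp add: hyp_conv_radius)
  have x: "fps_conv_radius (fps_X * (1 - fps_X) :: complex fps) = \<infinity>"
    using fps_conv_radius_mult[of fps_X "1 - fps_X :: complex fps"] fps_conv_radius_diff[of 1 "fps_X :: complex fps"]
    by simp
  have x1: "fps_conv_radius (1 - fps_X :: complex fps) = \<infinity>"
    using fps_conv_radius_diff[of 1 "fps_X :: complex fps"] by simp
  have g: "fps_conv_radius g \<ge> 1"
    unfolding g_def using fps_conv_radius_mult[of "fps_X * (1 - fps_X)" "fps_deriv hyp_fps"] d x
    by simp
  have ev: "eval_fps g w = w * (1 - w) * deriv hypF w" if w: "norm w < 1" for w
  proof -
    have "ereal (norm w) < 1" using w by (simp add: one_ereal_def)
    hence r: "ereal (norm w) < fps_conv_radius (fps_deriv hyp_fps)" using d by order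
    show ?thesis
      unfolding g_def using r x x1 w
      by (simp add: eval_fps_mult eval_fps_diff deriv_hypF_fps)
  qed
  have "ereal (norm m) < fps_conv_radius g" using assms g less_le_trans[of "ereal (norm m)" 1] by (simp add: one_ereal_def)
  hence "(eval_fps g has_field_derivative eval_fps (fps_deriv g) m) (at m)"
    by (rule has_field_derivative_eval_fps)
  moreover have "eval_fps (fps_deriv g) m = hypF m / 4"
    unfolding g_def hyp_ode_fps using assms by (simp add: eval_fps_mult hyp_conv_radius one_ereal_def hypF_def)
  ultimately have "(eval_fps g has_field_derivative hypF m / 4) (at m)" by simp
  thus ?thesis
    by (rule has_field_derivative_transform_within_open[of _ _ _ "ball 0 1"])
       (use assms ev in auto)
qed

text \<open>As in the Enestrom--Kakeya theorem, \<open>(1 - m) F(m) = 1 - \<Sum>\<^sub>n (a\<^sub>n - a\<^sub>n\<^sub>+\<^sub>1) m\<^bsup>n+1\<^esup>\<close>,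
  where the subtracted coefficients are positive and add up to \<open>1\<close>.\<close>

lemma hypF_nonzero:
  assumes m: "norm m < 1" shows "hypF m \<noteq> 0"
proof
  assume 0: "hypF m = 0"
  define d where "d = (\<lambda>n. hyp_coeff n - hyp_coeff (Suc n))"
  have d: "d n > 0" for n using hyp_coeff_decreasing[of n] by (simp add: d_def)
  have sd: "d sums 1" unfolding d_def using telescope_sums'[OF hyp_coeff_tendsto_0] by simp
  have "(\<lambda>n. of_real (hyp_coeff (Suc n)) * m ^ Suc n) sums (hypF m - 1)"
    using hypF_sums[OF m] sums_Suc_iff[of "\<lambda>n. of_real (hyp_coeff n) * m ^ n" "hypF m - 1"] by simp
  from sums_diff[OF sums_mult[OF hypF_sums[OF m], of m] this]
  have "(\<lambda>n. of_real (d n) * m ^ Suc n) sums 1" by (simp add: 0 d_def algebra_simps)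
  hence "1 = norm (\<Sum>n. of_real (d n) * m ^ Suc n)" by (simp add: sums_iff)
  also have nle: "norm (of_real (d n) * m ^ Suc n) \<le> d n * norm m" for n
  proof -
    have "norm m ^ Suc n \<le> norm m" using m by (simp add: mult_left_le power_le_one)
    thus ?thesis using d[of n] by (simp add: norm_mult norm_power mult_left_mono)
  qed
  have s: "summable (\<lambda>n. d n * norm m)" using sd by (intro summable_mult2) (simp add: sums_iff)
  have "norm (\<Sum>n. of_real (d n) * m ^ Suc n) \<le> (\<Sum>n. d n * norm m)"
    using nle s by (rule norm_suminf_le)
  also have "\<dots> = norm m" using sums_mult2[OF sd, of "norm m"] by (simp add: sums_iff)
  finally show False using m by simp
qed

section \<open>Boundary values at 1 and Legendre's relation\<close>

lemma DERIV_chain'_eq: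
  "(f has_field_derivative a) (at (g x)) \<Longrightarrow> (g has_field_derivative b) (at x) \<Longrightarrow> c = a * b
    \<Longrightarrow> ((\<lambda>x. f (g x)) has_field_derivative c) (at x)"
  using DERIV_chain2 by blast

lemma eventually_at_left_1: "eventually (\<lambda>x. 0 < x \<and> x < 1) (at_left (1::real))"
  by (rule eventually_at_leftI[of 0]) auto

lemma norm_one_minus_of_real: "norm (1 - complex_of_real x) = \<bar>1 - x\<bar>"
  by (metis norm_of_real of_real_1 of_real_diff)

text \<open>The weights (1 - x) x^n are positive, add up to 1 and shift to infinity as x tends to 1,
  so the weighted mean of \<open>b\<close> tends to the limit of \<open>b\<close>.\<close>

lemma abel_mean:
  fixes b :: "nat \<Rightarrow> real"
  assumes b: "b \<longlonglongrightarrow> L"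
  shows "((\<lambda>x. (1 - x) * (\<Sum>n. b n * x ^ n)) \<longlongrightarrow> L) (at_left 1)"
proof (rule tendstoI)
  fix e :: real assume e: "e > 0"
  obtain N where N: "\<And>n. n \<ge> N \<Longrightarrow> \<bar>b n - L\<bar> < e / 2"
    using LIMSEQ_D[OF b, of "e/2"] e by auto
  define C where "C = (\<Sum>n<N. \<bar>b n - L\<bar>)"
  have C: "C \<ge> 0" by (simp add: C_def sum_nonneg)
  have "dist ((1 - x) * (\<Sum>n. b n * x ^ n)) L < e"
    if x: "0 < x" "x < 1" "(1 - x) * C < e / 2" for x
  proof -
    define c where "c = (\<lambda>n. (b n - L) * x ^ n)"
    \<comment> \<open>Majorant of \<open>c\<close>: the first \<open>N\<close> terms are estimated
      with x^n \<le> 1, and the factor 1 - x kills their sum \<open>C\<close>; the others are below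
      e/2 times the geometric series.\<close>
    define d where "d = (\<lambda>n. (if n < N then \<bar>b n - L\<bar> else 0) + e / 2 * x ^ n)"
    have geo: "(\<lambda>n. x ^ n) sums (1 / (1 - x))" using geometric_sums[of x] x by simp
    have d: "d sums (C + e / 2 * (1 / (1 - x)))"
      unfolding d_def C_def lessThan_def
      by (intro sums_add sums_mult geo) (use sums_If_finite[of "\<lambda>n. n < N" "\<lambda>n. \<bar>b n - L\<bar>"] in simp)
    have cd: "norm (c n) \<le> d n" for n
    proof (cases "n < N")
      case True
      have "\<bar>b n - L\<bar> * x ^ n \<le> \<bar>b n - L\<bar>" using x by (simp add: mult_left_le power_le_one)
      moreover have "0 \<le> e / 2 * x ^ n" using e x by simp
      ultimately show ?thesis using True x by (simp add: c_def d_def abs_mult)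
    next
      case False
      hence "\<bar>b n - L\<bar> * x ^ n \<le> e / 2 * x ^ n" using N[of n] x by (intro mult_right_mono) auto
      thus ?thesis using False x by (simp add: c_def d_def abs_mult)
    qed
    have sc: "summable c" using d cd by (intro summable_comparison_test'[of d 0 c]) (auto simp: sums_iff)
    have "(\<lambda>n. b n * x ^ n) sums (suminf c + L * (1 / (1 - x)))"
      using sums_add[OF summable_sums[OF sc] sums_mult[OF geo, of L]] by (simp add: c_def algebra_simps)
    hence "(1 - x) * (\<Sum>n. b n * x ^ n) - L = (1 - x) * suminf c"
      using x by (simp add: sums_iff field_simps)
    moreover have "norm (suminf c) \<le> C + e / 2 * (1 / (1 - x))"
      using norm_suminf_le[of c d, OF cd] d by (simp add: sums_iff)
    hence "(1 - x) * norm (suminf c) \<le> (1 - x) * (C + e / 2 * (1 / (1 - x)))"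
      using x by (intro mult_left_mono) auto
    moreover have "(1 - x) * (C + e / 2 * (1 / (1 - x))) = (1 - x) * C + e / 2"
      using x by (simp add: field_simps)
    ultimately have "norm ((1 - x) * (\<Sum>n. b n * x ^ n) - L) \<le> (1 - x) * C + e / 2"
      using x by (simp only: norm_mult) simp
    also have "\<dots> < e" using x by simp
    finally show ?thesis by (simp add: dist_norm)
  qed
  moreover have "eventually (\<lambda>x. 0 < x \<and> x < 1 \<and> (1 - x) * C < e / 2) (at_left (1::real))"
  proof (intro eventually_conj)
    show "eventually (\<lambda>x. 0 < x) (at_left (1::real))" "eventually (\<lambda>x. x < 1) (at_left (1::real))"
      using eventually_at_left_1 by (auto elim: eventually_mono)
    have "((\<lambda>x. (1 - x) * C) \<longlongrightarrow> (1 - 1) * C) (at_left 1)" by (intro tendsto_intros)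
    thus "eventually (\<lambda>x. (1 - x) * C < e / 2) (at_left 1)" by (rule order_tendstoD) (use e in simp)
  qed
  ultimately show "eventually (\<lambda>x. dist ((1 - x) * (\<Sum>n. b n * x ^ n)) L < e) (at_left 1)"
    by (auto elim: eventually_mono)
qed

text \<open>Meant for F' and F, whose coefficients tend to 1/pi and 0: then (1 - x) F'(x) tends to
  1/pi and (1 - x) F(x) to 0, although F is unbounded at 1.\<close>

lemma powser_of_real_at_left_1:
  fixes f :: "complex \<Rightarrow> complex" and b :: "nat \<Rightarrow> real"
  assumes f: "\<And>z. norm z < 1 \<Longrightarrow> (\<lambda>n. of_real (b n) * z ^ n) sums f z" and b: "b \<longlonglongrightarrow> L"
  shows "((\<lambda>x. of_real (1 - x) * f (of_real x)) \<longlongrightarrow> of_real L) (at_left 1)"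
proof -
  have "((\<lambda>x. complex_of_real ((1 - x) * (\<Sum>n. b n * x ^ n))) \<longlongrightarrow> of_real L) (at_left 1)"
    by (intro tendsto_of_real abel_mean b)
  moreover have "eventually (\<lambda>x. complex_of_real ((1 - x) * (\<Sum>n. b n * x ^ n)) = of_real (1 - x) * f (of_real x)) (at_left 1)"
  proof -
    have "eventually (\<lambda>x. 0 < x \<and> x < 1) (at_left (1::real))"
      by (rule eventually_at_left_1)
    thus ?thesis
    proof eventually_elim
      case (elim x)
      have "(\<lambda>n. complex_of_real (b n * x ^ n)) sums f (of_real x)" using f[of "of_real x"] elim by simp
      moreover from sums_Re[OF this] have "(\<lambda>n. b n * x ^ n) sums Re (f (of_real x))"
        by simp
      hence "(\<lambda>n. complex_of_real (b n * x ^ n)) sums of_real (\<Sum>n. b n * x ^ n)"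
        by (intro sums_of_real summable_sums) (rule sums_summable)
      ultimately have "f (of_real x) = of_real (\<Sum>n. b n * x ^ n)"
        by (rule sums_unique2)
      thus ?case by simp
    qed
  qed
  ultimately show ?thesis by (rule Lim_transform_eventually)
qed

lemma deriv_hypF_0: "deriv hypF 0 = 1 / 4"
proof -
  have "hyp_coeff (Suc 0) = 1/4" using hyp_coeff_Suc[of 0] by (simp add: power2_eq_square)
  moreover have "deriv hypF 0 = of_real (real (Suc 0) * hyp_coeff (Suc 0))"
    by (rule sums_unique2[OF deriv_hypF_sums powser_sums_zero]) simp
  ultimately show ?thesis by (metis Suc_eq_plus1 add_0 mult_1 of_nat_1 of_real_1 of_real_divide of_real_numeral One_nat_def)
qed

text \<open>The Wronskian of F(1 - w) and F(w), two solutions of the same equation, times the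
  leading coefficient w (1 - w). The plus sign is due to the inner derivative -1.\<close>

definition hyp_wronskian :: "complex \<Rightarrow> complex" where
  "hyp_wronskian w = w * (1 - w) * (deriv hypF w * hypF (1 - w) + hypF w * deriv hypF (1 - w))"

text \<open>A form of Legendre's relation. The self-adjoint equation makes the expression constant
  on the lens; its value is the limit for real w tending to 1, where only the term with F'(w)
  survives.\<close>

lemma hyp_wronskian_eq:
  assumes w: "w \<in> ball 0 1 \<inter> ball 1 1"
  shows "hyp_wronskian w = 1 / of_real pi"
proof -
  let ?L = "ball 0 1 \<inter> ball (1::complex) 1"
  have "(hyp_wronskian has_field_derivative 0) (at w)" if "w \<in> ?L" for w
  proof -
    have n: "norm w < 1" "norm (1 - w) < 1" using that by (auto simp: dist_norm)
    define S where "S = (\<lambda>w. w * (1 - w) * deriv hypF w)"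
    have S: "(S has_field_derivative hypF w / 4) (at w)"
      unfolding S_def by (rule hypF_ode[OF n(1)])
    have S': "((\<lambda>w. S (1 - w)) has_field_derivative - (hypF (1 - w) / 4)) (at w)"
      unfolding S_def
      by (rule DERIV_chain'_eq[where f = "\<lambda>m. m * (1 - m) * deriv hypF m" and g = "\<lambda>w. 1 - w", OF hypF_ode[OF n(2)]])
         (auto intro!: derivative_eq_intros)
    have F': "((\<lambda>w. hypF (1 - w)) has_field_derivative - deriv hypF (1 - w)) (at w)"
      by (rule DERIV_chain'_eq[where f = hypF and g = "\<lambda>w. 1 - w", OF hypF_deriv[OF n(2)]])
         (auto intro!: derivative_eq_intros)
    have eq: "hyp_wronskian = (\<lambda>w. S w * hypF (1 - w) + hypF w * S (1 - w))"
      by (auto simp: hyp_wronskian_def S_def algebra_simps)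
    have "((\<lambda>w. S w * hypF (1 - w) + hypF w * S (1 - w)) has_field_derivative
       (hypF w / 4 * hypF (1 - w) + (- deriv hypF (1 - w)) * S w) +
       (deriv hypF w * S (1 - w) + (- (hypF (1 - w) / 4)) * hypF w)) (at w)"
      by (intro DERIV_add DERIV_mult S S' F' hypF_deriv n)
    thus ?thesis unfolding eq by (simp add: S_def algebra_simps)
  qed
  moreover have "open ?L" "convex ?L" by (auto intro: convex_Int)
  ultimately obtain c where c: "\<And>w. w \<in> ?L \<Longrightarrow> hyp_wronskian w = c"
    using has_field_derivative_zero_constant[of ?L hyp_wronskian] by (metis has_field_derivative_at_within)
  have real_left: "((\<lambda>x::real. f (1 - of_real x)) \<longlongrightarrow> f 0) (at_left 1)" if "isCont f 0" for f :: "complex \<Rightarrow> complex"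
  proof -
    have "((\<lambda>x::real. 1 - complex_of_real x) \<longlongrightarrow> 1 - of_real 1) (at_left 1)" by (intro tendsto_intros)
    thus ?thesis using isCont_tendsto_compose[OF that] by simp
  qed
  have "isCont (deriv hypF) 0"
    using holomorphic_on_imp_continuous_on[OF holomorphic_deriv[OF hypF_holomorphic open_ball]]
    by (simp add: continuous_on_eq_continuous_at)
  moreover have "isCont hypF 0" using hypF_deriv[of 0] DERIV_isCont by auto
  ultimately have r: "((\<lambda>x::real. deriv hypF (1 - of_real x)) \<longlongrightarrow> 1/4) (at_left 1)"
     "((\<lambda>x::real. hypF (1 - of_real x)) \<longlongrightarrow> 1) (at_left 1)"
    using real_left deriv_hypF_0 hypF_0 by metis+
  \<comment> \<open>The factor 1 - x is attached to F'(x) and F(x), which blow up; F(1 - x) and F'(1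
    - x) tend to 1 and 1/4.\<close>
  have "((\<lambda>x::real. of_real x * ((of_real (1 - x) * deriv hypF (of_real x)) * hypF (1 - of_real x)
      + (of_real (1 - x) * hypF (of_real x)) * deriv hypF (1 - of_real x))) \<longlongrightarrow>
      of_real 1 * (of_real (1 / pi) * 1 + of_real 0 * (1 / 4))) (at_left 1)"
    by (intro tendsto_mult tendsto_add tendsto_of_real tendsto_ident_at r
          powser_of_real_at_left_1[OF deriv_hypF_sums LIMSEQ_Suc[OF hyp_coeff_asymp]]
          powser_of_real_at_left_1[OF hypF_sums hyp_coeff_tendsto_0])
  moreover have "eventually (\<lambda>x::real. of_real x * ((of_real (1 - x) * deriv hypF (of_real x)) * hypF (1 - of_real x)
      + (of_real (1 - x) * hypF (of_real x)) * deriv hypF (1 - of_real x)) = c) (at_left 1)"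
  proof -
    have "eventually (\<lambda>x. 0 < x \<and> x < 1) (at_left (1::real))"
      by (rule eventually_at_left_1)
    thus ?thesis
    proof eventually_elim
      case (elim x)
      hence "norm (1 - complex_of_real x) < 1"
        by (simp add: norm_one_minus_of_real)
      hence "of_real x \<in> ?L" using elim by (auto simp: dist_norm)
      from c[OF this, symmetric] show ?case by (simp only:) (simp add: hyp_wronskian_def algebra_simps)
    qed
  qed
  ultimately have "((\<lambda>x::real. c) \<longlongrightarrow> of_real 1 * (of_real (1 / pi) * 1 + of_real 0 * (1 / 4))) (at_left 1)"
    by (rule Lim_transform_eventually)
  hence "c = of_real (1 / pi)" by (simp add: tendsto_const_iff)
  thus ?thesis using c[OF w] by simp
qed

section \<open>Landen's transformation\<close>

definition landen :: "complex \<Rightarrow> complex" where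
  "landen x = 4 * x / (1 + x)\<^sup>2"

lemma one_minus_landen: "x \<noteq> -1 \<Longrightarrow> 1 - landen x = ((1 - x) / (1 + x))\<^sup>2"
  by (simp add: landen_def power2_eq_square divide_simps add_eq_0_iff) (simp add: algebra_simps)

lemma landen_deriv:
  assumes "x \<noteq> -1"
  shows "(landen has_field_derivative 4 * (1 - x) / (1 + x) ^ 3) (at x)"
proof -
  have "1 + x \<noteq> 0" using assms by (metis add_eq_0_iff2 minus_unique)
  thus ?thesis unfolding landen_def
    by (auto intro!: derivative_eq_intros simp: power2_eq_square power3_eq_cube divide_simps)
       (simp add: algebra_simps)
qed

text \<open>With P = x (1 - x) / (1 + x) this reads L (1 - L) = P L' for L = \<open>landen\<close>.
  It identifies the flux m (1 - m) F'(m) at m = L(x) with P times the derivative of F(L(x)).\<close>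

lemma landen_mult_one_minus_landen:
  fixes x :: complex
  shows "4 * x / (1 + x)\<^sup>2 * ((1 - x) / (1 + x))\<^sup>2 = x * (1 - x) / (1 + x) * (4 * (1 - x) / (1 + x) ^ 3)"
proof -
  define u v where "u = 1 + x" and "v = 1 - x"
  have "4 * x / u\<^sup>2 * (v / u)\<^sup>2 = x * v / u * (4 * v / u ^ 3)"
    by (simp add: power_divide power2_eq_square power3_eq_cube ac_simps)
  thus ?thesis by (simp only: u_def v_def)
qed

text \<open>The left side is P y' for y = (1 + x) F(x^2), where \<open>h\<close> and
  \<open>d\<close> stand for F and F' at x^2. On the right the flux of F at x^2 appears, whose
  derivative is known from \<open>hypF_ode\<close>.\<close>

lemma landen_flux_square:
  fixes x h d :: complex
  assumes "1 + x \<noteq> 0"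
  shows "x * (1 - x) / (1 + x) * (h + (1 + x) * (d * (2 * x))) =
    x * (1 - x) / (1 + x) * h + 2 / (1 + x) * (x\<^sup>2 * (1 - x\<^sup>2) * d)"
proof -
  define u v where "u = 1 + x" and "v = 1 - x"
  have 1: "1 - x\<^sup>2 = u * v" by (simp add: u_def v_def power2_eq_square algebra_simps)
  have "u \<noteq> 0" using assms by (simp add: u_def)
  hence "x * v / u * (h + u * (d * (2 * x))) = x * v / u * h + 2 / u * (x\<^sup>2 * (u * v) * d)"
    by (simp add: power2_eq_square field_simps)
  thus ?thesis unfolding 1 by (simp only: u_def v_def)
qed

text \<open>The derivative of the flux P y' of y = (1 + x) F(x^2), with the equation of F inserted,
  is Q y for Q = (1 - x) / (1 + x)^3. Naming 1 + x and 1 - x keeps them atomic during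
  simplification.\<close>

lemma landen_flux_square_deriv:
  fixes x h d :: complex
  assumes x: "1 + x \<noteq> 0"
  shows "(1 - 2 * x - x\<^sup>2) / (1 + x)\<^sup>2 * h + x * (1 - x) / (1 + x) * (d * (2 * x)) +
         ((- 2 / (1 + x)\<^sup>2) * (x\<^sup>2 * (1 - x\<^sup>2) * d) + 2 / (1 + x) * (h / 4 * (2 * x))) =
         (1 - x) / (1 + x) ^ 3 * ((1 + x) * h)"
proof -
  define u v where "u = 1 + x" and "v = 1 - x"
  have 1: "1 - x\<^sup>2 = u * v" by (simp add: u_def v_def power2_eq_square algebra_simps)
  have u: "u \<noteq> 0" using x by (simp add: u_def)
  have 2: "1 - 2 * x - x\<^sup>2 = v - x * u" by (simp add: u_def v_def power2_eq_square algebra_simps)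
  have "(v - x * u) / u\<^sup>2 * h + x * v / u * (d * (2 * x)) +
         ((- 2 / u\<^sup>2) * (x\<^sup>2 * (u * v) * d) + 2 / u * (h / 4 * (2 * x))) = v / u ^ 3 * (u * h)"
    using u by (simp add: power2_eq_square power3_eq_cube field_simps)
  thus ?thesis unfolding 1 2 by (simp only: u_def v_def)
qed

text \<open>Both sides solve \<open>(P y')' = Q y\<close> with \<open>P = x (1 - x) / (1 + x)\<close> and \<open>Q = (1 - x) / (1 + x)\<^sup>3\<close>.
  As \<open>P\<close> vanishes at \<open>0\<close>, so does their Wronskian, whence they are proportional.\<close>

lemma hypF_landen:
  assumes s: "convex s" "0 \<in> s" "\<And>x. x \<in> s \<Longrightarrow> norm x < 1 \<and> norm (landen x) < 1" and x: "x \<in> s"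
  shows "hypF (landen x) = (1 + x) * hypF (x\<^sup>2)"
proof -
  define A where "A = (\<lambda>x. hypF (landen x))"
  define B where "B = (\<lambda>x. (1 + x) * hypF (x\<^sup>2))"
  define A' where "A' = (\<lambda>x. deriv hypF (landen x) * (4 * (1 - x) / (1 + x) ^ 3))"
  define B' where "B' = (\<lambda>x. hypF (x\<^sup>2) + (1 + x) * (deriv hypF (x\<^sup>2) * (2 * x)))"
  define P where "P = (\<lambda>x::complex. x * (1 - x) / (1 + x))"
  define Q where "Q = (\<lambda>x::complex. (1 - x) / (1 + x) ^ 3)"
  define S where "S = (\<lambda>m. m * (1 - m) * deriv hypF m)"
  have n: "norm x < 1" "norm (landen x) < 1" "norm (x\<^sup>2) < 1" "1 + x \<noteq> 0" "x \<noteq> -1" "x \<noteq> 1" if "x \<in> s" for x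
  proof -
    show 1: "norm x < 1" "norm (landen x) < 1" using s(3) that by auto
    thus "norm (x\<^sup>2) < 1" by (simp add: norm_power power_less_one_iff)
    show "x \<noteq> -1" "x \<noteq> 1" using 1 by auto
    thus "1 + x \<noteq> 0" by (metis add_eq_0_iff2 minus_unique)
  qed
  have dA: "(A has_field_derivative A' x) (at x)" if "x \<in> s" for x
    unfolding A_def A'_def using n[OF that]
    by (intro DERIV_chain'_eq[where f = hypF and g = landen, OF hypF_deriv landen_deriv]) auto
  have dF2: "((\<lambda>x. hypF (x\<^sup>2)) has_field_derivative deriv hypF (x\<^sup>2) * (2 * x)) (at x)" if "x \<in> s" for x
    by (rule DERIV_chain'_eq[where f = hypF and g = "\<lambda>x. x\<^sup>2", OF hypF_deriv[OF n(3)[OF that]]])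
       (auto intro!: derivative_eq_intros)
  have dB: "(B has_field_derivative B' x) (at x)" if "x \<in> s" for x
  proof -
    have "((\<lambda>x. 1 + x) has_field_derivative 1) (at x)" by (auto intro!: derivative_eq_intros)
    from DERIV_mult[OF this dF2[OF that]] show ?thesis
      by (simp add: B_def B'_def mult.commute)
  qed
  have PA: "P x * A' x = S (landen x)" if "x \<in> s" for x
  proof -
    have "landen x * (1 - landen x) = P x * (4 * (1 - x) / (1 + x) ^ 3)"
      unfolding one_minus_landen[OF n(5)[OF that]]
      unfolding landen_def P_def by (rule landen_mult_one_minus_landen)
    thus ?thesis by (simp add: S_def A'_def)
  qed
  have PB: "P x * B' x = P x * hypF (x\<^sup>2) + 2 / (1 + x) * S (x\<^sup>2)" if "x \<in> s" for x
    unfolding P_def B'_def S_def by (rule landen_flux_square[OF n(4)[OF that]])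
  have dPA: "((\<lambda>x. S (landen x)) has_field_derivative Q x * A x) (at x)" if "x \<in> s" for x
  proof -
    have "Q x * A x = hypF (landen x) / 4 * (4 * (1 - x) / (1 + x) ^ 3)"
    proof -
      have "4 * (1 - x) / (1 + x) ^ 3 = 4 * Q x" by (simp only: Q_def times_divide_eq_right)
      thus ?thesis by (simp only: A_def) simp
    qed
    thus ?thesis
      unfolding S_def
      by (rule DERIV_chain'_eq[where f = "\<lambda>m. m * (1 - m) * deriv hypF m" and g = landen,
            OF hypF_ode[OF n(2)[OF that]] landen_deriv[OF n(5)[OF that]]])
  qed
  have dPB: "((\<lambda>x. P x * hypF (x\<^sup>2) + 2 / (1 + x) * S (x\<^sup>2)) has_field_derivative Q x * B x) (at x)" if "x \<in> s" for x
  proof -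
    have 1: "((\<lambda>x. S (x\<^sup>2)) has_field_derivative hypF (x\<^sup>2) / 4 * (2 * x)) (at x)"
      unfolding S_def
      by (rule DERIV_chain'_eq[where f = "\<lambda>m. m * (1 - m) * deriv hypF m" and g = "\<lambda>x. x\<^sup>2", OF hypF_ode[OF n(3)[OF that]]])
         (auto intro!: derivative_eq_intros)
    note 2 = dF2[OF that]
    have 3: "(P has_field_derivative (1 - 2 * x - x\<^sup>2) / (1 + x)\<^sup>2) (at x)"
      unfolding P_def using n(4)[OF that]
      by (auto intro!: derivative_eq_intros simp: power2_eq_square divide_simps) (simp add: algebra_simps)
    have 4: "((\<lambda>x. 2 / (1 + x)) has_field_derivative (- 2 / (1 + x)\<^sup>2)) (at x)"
      using n(4)[OF that] by (auto intro!: derivative_eq_intros simp: power2_eq_square)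
    have "((\<lambda>x. P x * hypF (x\<^sup>2) + 2 / (1 + x) * S (x\<^sup>2)) has_field_derivative
        ((1 - 2 * x - x\<^sup>2) / (1 + x)\<^sup>2 * hypF (x\<^sup>2) + P x * (deriv hypF (x\<^sup>2) * (2 * x)) +
         ((- 2 / (1 + x)\<^sup>2) * S (x\<^sup>2) + 2 / (1 + x) * (hypF (x\<^sup>2) / 4 * (2 * x))))) (at x)"
      using DERIV_add[OF DERIV_mult[OF 3 2] DERIV_mult[OF 4 1]] by (simp only: ac_simps)
    moreover have "(1 - 2 * x - x\<^sup>2) / (1 + x)\<^sup>2 * hypF (x\<^sup>2) + P x * (deriv hypF (x\<^sup>2) * (2 * x)) +
         ((- 2 / (1 + x)\<^sup>2) * S (x\<^sup>2) + 2 / (1 + x) * (hypF (x\<^sup>2) / 4 * (2 * x))) = Q x * B x"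
      unfolding P_def S_def Q_def B_def by (rule landen_flux_square_deriv[OF n(4)[OF that]])
    ultimately show ?thesis by simp
  qed
  \<comment> \<open>\<open>P\<close> times the Wronskian of \<open>A\<close> and \<open>B\<close>,
    written with the fluxes, whose derivatives are \<open>Q x * A x\<close> and
    \<open>Q x * B x\<close>.\<close>
  define D where "D = (\<lambda>x. S (landen x) * B x - A x * (P x * hypF (x\<^sup>2) + 2 / (1 + x) * S (x\<^sup>2)))"
  have "(D has_field_derivative 0) (at x within s)" if "x \<in> s" for x
  proof (rule has_field_derivative_at_within)
    have "Q x * A x * B x + S (landen x) * B' x -
       (A' x * (P x * hypF (x\<^sup>2) + 2 / (1 + x) * S (x\<^sup>2)) + A x * (Q x * B x)) = 0"
      unfolding PB[OF that, symmetric] PA[OF that, symmetric] by (simp add: algebra_simps)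
    thus "(D has_field_derivative 0) (at x)"
      unfolding D_def
      using DERIV_diff[OF DERIV_mult[OF dPA dB] DERIV_mult[OF dA dPB], OF that that that that]
      by (simp only: ac_simps)
  qed
  then obtain c where c: "\<And>x. x \<in> s \<Longrightarrow> D x = c"
    using has_field_derivative_zero_constant[OF s(1), of D] by blast
  have "D 0 = 0" by (simp add: D_def S_def P_def landen_def)
  hence D0: "D x = 0" if "x \<in> s" for x using c s(2) that by metis
  have W: "A' x * B x = A x * B' x" if "x \<in> s" for x
  proof (cases "x = 0")
    \<comment> \<open>Since \<open>P 0 = 0\<close>, nothing can be cancelled at 0; there both
      derivatives are equal to 1.\<close>
    case True thus ?thesis by (simp add: A'_def B_def A_def B'_def landen_def deriv_hypF_0)
  next
    case False
    hence "P x \<noteq> 0" using n[OF that] by (simp add: P_def)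
    moreover have "P x * (A' x * B x) = P x * (A x * B' x)"
      using D0[OF that] unfolding D_def PB[OF that, symmetric] PA[OF that, symmetric] by (simp add: algebra_simps)
    ultimately show ?thesis by simp
  qed
  have nB: "B x \<noteq> 0" if "x \<in> s" for x
    unfolding B_def using n[OF that] hypF_nonzero by simp
  have "((\<lambda>x. A x / B x) has_field_derivative 0) (at x within s)" if "x \<in> s" for x
    using DERIV_divide[OF dA[OF that] dB[OF that] nB[OF that]] unfolding W[OF that]
    by (simp add: has_field_derivative_at_within)
  then obtain c' where c': "\<And>x. x \<in> s \<Longrightarrow> A x / B x = c'"
    using has_field_derivative_zero_constant[OF s(1), of "\<lambda>x. A x / B x"] by blast
  have "A 0 / B 0 = 1" by (simp add: A_def B_def landen_def)
  hence "A x / B x = 1" using c' s(2) x by metis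
  thus ?thesis using nB[OF x] by (simp add: A_def B_def)
qed

section \<open>The nome near the origin\<close>

lemma islimpt_0_of_real:
  assumes "d > 0" shows "(0::complex) islimpt (of_real ` {0<..<d})"
  unfolding islimpt_approachable
proof (intro allI impI)
  fix e :: real assume "e > 0"
  hence "0 < min (d / 2) (e / 2)" "min (d / 2) (e / 2) < d" "min (d / 2) (e / 2) < e" using assms by auto
  thus "\<exists>x'\<in>complex_of_real ` {0<..<d}. x' \<noteq> 0 \<and> dist x' 0 < e"
    by (intro bexI[of _ "of_real (min (d / 2) (e / 2))"]) (auto simp del: of_real_divide)
qed

lemma landen_of_real:
  fixes k :: real assumes "0 < k" "k < 1"
  shows "landen (of_real k) = of_real (4 * k / (1 + k)\<^sup>2)" "0 < 4 * k / (1 + k)\<^sup>2" "4 * k / (1 + k)\<^sup>2 < 1"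
proof -
  show "landen (of_real k) = of_real (4 * k / (1 + k)\<^sup>2)" by (simp add: landen_def)
  show "0 < 4 * k / (1 + k)\<^sup>2" using assms by simp
  have "0 < (1 - k)\<^sup>2" using assms by simp
  hence "4 * k < (1 + k)\<^sup>2" by (simp add: power2_eq_square algebra_simps)
  thus "4 * k / (1 + k)\<^sup>2 < 1" using assms by simp
qed

lemma hypF_landen_real:
  fixes k :: real assumes k: "0 < k" "k < 1"
  shows "hypF (landen (of_real k)) = (1 + of_real k) * hypF ((of_real k)\<^sup>2)"
proof (rule hypF_landen[where s = "of_real ` {0..<1}"])
  show "convex (complex_of_real ` {0..<1})"
    by (intro convex_linear_image linear_of_real) auto
  fix x assume "x \<in> complex_of_real ` {0..<1}"
  then obtain r where r: "x = of_real r" "0 \<le> r" "r < 1" by auto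
  show "norm x < 1 \<and> norm (landen x) < 1"
  proof (cases "r = 0")
    case False
    thus ?thesis using r landen_of_real[of r] by (auto simp del: of_real_divide)
  qed (use r in \<open>simp add: landen_def\<close>)
qed (use k in auto)

text \<open>The involution taking k to j = (1 - k) / (1 + k) turns 1 - L(k) into j^2 and 1 - L(j)
  into k^2 for L = \<open>landen\<close>. So this is \<open>hypF_landen_real\<close> for
  \<open>j\<close>, and (1 + j) (1 + k) = 2 gives the factor. Together the two identities say that
  F(1 - w) / F(w) at w = L(k) is half of its value at k^2.\<close>

lemma hypF_landen_compl_real:
  fixes k :: real assumes k: "0 < k" "k < 1"
  shows "2 * hypF (1 - landen (of_real k)) = (1 + of_real k) * hypF (1 - (of_real k)\<^sup>2)"
proof -
  define j where "j = (1 - k) / (1 + k)"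
  have j: "0 < j" "j < 1" using k by (auto simp: j_def)
  have jk: "(1 + of_real j) * (1 + of_real k) = (2 :: complex)"
  proof -
    have "(1 + j) * (1 + k) = 2" using k by (simp add: j_def field_simps)
    from arg_cong[OF this, of complex_of_real] show ?thesis by simp
  qed
  have k1: "of_real k \<noteq> (-1::complex)" using k by (metis of_real_eq_iff of_real_minus of_real_1 less_asym zero_less_one neg_less_0_iff_less)
  have j1: "of_real j \<noteq> (-1::complex)" using j by (metis of_real_eq_iff of_real_minus of_real_1 less_asym zero_less_one neg_less_0_iff_less)
  have 1: "1 - landen (of_real k) = (of_real j)\<^sup>2"
    unfolding one_minus_landen[OF k1] by (simp add: j_def)
  have "(1 - j) / (1 + j) = k" using k by (simp add: j_def divide_simps)
  from arg_cong[OF this, of complex_of_real] have "(1 - of_real j) / (1 + of_real j) = complex_of_real k"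
    by simp
  hence "1 - landen (of_real j) = (of_real k)\<^sup>2"
    unfolding one_minus_landen[OF j1] by simp
  hence 2: "landen (of_real j) = 1 - (of_real k)\<^sup>2" by (metis diff_diff_eq2 add_diff_cancel_left')
  have "hypF (1 - (of_real k)\<^sup>2) = (1 + of_real j) * hypF (1 - landen (of_real k))"
    using hypF_landen_real[OF j] by (simp only: 1 2)
  hence "(1 + of_real k) * hypF (1 - (of_real k)\<^sup>2) =
      ((1 + of_real j) * (1 + of_real k)) * hypF (1 - landen (of_real k))" by (simp only: ac_simps)
  thus ?thesis unfolding jk by simp
qed

text \<open>On the lens, \<open>W = - \<pi> F(1 - w) / F(w)\<close> is \<open>ln w\<close> plus a function \<open>E\<close> holomorphic on the unit disk,
  because \<open>W' = 1 / (w (1 - w) F(w)\<^sup>2)\<close>. Landen's transformation gives \<open>W(k\<^sup>2) = 2 W(4k/(1+k)\<^sup>2)\<close>, which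
  determines \<open>E(0)\<close>.\<close>

lemma nome_near_0:
  obtains \<psi>0 where "\<psi>0 holomorphic_on ball 0 1" "\<psi>0 0 = 0" "deriv \<psi>0 0 = 1 / 16"
    "\<And>w. w \<in> ball 0 1 \<inter> ball 1 1 \<Longrightarrow> \<psi>0 w = exp (- of_real pi * (ellipticK (1 - w) / ellipticK w))"
    "\<And>x. norm x < 1 / 8 \<Longrightarrow> \<psi>0 (x\<^sup>2) = (\<psi>0 (landen x))\<^sup>2"
proof -
  let ?L = "ball 0 1 \<inter> ball (1::complex) 1"
  \<comment> \<open>Legendre's relation will give W' = h / w on the lens. As \<open>h 0 = 1\<close>,
    this is 1 / w + e with the difference quotient \<open>e\<close> of \<open>h\<close>, which is
    holomorphic at 0; so \<open>Ln w + E w\<close> has the same derivative as W.\<close>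
  define h where "h = (\<lambda>w. 1 / ((1 - w) * (hypF w)\<^sup>2))"
  have h: "h holomorphic_on ball 0 1"
    unfolding h_def using hypF_nonzero by (intro holomorphic_intros hypF_holomorphic) auto
  define e where "e = (\<lambda>w. if w = 0 then deriv h 0 else (h w - h 0) / (w - 0))"
  have "e holomorphic_on ball 0 1" unfolding e_def by (rule pole_lemma[OF h]) simp
  then obtain E where E': "\<And>w. w \<in> ball 0 1 \<Longrightarrow> (E has_field_derivative e w) (at w within ball 0 1)"
    using holomorphic_convex_primitive'[of "ball 0 1" e] by auto
  hence E: "(E has_field_derivative e w) (at w)" if "norm w < 1" for w
    using that at_within_open[of w "ball 0 1"] by (metis mem_ball_0 open_ball)
  define W where "W = (\<lambda>w. - of_real pi * (hypF (1 - w) / hypF w))"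
  have L: "norm w < 1" "norm (1 - w) < 1" "w \<noteq> 0" "w \<notin> \<real>\<^sub>\<le>\<^sub>0" if "w \<in> ?L" for w
  proof -
    show 1: "norm w < 1" "norm (1 - w) < 1" using that by (auto simp: dist_norm)
    have "1 - Re w \<le> norm (1 - w)" using complex_Re_le_cmod[of "1 - w"] by simp
    hence "Re w > 0" using 1 by linarith
    thus "w \<noteq> 0" "w \<notin> \<real>\<^sub>\<le>\<^sub>0" by (auto simp: complex_nonpos_Reals_iff)
  qed
  have dW: "(W has_field_derivative h w / w) (at w)" if w: "w \<in> ?L" for w
  proof -
    note n = L[OF w]
    have n1: "1 - w \<noteq> 0" using n by auto
    have "((\<lambda>w. hypF (1 - w)) has_field_derivative - deriv hypF (1 - w)) (at w)"
      by (rule DERIV_chain'_eq[where f = hypF and g = "\<lambda>w. 1 - w", OF hypF_deriv[OF n(2)]])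
         (auto intro!: derivative_eq_intros)
    from DERIV_cmult[OF DERIV_divide[OF this hypF_deriv[OF n(1)] hypF_nonzero[OF n(1)]], of "- of_real pi"]
    have "(W has_field_derivative - of_real pi *
       ((- deriv hypF (1 - w) * hypF w - hypF (1 - w) * deriv hypF w) / (hypF w * hypF w))) (at w)"
      unfolding W_def .
    moreover have "- deriv hypF (1 - w) * hypF w - hypF (1 - w) * deriv hypF w =
       - (deriv hypF w * hypF (1 - w) + hypF w * deriv hypF (1 - w))" by simp
    ultimately have "(W has_field_derivative of_real pi * ((deriv hypF w * hypF (1 - w) + hypF w * deriv hypF (1 - w)) / (hypF w)\<^sup>2)) (at w)"
      by (simp only: power2_eq_square minus_divide_left [symmetric] minus_mult_minus)
    moreover have "of_real pi * ((deriv hypF w * hypF (1 - w) + hypF w * deriv hypF (1 - w)) / (hypF w)\<^sup>2) = h w / w"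
    proof -
      have "(deriv hypF w * hypF (1 - w) + hypF w * deriv hypF (1 - w)) = 1 / (of_real pi * (w * (1 - w)))"
        using hyp_wronskian_eq[OF w] n(3) n1 unfolding hyp_wronskian_def by (simp add: field_simps)
      thus ?thesis unfolding h_def using n(3) n1 hypF_nonzero[OF n(1)]
        by (simp only:) simp
    qed
    ultimately show ?thesis by simp
  qed
  have dLE: "((\<lambda>w. Ln w + E w) has_field_derivative h w / w) (at w)" if w: "w \<in> ?L" for w
  proof -
    have "h 0 = 1" by (simp add: h_def)
    hence "inverse w + e w = h w / w" using L(3)[OF w] by (simp add: e_def field_simps)
    with DERIV_add[OF has_field_derivative_Ln[OF L(4)[OF w]] E[OF L(1)[OF w]]] show ?thesis by simp
  qed
  have "\<exists>c. \<forall>w\<in>?L. W w - (Ln w + E w) = c"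
  proof (rule has_field_derivative_zero_constant)
    show "convex ?L" by (intro convex_Int convex_ball)
    show "((\<lambda>w. W w - (Ln w + E w)) has_field_derivative 0) (at w within ?L)" if "w \<in> ?L" for w
      using DERIV_diff[OF dW[OF that] dLE[OF that]] by (simp add: has_field_derivative_at_within)
  qed
  then obtain c where c: "\<And>w. w \<in> ?L \<Longrightarrow> W w = Ln w + (E w + c)" by (auto simp: algebra_simps)
  \<comment> \<open>The factor \<open>w\<close> stands for exp(Ln w) and has no branch cut, so this
    extends exp W from the lens to the unit disk.\<close>
  define \<psi>0 where "\<psi>0 = (\<lambda>w. w * exp (E w + c))"
  have E_hol: "E holomorphic_on ball 0 1"
    unfolding holomorphic_on_open[OF open_ball] using E by (metis mem_ball_0)
  have hol: "\<psi>0 holomorphic_on ball 0 1"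
    unfolding \<psi>0_def by (intro holomorphic_intros E_hol)
  have lens: "\<psi>0 w = exp (W w)" if "w \<in> ?L" for w
    using c[OF that] L(3)[OF that] by (simp add: \<psi>0_def exp_add)
  \<comment> \<open>For |x| < 1/8 one has |1 + x|^2 \<ge> 49/64 > 4 |x|, which puts
    \<open>landen x\<close> into the unit disk.\<close>
  have small: "norm (x\<^sup>2) < 1 \<and> norm (landen x) < 1 \<and> 1 + x \<noteq> 0" if "norm x < 1/8" for x :: complex
  proof -
    have "norm (x\<^sup>2) < 1" using that by (simp add: norm_power power_less_one_iff)
    moreover have "norm (1 + x) \<ge> 7/8" using that norm_triangle_ineq2[of 1 "- x"] by simp
    hence 1: "norm (1 + x) ^ 2 \<ge> (7/8)^2" by (intro power_mono) auto
    hence "4 * norm x < norm (1 + x) ^ 2" using that by (simp add: power2_eq_square)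
    hence "norm (landen x) < 1" using 1 by (simp add: landen_def norm_divide norm_mult norm_power divide_less_eq)
    ultimately show ?thesis using 1 by auto
  qed
  have real_lens: "complex_of_real r \<in> ?L" if "0 < r" "r < 1" for r
    using that by (simp add: dist_norm norm_one_minus_of_real)
  \<comment> \<open>For real k in (0, 1) both k^2 and \<open>landen k\<close> lie in the lens, where
    \<open>\<psi>0\<close> is exp W; the identity theorem then carries the equation to complex
    arguments.\<close>
  have fe_real: "\<psi>0 ((of_real k)\<^sup>2) - (\<psi>0 (landen (of_real k)))\<^sup>2 = 0" if k: "0 < k" "k < 1" for k :: real
  proof -
    have k2: "0 < k\<^sup>2" "k\<^sup>2 < 1" using k by (auto simp: power_less_one_iff)
    note p = landen_of_real[OF k]
    have 1: "(of_real k)\<^sup>2 \<in> ?L" using real_lens[OF k2] by simp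
    have 2: "landen (of_real k) \<in> ?L" unfolding p(1) by (rule real_lens[OF p(2,3)])
    have k1: "1 + complex_of_real k \<noteq> 0"
      using k by (metis of_real_1 of_real_add of_real_eq_0_iff add_pos_pos less_irrefl zero_less_one)
    have "2 * hypF (1 - landen (of_real k)) / hypF (landen (of_real k)) = hypF (1 - (of_real k)\<^sup>2) / hypF ((of_real k)\<^sup>2)"
      unfolding hypF_landen_compl_real[OF k] hypF_landen_real[OF k] using k1 by simp
    from this [symmetric] have "W ((of_real k)\<^sup>2) = 2 * W (landen (of_real k))"
      unfolding W_def by (simp only: times_divide_eq_right mult.left_commute)
    thus ?thesis unfolding lens[OF 1] lens[OF 2] by (simp add: exp_double)
  qed
  have fe: "\<psi>0 (x\<^sup>2) = (\<psi>0 (landen x))\<^sup>2" if x: "norm x < 1/8" for x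
  proof -
    have "\<psi>0 (x\<^sup>2) - (\<psi>0 (landen x))\<^sup>2 = 0"
    proof (rule analytic_continuation[where f = "\<lambda>x. \<psi>0 (x\<^sup>2) - (\<psi>0 (landen x))\<^sup>2" and U = "of_real ` {0<..<1/8}" and S = "ball 0 (1/8)" and \<xi> = 0])
      have p: "landen holomorphic_on ball 0 (1/8)"
        unfolding landen_def using small by (intro holomorphic_intros) auto
      have "(\<psi>0 \<circ> (\<lambda>x. x\<^sup>2)) holomorphic_on ball 0 (1/8)"
        by (rule holomorphic_on_compose_gen[OF _ hol]) (use small in \<open>auto intro!: holomorphic_intros\<close>)
      moreover have "(\<psi>0 \<circ> landen) holomorphic_on ball 0 (1/8)"
        by (rule holomorphic_on_compose_gen[OF p hol]) (use small in auto)
      ultimately show "(\<lambda>x. \<psi>0 (x\<^sup>2) - (\<psi>0 (landen x))\<^sup>2) holomorphic_on ball 0 (1/8)"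
        unfolding o_def by (intro holomorphic_intros)
    qed (use x islimpt_0_of_real[of "1/8"] fe_real in auto)
    thus ?thesis by simp
  qed
  \<comment> \<open>Divided by x^2, the functional equation becomes a = 16 a^2 in the limit x = 0,
    where a = exp(E 0 + c) is not 0.\<close>
  have E0: "exp (E 0 + c) = 1 / 16"
  proof -
    have contE: "isCont E z" if "norm z < 1" for z using DERIV_isCont[OF E[OF that]] .
    have "((\<lambda>x. exp (E (x\<^sup>2) + c)) \<longlongrightarrow> exp (E 0 + c)) (at 0)"
      by (intro tendsto_intros isCont_tendsto_compose[OF contE]) (auto intro!: tendsto_eq_intros)
    moreover have "((\<lambda>x. 16 / (1 + x) ^ 4 * (exp (E (landen x) + c))\<^sup>2) \<longlongrightarrow> 16 / (1 + 0) ^ 4 * (exp (E 0 + c))\<^sup>2) (at 0)"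
      by (intro tendsto_intros isCont_tendsto_compose[OF contE]) (auto simp: landen_def intro!: tendsto_eq_intros)
    moreover have "eventually (\<lambda>x. 16 / (1 + x) ^ 4 * (exp (E (landen x) + c))\<^sup>2 = exp (E (x\<^sup>2) + c)) (at 0)"
      unfolding eventually_at
    proof (intro exI[of _ "1/8"] conjI ballI impI)
      fix x :: complex assume "x \<noteq> 0 \<and> dist x 0 < 1/8"
      hence x: "x \<noteq> 0" "norm x < 1/8" by auto
      have "x\<^sup>2 * exp (E (x\<^sup>2) + c) = (landen x)\<^sup>2 * (exp (E (landen x) + c))\<^sup>2"
        using fe[OF x(2)] by (simp add: \<psi>0_def power_mult_distrib)
      also have "(landen x)\<^sup>2 = x\<^sup>2 * (16 / (1 + x) ^ 4)"
        by (simp add: landen_def power_divide power_mult_distrib flip: power_mult)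
      finally have "x\<^sup>2 * exp (E (x\<^sup>2) + c) = x\<^sup>2 * (16 / (1 + x) ^ 4 * (exp (E (landen x) + c))\<^sup>2)"
        by (simp only: mult.assoc)
      thus "16 / (1 + x) ^ 4 * (exp (E (landen x) + c))\<^sup>2 = exp (E (x\<^sup>2) + c)"
        using x(1) mult_left_cancel[of "x\<^sup>2"] by (metis zero_eq_power2)
    qed simp
    ultimately have "((\<lambda>x. exp (E (x\<^sup>2) + c)) \<longlongrightarrow> 16 / (1 + 0) ^ 4 * (exp (E 0 + c))\<^sup>2) (at 0)"
      using Lim_transform_eventually by fast
    hence "16 / (1 + 0) ^ 4 * (exp (E 0 + c))\<^sup>2 = exp (E 0 + c)"
      using \<open>((\<lambda>x. exp (E (x\<^sup>2) + c)) \<longlongrightarrow> exp (E 0 + c)) (at 0)\<close> tendsto_unique trivial_limit_at by metis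
    hence "16 * exp (E 0 + c) = 1" by (simp add: power2_eq_square)
    thus ?thesis by (simp add: field_simps)
  qed
  have "(\<psi>0 has_field_derivative 1 * exp (E 0 + c) + (exp (E 0 + c) * e 0) * 0) (at 0)"
    unfolding \<psi>0_def by (intro DERIV_mult DERIV_ident DERIV_chain'_eq[where f = exp and g = "\<lambda>w. E w + c", OF DERIV_exp])
      (auto intro!: derivative_eq_intros E)
  hence "deriv \<psi>0 0 = 1 / 16" using E0 by (auto dest!: DERIV_imp_deriv)
  moreover have "exp (W w) = exp (- of_real pi * (ellipticK (1 - w) / ellipticK w))" for w
    by (simp add: W_def ellipticK_hypF)
  ultimately show ?thesis
    using that[of \<psi>0] hol lens fe by (simp add: \<psi>0_def)
qed

section \<open>Extension of the inverse nome to the unit disk\<close>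

text \<open>A logarithm of \<open>f\<close> exists on the convex set and is divided by
  \<open>n\<close>. Subtracting its value at \<open>a\<close> and multiplying by \<open>b\<close>
  selects the root with value \<open>b\<close> at \<open>a\<close>.\<close>

lemma holomorphic_nth_root:
  fixes f :: "complex \<Rightarrow> complex"
  assumes f: "f holomorphic_on S" "convex S" "\<And>z. z \<in> S \<Longrightarrow> f z \<noteq> 0" and n: "n > 0" and a: "a \<in> S" "b ^ n = f a"
  obtains g where "g holomorphic_on S" "\<And>z. z \<in> S \<Longrightarrow> g z ^ n = f z" "g a = b"
proof -
  obtain l where l: "l holomorphic_on S" "\<And>z. z \<in> S \<Longrightarrow> f z = exp (l z)"
    using contractible_imp_holomorphic_log[OF f(1) convex_imp_contractible[OF f(2)] f(3)] by blast
  define g where "g = (\<lambda>z. b * exp ((l z - l a) / of_nat n))"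
  show ?thesis
  proof
    show "g holomorphic_on S" unfolding g_def using n by (intro holomorphic_intros l) auto
    show "g a = b" by (simp add: g_def)
    fix z assume z: "z \<in> S"
    have "g z ^ n = f a * exp (l z - l a)"
      using n by (simp add: g_def power_mult_distrib a(2) flip: exp_of_nat_mult)
    thus "g z ^ n = f z" using l(2)[OF z] l(2)[OF a(1)] by (simp add: exp_diff)
  qed
qed

lemma eventually_norm_less:
  fixes f :: "complex \<Rightarrow> complex"
  assumes "isCont f 0" "f 0 = 0" "r > 0"
  shows "eventually (\<lambda>z. norm (f z) < r) (nhds 0)"
proof -
  have "(f \<longlongrightarrow> f 0) (nhds 0)" using assms(1) by (simp add: continuous_within tendsto_nhds_iff)
  thus ?thesis using tendstoD[of f 0 "nhds 0" r] assms by (simp add: dist_norm)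
qed

lemma holomorphic_eq_on_ball:
  fixes f :: "complex \<Rightarrow> complex"
  assumes "f holomorphic_on ball 0 r" "g holomorphic_on ball 0 r" "eventually (\<lambda>z. f z = g z) (nhds 0)" "z \<in> ball 0 r"
  shows "f z = g z"
proof -
  obtain d where d: "d > 0" "\<And>z. norm z < d \<Longrightarrow> f z = g z"
    using assms(3) unfolding eventually_nhds_metric by (auto simp: dist_norm)
  have "r > 0" using assms(4) by (auto intro: le_less_trans[OF norm_ge_zero])
  show ?thesis
    by (rule analytic_continuation_open[of "ball 0 (min d r)" "ball 0 r" f g])
       (use assms d \<open>r > 0\<close> in auto)
qed

text \<open>\<open>\<psi>0\<close> is the nome in the coordinate of the first sheet,
  \<open>\<phi>0\<close> its local inverse at 0. What the extension takes from the hypergeometric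
  function is the derivative 1/16 and Landen's equation near 0.\<close>

locale nome_germ =
  fixes \<psi>0 \<phi>0 :: "complex \<Rightarrow> complex" and \<rho> \<epsilon> :: real
  assumes psi_hol: "\<psi>0 holomorphic_on ball 0 1" and psi_0: "\<psi>0 0 = 0" and psi_deriv: "deriv \<psi>0 0 = 1 / 16"
    and psi_landen: "\<And>x. norm x < 1 / 8 \<Longrightarrow> \<psi>0 (x\<^sup>2) = (\<psi>0 (landen x))\<^sup>2"
    and rho: "0 < \<rho>" "\<rho> \<le> 1" and eps: "0 < \<epsilon>" "\<epsilon> \<le> 1"
    and phi_hol: "\<phi>0 holomorphic_on ball 0 \<epsilon>"
    and phi_psi: "\<And>w. norm w < \<rho> \<Longrightarrow> \<phi>0 (\<psi>0 w) = w"
    and psi_phi: "\<And>z. norm z < \<epsilon> \<Longrightarrow> norm (\<phi>0 z) < \<rho> \<and> \<psi>0 (\<phi>0 z) = z"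
begin

lemma phi_0: "\<phi>0 0 = 0" using phi_psi[of 0] rho by (simp add: psi_0)

lemma psi_has_deriv: "(\<psi>0 has_field_derivative 1 / 16) (at 0)"
  using holomorphic_derivI[OF psi_hol open_ball, of 0 UNIV] psi_deriv by simp

lemma phi_has_deriv: "(\<phi>0 has_field_derivative 16) (at 0)"
proof -
  have 1: "(\<phi>0 has_field_derivative deriv \<phi>0 0) (at 0)"
    using holomorphic_derivI[OF phi_hol open_ball, of 0 UNIV] eps by simp
  have "((\<lambda>z. \<psi>0 (\<phi>0 z)) has_field_derivative 1 / 16 * deriv \<phi>0 0) (at 0)"
    by (rule DERIV_chain2[where f = \<psi>0]) (simp_all add: phi_0 psi_has_deriv 1)
  hence "((\<lambda>z. z) has_field_derivative 1 / 16 * deriv \<phi>0 0) (at 0)"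
    by (rule has_field_derivative_transform_within_open[of _ _ _ "ball 0 \<epsilon>"]) (use eps psi_phi in auto)
  hence "1 / 16 * deriv \<phi>0 0 = 1" using DERIV_unique DERIV_ident by blast
  thus ?thesis using 1 by simp
qed

text \<open>Avoiding 0 and 1 is part of the invariant because the next square root and the next
  Landen step depend on it. The prescribed germ at 0 makes extensions unique.\<close>

definition extends :: "real \<Rightarrow> (complex \<Rightarrow> complex) \<Rightarrow> bool" where
  "extends r f \<longleftrightarrow> f holomorphic_on ball 0 r \<and> (\<forall>z\<in>ball 0 r - {0}. f z \<notin> {0, 1}) \<and>
     eventually (\<lambda>z. f z = \<phi>0 z) (nhds 0)"

lemma extends_phi0: "extends \<epsilon> \<phi>0"
proof -
  have "\<phi>0 z \<notin> {0, 1}" if "norm z < \<epsilon>" "z \<noteq> 0" for z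
    using psi_phi[OF that(1)] that(2) psi_0 rho by auto
  thus ?thesis by (auto simp: extends_def phi_hol)
qed

lemma extends_mono: "extends r f \<Longrightarrow> s \<le> r \<Longrightarrow> extends s f"
  unfolding extends_def by (auto elim: holomorphic_on_subset)

lemma extends_unique:
  assumes "extends r f" "extends s g" "norm z < r" "norm z < s"
  shows "f z = g z"
proof (rule holomorphic_eq_on_ball[of f "min r s"])
  show "eventually (\<lambda>z. f z = g z) (nhds 0)"
    using assms(1,2) unfolding extends_def by (auto elim: eventually_elim2)
qed (use assms in \<open>auto simp: extends_def elim: holomorphic_on_subset\<close>)

lemma extends_0: "extends r f \<Longrightarrow> f 0 = 0"
  unfolding extends_def using phi_0 eventually_nhds_x_imp_x by fastforce

lemma extends_deriv:
  assumes "extends r f" shows "(f has_field_derivative 16) (at 0)"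
proof -
  have "eventually (\<lambda>z. f z = \<phi>0 z) (nhds 0)" using assms by (simp add: extends_def)
  thus ?thesis using phi_has_deriv by (subst DERIV_cong_ev[OF refl _ refl])
qed

text \<open>\<open>f (z\<^sup>2)\<close> has a double zero at \<open>0\<close> and no other zero, so it has a square root \<open>\<kappa>\<close>; then
  \<open>landen (\<kappa> z)\<close> extends \<open>f\<close> to the larger disk.\<close>

lemma extends_landen:
  assumes f: "extends (r\<^sup>2) f" and r: "0 < r" "r \<le> 1"
  obtains \<kappa> where "\<kappa> holomorphic_on ball 0 r" "\<And>z. norm z < r \<Longrightarrow> (\<kappa> z)\<^sup>2 = f (z\<^sup>2)"
    "\<And>z. norm z < r \<Longrightarrow> 1 + \<kappa> z \<noteq> 0" "extends r (\<lambda>z. landen (\<kappa> z))" "(\<kappa> has_field_derivative 4) (at 0)"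
proof -
  have fh: "f holomorphic_on ball 0 (r\<^sup>2)" and f01: "\<And>z. norm z < r\<^sup>2 \<Longrightarrow> z \<noteq> 0 \<Longrightarrow> f z \<noteq> 0 \<and> f z \<noteq> 1"
    using f by (auto simp: extends_def)
  have f0: "f 0 = 0" by (rule extends_0[OF f])
  have r2: "norm (z\<^sup>2) < r\<^sup>2" if "norm z < r" for z :: complex
    using that r by (simp add: norm_power power_strict_mono)
  define h where "h = (\<lambda>z. if z = 0 then deriv f 0 else (f z - f 0) / (z - 0))"
  have h: "h holomorphic_on ball 0 (r\<^sup>2)" unfolding h_def by (rule pole_lemma_open[OF fh open_ball])
  have d16: "deriv f 0 = 16" using extends_deriv[OF f] by (rule DERIV_imp_deriv)
  have h0: "h 0 = 16" by (simp add: h_def d16)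
  have hn: "h z \<noteq> 0" if "norm z < r\<^sup>2" for z
    using f01[OF that] by (auto simp: h_def f0 d16)
  have "(h \<circ> (\<lambda>z. z\<^sup>2)) holomorphic_on ball 0 r"
    by (rule holomorphic_on_compose_gen[OF _ h]) (use r2 in \<open>auto intro!: holomorphic_intros\<close>)
  then obtain s where s: "s holomorphic_on ball 0 r" "\<And>z. z \<in> ball 0 r \<Longrightarrow> s z ^ 2 = (h \<circ> (\<lambda>z. z\<^sup>2)) z" "s 0 = 4"
    by (rule holomorphic_nth_root[of _ _ 2 0 4]) (use r r2 hn h0 in auto)
  define \<kappa> where "\<kappa> = (\<lambda>z. z * s z)"
  have kh: "\<kappa> holomorphic_on ball 0 r" unfolding \<kappa>_def by (intro holomorphic_intros s)
  have k2: "(\<kappa> z)\<^sup>2 = f (z\<^sup>2)" if "norm z < r" for z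
    using s(2)[of z] that by (cases "z = 0") (auto simp: \<kappa>_def power_mult_distrib h_def f0)
  have k0: "\<kappa> 0 = 0" by (simp add: \<kappa>_def)
  have k1: "1 + \<kappa> z \<noteq> 0 \<and> \<kappa> z \<noteq> 1" if "norm z < r" for z
  proof (rule ccontr)
    assume "\<not> ?thesis"
    hence "(\<kappa> z)\<^sup>2 = 1" by (auto simp: add_eq_0_iff)
    hence "f (z\<^sup>2) = 1" "z \<noteq> 0" using k2[OF that] k0 by auto
    thus False using f01[OF r2[OF that]] by simp
  qed
  have kn: "\<kappa> z \<noteq> 0" if "norm z < r" "z \<noteq> 0" for z
    using k2[OF that(1)] f01[OF r2[OF that(1)]] that(2) by auto
  have kd: "(\<kappa> has_field_derivative 4) (at 0)"
    using DERIV_mult[OF DERIV_ident holomorphic_derivI[OF s(1) open_ball, of 0 UNIV]] r s(3)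
    by (simp add: \<kappa>_def)
  define f' where "f' = (\<lambda>z. landen (\<kappa> z))"
  have f'h: "f' holomorphic_on ball 0 r"
    unfolding f'_def landen_def using k1 by (intro holomorphic_intros kh) auto
  have f'01: "f' z \<notin> {0, 1}" if "norm z < r" "z \<noteq> 0" for z
  proof -
    have "\<kappa> z \<noteq> -1" using k1[OF that(1)] by auto
    hence "1 - f' z = ((1 - \<kappa> z) / (1 + \<kappa> z))\<^sup>2" unfolding f'_def by (rule one_minus_landen)
    hence "f' z \<noteq> 1" using k1[OF that(1)] by auto
    thus ?thesis using k1[OF that(1)] kn[OF that] by (auto simp: f'_def landen_def)
  qed
  have f'0: "f' 0 = 0" by (simp add: f'_def k0 landen_def)
  have f'd: "(f' has_field_derivative 16) (at 0)"
    using DERIV_chain'_eq[where f = landen and g = \<kappa> and a = 4, OF _ kd] landen_deriv[of 0] by (simp add: f'_def k0)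
  have cont: "isCont f' 0" "isCont \<kappa> 0" using f'd kd DERIV_isCont by auto
  define g where "g = (\<lambda>z. \<psi>0 (f' z))"
  have gd: "(g has_field_derivative 1) (at 0)"
    unfolding g_def by (rule DERIV_chain'_eq[where f = \<psi>0, OF _ f'd]) (use psi_has_deriv f'0 in auto)
  have "((\<lambda>z. g z / z) \<longlongrightarrow> 1) (at 0)"
    using gd by (simp add: has_field_derivative_iff g_def f'0 psi_0)
  \<comment> \<open>Landen's equation will only yield (g z)^2 = z^2. Near 0 the quotient g z / z is
    close to 1, which excludes g z = - z.\<close>
  hence "eventually (\<lambda>z. dist (g z / z) 1 < 1) (at 0)" by (rule tendstoD) simp
  hence "eventually (\<lambda>z. z \<noteq> 0 \<longrightarrow> dist (g z / z) 1 < 1) (nhds 0)"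
    by (simp add: eventually_at_filter)
  moreover have "eventually (\<lambda>z. norm (\<kappa> z) < 1/8) (nhds 0)" "eventually (\<lambda>z. norm (f' z) < \<rho>) (nhds 0)"
    using eventually_norm_less[OF cont(2) k0, of "1/8"] eventually_norm_less[OF cont(1) f'0 rho(1)] by simp_all
  moreover have "eventually (\<lambda>z. norm z < r) (nhds (0::complex))"
    using eventually_norm_less[of "\<lambda>z. z" r] r by simp
  moreover have "eventually (\<lambda>z. norm (z\<^sup>2) < \<epsilon>) (nhds (0::complex))"
    by (rule eventually_norm_less) (use eps in auto)
  moreover have "eventually (\<lambda>z. f (z\<^sup>2) = \<phi>0 (z\<^sup>2)) (nhds 0)"
  proof -
    have "eventually (\<lambda>z. f z = \<phi>0 z) (nhds 0)" using f by (simp add: extends_def)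
    moreover have "filterlim (\<lambda>z::complex. z\<^sup>2) (nhds 0) (nhds 0)"
      using tendsto_power[of "\<lambda>z::complex. z" 0 "nhds 0" 2] by (simp add: filterlim_ident)
    ultimately show ?thesis unfolding filterlim_iff by blast
  qed
  ultimately have "eventually (\<lambda>z. f' z = \<phi>0 z) (nhds 0)"
  proof eventually_elim
    case (elim z)
    have "(g z)\<^sup>2 = z\<^sup>2"
      using psi_landen[OF elim(2)] psi_phi[OF elim(5)] k2[OF elim(4)] elim(6) by (simp add: g_def f'_def)
    have "g z = z"
    proof (cases "z = 0")
      case True thus ?thesis by (simp add: g_def f'0 psi_0)
    next
      case False
      have "g z = z \<or> g z = - z" using \<open>(g z)\<^sup>2 = z\<^sup>2\<close> by (simp add: power2_eq_iff)
      moreover have "g z \<noteq> - z" using elim(1) False by (auto simp: dist_norm)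
      ultimately show ?thesis by blast
    qed
    thus ?case using phi_psi[OF elim(3)] by (simp add: g_def)
  qed
  hence "extends r f'" using f'h f'01 by (auto simp: extends_def)
  thus ?thesis using that[of \<kappa>] kh k2 k1 kd by (auto simp: f'_def)
qed

text \<open>Each use of \<open>extends_landen\<close> passes from radius r^2 to r. Once r^(2^n) is
  below \<epsilon>, where \<open>\<phi>0\<close> itself is available, n uses lead back to
  \<open>r\<close>.\<close>

lemma extends_exists:
  assumes "0 < r" "r < 1" shows "\<exists>f. extends r f"
proof -
  have *: "\<exists>f. extends r f" if "0 < r" "r < 1" "r ^ (2 ^ n) < \<epsilon>" for r n
    using that
  proof (induction n arbitrary: r)
    case 0
    thus ?case using extends_mono[OF extends_phi0, of r] by auto
  next
    case (Suc n)
    have "(r\<^sup>2) ^ (2 ^ n) < \<epsilon>" using Suc.prems(3) by (simp flip: power_mult)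
    hence "\<exists>f. extends (r\<^sup>2) f" using Suc.prems by (intro Suc.IH) (auto simp: power_less_one_iff)
    then obtain f where "extends (r\<^sup>2) f" by blast
    thus ?case using extends_landen[of r f] Suc.prems by (metis less_imp_le)
  qed
  obtain m where m: "r ^ m < \<epsilon>" using real_arch_pow_inv[OF eps(1) assms(2)] by blast
  have "r ^ (2 ^ m) \<le> r ^ m" using assms by (intro power_decreasing) (auto simp: less_imp_le[OF less_exp])
  hence "r ^ (2 ^ m) < \<epsilon>" using m by linarith
  thus ?thesis by (rule *[OF assms])
qed

text \<open>Extensions to different radii agree where both are defined, so they glue; (1 + |z|) / 2
  is a choice of a radius between |z| and 1.\<close>

lemma extends_1: "\<exists>f. extends 1 f"
proof -
  obtain F where F: "\<And>r. 0 < r \<Longrightarrow> r < 1 \<Longrightarrow> extends r (F r)" using extends_exists by metis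
  define f where "f = (\<lambda>z. F ((1 + norm z) / 2) z)"
  have eq: "f z = F r z" if "norm z < r" "r < 1" for z r
  proof -
    have "0 < r" using that(1) by (rule le_less_trans[OF norm_ge_zero])
    have "0 \<le> norm z" by simp
    hence "extends ((1 + norm z) / 2) (F ((1 + norm z) / 2))" using that by (intro F) (auto simp: add_pos_nonneg)
    moreover have "norm z < (1 + norm z) / 2" using that by simp
    ultimately show ?thesis unfolding f_def
      by (rule extends_unique[OF _ F[OF \<open>0 < r\<close> that(2)] _ that(1)])
  qed
  have "f field_differentiable (at z)" if z: "norm z < 1" for z
  proof -
    obtain r where r: "norm z < r" "r < 1" using dense[OF z] by blast
    have "0 < r" using r(1) by (rule le_less_trans[OF norm_ge_zero])
    hence "F r holomorphic_on ball 0 r" using F r by (simp add: extends_def)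
    hence "f holomorphic_on ball 0 r" using eq r(2) by (subst holomorphic_cong[OF refl]) auto
    thus ?thesis using r by (auto intro: holomorphic_on_imp_differentiable_at)
  qed
  hence "f holomorphic_on ball 0 1" by (simp add: holomorphic_on_def field_differentiable_at_within)
  moreover have "f z \<notin> {0, 1}" if z: "norm z < 1" "z \<noteq> 0" for z
  proof -
    obtain r where r: "norm z < r" "r < 1" using dense[OF z(1)] by blast
    have "0 < r" using r(1) by (rule le_less_trans[OF norm_ge_zero])
    thus ?thesis using F[of r] eq[OF r] r z by (auto simp: extends_def)
  qed
  moreover have "eventually (\<lambda>z. f z = \<phi>0 z) (nhds 0)"
  proof -
    have "eventually (\<lambda>z. F (1/2) z = \<phi>0 z) (nhds 0)" using F[of "1/2"] by (simp add: extends_def)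
    moreover have "eventually (\<lambda>z. norm z < 1/2) (nhds (0::complex))"
      using eventually_norm_less[of "\<lambda>z. z" "1/2"] by simp
    ultimately show ?thesis by eventually_elim (use eq[of _ "1/2"] in auto)
  qed
  ultimately show ?thesis by (auto simp: extends_def)
qed

text \<open>At radius 1 one has r^2 = r, so the enlargement step reproduces \<open>\<phi>\<close> by
  uniqueness. The resulting relation between \<open>\<phi>\<close> and \<open>\<kappa>\<close> is
  what the descent rests on.\<close>

lemma inverse_nome_exists:
  obtains \<phi> \<kappa> where "\<phi> holomorphic_on ball 0 1" "\<kappa> holomorphic_on ball 0 1"
    "\<And>z. norm z < 1 \<Longrightarrow> \<phi> z = landen (\<kappa> z) \<and> 1 + \<kappa> z \<noteq> 0 \<and> (\<kappa> z)\<^sup>2 = \<phi> (z\<^sup>2)"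
    "\<And>z. norm z < 1 \<Longrightarrow> z \<noteq> 0 \<Longrightarrow> \<phi> z \<notin> {0, 1}" "\<phi> 0 = 0"
    "(\<phi> has_field_derivative 16) (at 0)" "(\<kappa> has_field_derivative 4) (at 0)"
    "eventually (\<lambda>w. \<phi> (\<psi>0 w) = w) (nhds 0)"
proof -
  obtain f where f: "extends 1 f" using extends_1 by blast
  obtain \<kappa> where k: "\<kappa> holomorphic_on ball 0 1" "\<And>z. norm z < 1 \<Longrightarrow> (\<kappa> z)\<^sup>2 = f (z\<^sup>2)"
    "\<And>z. norm z < 1 \<Longrightarrow> 1 + \<kappa> z \<noteq> 0" "extends 1 (\<lambda>z. landen (\<kappa> z))" "(\<kappa> has_field_derivative 4) (at 0)"
    using extends_landen[of 1 f] f by auto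
  have psi: "filterlim \<psi>0 (nhds 0) (nhds 0)"
    using DERIV_isCont[OF psi_has_deriv] psi_0 by (simp add: continuous_within tendsto_nhds_iff)
  have "eventually (\<lambda>w. f (\<psi>0 w) = \<phi>0 (\<psi>0 w)) (nhds 0)"
    using f psi unfolding extends_def filterlim_iff by blast
  moreover have "eventually (\<lambda>w. norm w < \<rho>) (nhds (0::complex))"
    using eventually_norm_less[of "\<lambda>z. z" \<rho>] rho by simp
  ultimately have "eventually (\<lambda>w. f (\<psi>0 w) = w) (nhds 0)"
    by eventually_elim (simp add: phi_psi)
  thus ?thesis
    using that[of f \<kappa>] f k extends_unique[OF f k(4)] extends_0[OF f] extends_deriv[OF f]
    by (auto simp: extends_def)
qed

end

lemma local_inverse:
  fixes f :: "complex \<Rightarrow> complex"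
  assumes f: "f holomorphic_on ball 0 1" "f 0 = 0" "deriv f 0 \<noteq> 0"
  obtains g \<rho> \<epsilon> where "0 < \<rho>" "\<rho> \<le> 1" "0 < \<epsilon>" "\<epsilon> \<le> 1" "g holomorphic_on ball 0 \<epsilon>"
    "\<And>w. norm w < \<rho> \<Longrightarrow> g (f w) = w" "\<And>z. norm z < \<epsilon> \<Longrightarrow> norm (g z) < \<rho> \<and> f (g z) = z"
proof -
  obtain r where r: "r > 0" "ball (0::complex) r \<subseteq> ball 0 1" "open (f ` ball 0 r)" "inj_on f (ball 0 r)"
    by (rule has_complex_derivative_locally_invertible[OF f(1) _ open_ball f(3)]) auto
  have "f holomorphic_on ball 0 r" using f(1) r(2) by (rule holomorphic_on_subset)
  then obtain g where g: "g holomorphic_on (f ` ball 0 r)" "\<And>z. z \<in> ball 0 r \<Longrightarrow> g (f z) = z"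
    using holomorphic_has_inverse[OF _ open_ball r(4)] by metis
  have "0 \<in> f ` ball 0 r" using r(1) f(2) by (metis centre_in_ball image_eqI)
  then obtain e where e: "e > 0" "ball 0 e \<subseteq> f ` ball 0 r" using r(3) open_contains_ball by metis
  have "r \<le> 1" using r(1,2) by (simp add: ball_subset_ball_iff)
  show ?thesis
  proof
    show "0 < r" "r \<le> 1" "0 < min e 1" "min e 1 \<le> 1" using r(1) e \<open>r \<le> 1\<close> by auto
    show "g holomorphic_on ball 0 (min e 1)" by (rule holomorphic_on_subset[OF g(1)]) (use e(2) in auto)
    show "g (f w) = w" if "norm w < r" for w using g(2) that by simp
    show "norm (g z) < r \<and> f (g z) = z" if "norm z < min e 1" for z
    proof -
      have "z \<in> f ` ball 0 r" using e(2) that by auto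
      thus ?thesis using g(2) by auto
    qed
  qed
qed

section \<open>Branches of the nome\<close>

text \<open>The quotient a / b is continuous with values in {1, -1}, hence constant on the connected
  set.\<close>

lemma eq_if_squares_eq:
  fixes a b :: "complex \<Rightarrow> complex"
  assumes "connected S" "continuous_on S a" "continuous_on S b" "\<And>y. y \<in> S \<Longrightarrow> (a y)\<^sup>2 = (b y)\<^sup>2"
    "\<And>y. y \<in> S \<Longrightarrow> b y \<noteq> 0" "s \<in> S" "a s = b s" "y \<in> S"
  shows "a y = b y"
proof -
  define q where "q = (\<lambda>y. a y / b y)"
  have "q constant_on S"
  proof (rule continuous_finite_range_constant[OF assms(1)])
    show "continuous_on S q" unfolding q_def using assms by (intro continuous_intros) auto
    have "q y \<in> {1, -1}" if "y \<in> S" for y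
    proof -
      have "(q y)\<^sup>2 = 1" using assms(4,5)[OF that] by (simp add: q_def power_divide)
      thus ?thesis by (simp add: power2_eq_1_iff)
    qed
    hence "q ` S \<subseteq> {1, -1}" by blast
    thus "finite (q ` S)" by (rule finite_subset) simp
  qed
  hence "q y = q s" using assms(6,8) by (auto simp: constant_on_def)
  thus ?thesis using assms(5)[OF assms(6)] assms(5)[OF assms(8)] assms(7) by (simp add: q_def)
qed

text \<open>If |f(y)| \<ge> e, then 1/f is bounded at \<open>y\<close>, hence by Schottky's theorem
  also at \<open>s\<close>, which keeps f(s) away from 0. The threshold \<open>d\<close> serves all
  \<open>f\<close> at once.\<close>

lemma schottky_small:
  fixes c :: complex
  assumes R: "R > 0" and e: "e > 0"
  obtains d where "d > 0"
    "\<And>f y s. f holomorphic_on ball c R \<Longrightarrow> f ` ball c R \<subseteq> - {0, 1} \<Longrightarrow> s \<in> ball c (R / 4) \<Longrightarrow> norm (f s) < d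
      \<Longrightarrow> y \<in> ball c (R / 4) \<Longrightarrow> norm (f y) < e"
proof -
  \<comment> \<open>Schottky's bound at relative distance 4/5 for a function of modulus at most 1/e
    at the centre.\<close>
  define M where "M = exp (pi * exp (pi * (2 + 2 * (1 / e) + 12 * (4/5) / (1 - 4/5))))"
  have M: "M > 0" by (simp add: M_def)
  show ?thesis
  proof
    show "1 / M > 0" using M by simp
    fix f y s
    assume f: "f holomorphic_on ball c R" "f ` ball c R \<subseteq> - {0, 1}" and s: "s \<in> ball c (R / 4)" "norm (f s) < 1 / M"
      and y: "y \<in> ball c (R / 4)"
    show "norm (f y) < e"
    proof (rule ccontr)
      assume "\<not> norm (f y) < e"
      hence fy: "norm (1 / f y) \<le> 1 / e" using e by (simp add: norm_divide frac_le)
      \<comment> \<open>The disk is recentred at \<open>y\<close>. Radius 5R/8 stays inside because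
        1/4 + 5/8 < 1, and \<open>s\<close>, at distance less than R/2 = 4/5 * 5R/8 from
        \<open>y\<close>, is reached with |z| \<le> 4/5.\<close>
      define w where "w = (\<lambda>z::complex. y + of_real (5 * R / 8) * z)"
      have w: "w z \<in> ball c R" if "norm z \<le> 1" for z
      proof -
        have "dist c (w z) \<le> dist c y + norm (of_real (5 * R / 8) * z)"
          unfolding w_def by (metis dist_triangle dist_norm add_diff_cancel_left' dist_commute)
        also have "norm (of_real (5 * R / 8) * z) \<le> 5 * R / 8"
          using R that unfolding norm_mult norm_of_real by (simp add: mult_left_le)
        also have "dist c y + 5 * R / 8 < R" using y R by simp
        finally show ?thesis by simp
      qed
      have "(f \<circ> w) holomorphic_on cball 0 1"
        by (rule holomorphic_on_compose_gen[OF _ f(1)]) (use w in \<open>auto simp: w_def intro!: holomorphic_intros\<close>)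
      moreover have "f (w z) \<noteq> 0" "f (w z) \<noteq> 1" if "z \<in> cball 0 1" for z
        using subsetD[OF f(2) imageI[OF w[of z]]] that by auto
      ultimately have h: "(\<lambda>z. 1 / f (w z)) holomorphic_on cball 0 1"
        and h01: "\<And>z. z \<in> cball 0 1 \<Longrightarrow> \<not> (1 / f (w z) = 0 \<or> 1 / f (w z) = 1)"
        unfolding o_def by (auto intro!: holomorphic_intros)
      define z where "z = (s - y) / of_real (5 * R / 8)"
      have "complex_of_real (5 * R / 8) \<noteq> 0" using R by simp
      hence "complex_of_real (5 * R / 8) * z = s - y" unfolding z_def by (metis mult.commute nonzero_eq_divide_eq)
      hence wz: "w z = s" unfolding w_def by (simp only: add_diff_cancel_left' add_diff_eq)
      have "norm (s - y) < R / 2"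
        using s(1) y dist_triangle_half_l[of s c "R/2" y] by (simp add: dist_norm norm_minus_commute)
      hence "norm (s - y) \<le> 4/5 * (5 * R / 8)" by simp
      hence nz: "norm z \<le> 4/5" using R unfolding z_def norm_divide norm_of_real by (simp add: divide_le_eq)
      have "norm (1 / f (w 0)) \<le> 1 / e" using fy by (simp add: w_def)
      from Schottky[OF h this h01 _ _ nz] have "norm (1 / f s) \<le> M"
        unfolding wz M_def by simp
      moreover have "f s \<noteq> 0" using subsetD[OF f(2) imageI[OF w[of z]]] nz wz by auto
      ultimately have "1 / M \<le> norm (f s)" using M by (simp add: norm_divide field_simps)
      thus False using s(2) by simp
    qed
  qed
qed

text \<open>\<open>\<phi>\<close> is the elliptic modular function lambda in the variable q, and
  \<open>\<kappa> z\<close> is the elliptic modulus k (a square root of the parameter) at nome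
  z^2.\<close>

locale inverse_nome =
  fixes \<phi> \<kappa> :: "complex \<Rightarrow> complex"
  assumes phi_hol: "\<phi> holomorphic_on ball 0 1" and kappa_hol: "\<kappa> holomorphic_on ball 0 1"
    and phi_landen: "\<And>z. norm z < 1 \<Longrightarrow> \<phi> z = landen (\<kappa> z) \<and> 1 + \<kappa> z \<noteq> 0 \<and> (\<kappa> z)\<^sup>2 = \<phi> (z\<^sup>2)"
    and phi_avoids: "\<And>z. norm z < 1 \<Longrightarrow> z \<noteq> 0 \<Longrightarrow> \<phi> z \<notin> {0, 1}" and phi_0: "\<phi> 0 = 0"
    and phi_deriv: "(\<phi> has_field_derivative 16) (at 0)" and kappa_deriv: "(\<kappa> has_field_derivative 4) (at 0)"
begin

lemma isCont_phi: "norm z < 1 \<Longrightarrow> isCont \<phi> z"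
  using holomorphic_on_imp_continuous_on[OF phi_hol] by (simp add: continuous_on_eq_continuous_at)

text \<open>\<open>f\<close> is the \<open>n\<close>-fold descending Landen transform of the identity on \<open>B\<close>, along the branches determined by
  \<open>x\<close>. The last clause pulls lifts back up the chain: each step is a square root, hence determined on a
  connected set by its value at \<open>\<phi> x\<close>.\<close>

definition landen_chain :: "complex set \<Rightarrow> complex \<Rightarrow> nat \<Rightarrow> (complex \<Rightarrow> complex) \<Rightarrow> bool" where
  "landen_chain B x n f \<longleftrightarrow> f holomorphic_on B \<and> f ` B \<subseteq> - {0, 1} \<and> f (\<phi> x) = \<phi> (x ^ (2 ^ n)) \<and>
     (\<forall>S g. connected S \<and> S \<subseteq> B \<and> \<phi> x \<in> S \<and> continuous_on S g \<and> g ` S \<subseteq> ball 0 1 \<and> g (\<phi> x) = x \<and>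
        (\<forall>y\<in>S. \<phi> (g y ^ (2 ^ n)) = f y) \<longrightarrow> (\<forall>y\<in>S. \<phi> (g y) = y))"

lemma landen_chain_lift:
  assumes "landen_chain B x n f" "connected S" "S \<subseteq> B" "\<phi> x \<in> S" "continuous_on S g" "g ` S \<subseteq> ball 0 1"
    "g (\<phi> x) = x" "\<And>y. y \<in> S \<Longrightarrow> \<phi> (g y ^ (2 ^ n)) = f y" "y \<in> S"
  shows "\<phi> (g y) = y"
  using assms unfolding landen_chain_def by blast

text \<open>\<open>landen k' = f\<close> is solved by k' = (1 - \<sigma>) / (1 + \<sigma>) with
  \<sigma>^2 = 1 - f, and the next member of the chain is k'^2. Since \<open>f\<close> avoids 1, the
  root exists on the convex set and does not vanish, so k'^2 avoids 1; since \<open>f\<close> avoids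
  0, neither 1 + \<sigma> nor k' vanishes.\<close>

lemma landen_chain_exists:
  assumes B: "convex B" "B \<subseteq> - {0, 1}" and x: "norm x < 1" "x \<noteq> 0" "\<phi> x \<in> B"
  shows "\<exists>f. landen_chain B x n f"
proof (induction n)
  case 0
  show ?case unfolding landen_chain_def using B by (intro exI[of _ "\<lambda>y. y"]) simp
next
  case (Suc n)
  then obtain f where chain: "landen_chain B x n f" by blast
  hence f: "f holomorphic_on B" "f ` B \<subseteq> - {0, 1}" "f (\<phi> x) = \<phi> (x ^ (2 ^ n))"
    by (simp_all add: landen_chain_def)
  define x' where "x' = x ^ (2 ^ n)"
  have x': "norm x' < 1" using x(1) by (simp add: x'_def norm_power power_less_one_iff)
  note k = phi_landen[OF x']
  \<comment> \<open>The sign of \<sigma> at \<open>\<phi> x\<close> is chosen such that k' takes the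
    value \<open>\<kappa> x'\<close> there.\<close>
  define s where "s = (1 - \<kappa> x') / (1 + \<kappa> x')"
  have "\<kappa> x' \<noteq> -1" using k by auto
  hence s2: "s ^ 2 = 1 - f (\<phi> x)"
    using one_minus_landen[of "\<kappa> x'"] k by (simp add: s_def f(3) x'_def)
  have f01: "f y \<noteq> 0" "f y \<noteq> 1" if "y \<in> B" for y using f(2) that by auto
  obtain \<sigma> where sg: "\<sigma> holomorphic_on B" "\<And>y. y \<in> B \<Longrightarrow> \<sigma> y ^ 2 = 1 - f y" "\<sigma> (\<phi> x) = s"
    by (rule holomorphic_nth_root[of "\<lambda>y. 1 - f y" B 2 "\<phi> x" s])
       (use f01 B x s2 in \<open>auto intro!: holomorphic_intros f(1)\<close>)
  have sn: "\<sigma> y \<noteq> 0" "1 + \<sigma> y \<noteq> 0" "\<sigma> y \<noteq> 1" if "y \<in> B" for y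
  proof -
    have "\<sigma> y ^ 2 \<noteq> 0" "\<sigma> y ^ 2 \<noteq> 1" using sg(2)[OF that] f01[OF that] by auto
    thus "\<sigma> y \<noteq> 0" "1 + \<sigma> y \<noteq> 0" "\<sigma> y \<noteq> 1" by (auto simp: add_eq_0_iff)
  qed
  define k' where "k' = (\<lambda>y. (1 - \<sigma> y) / (1 + \<sigma> y))"
  have k'h: "k' holomorphic_on B" unfolding k'_def using sn by (intro holomorphic_intros sg) auto
  have invol: "(1 - (1 - a) / (1 + a)) / (1 + (1 - a) / (1 + a)) = a" "1 + (1 - a) / (1 + a) \<noteq> 0"
    if "1 + a \<noteq> 0" for a :: complex
  proof -
    have "1 + (1 - a) / (1 + a) = 2 / (1 + a)" using that by (simp add: field_simps)
    moreover have "1 - (1 - a) / (1 + a) = 2 * a / (1 + a)" using that by (simp add: field_simps)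
    ultimately show "(1 - (1 - a) / (1 + a)) / (1 + (1 - a) / (1 + a)) = a" "1 + (1 - a) / (1 + a) \<noteq> 0"
      using that by simp_all
  qed
  have k'l: "landen (k' y) = f y" if "y \<in> B" for y
  proof -
    have "k' y \<noteq> -1" using invol(2)[OF sn(2)[OF that]] by (auto simp: k'_def)
    hence "1 - landen (k' y) = \<sigma> y ^ 2"
      using one_minus_landen[of "k' y"] invol(1)[OF sn(2)[OF that]] by (simp add: k'_def)
    thus ?thesis using sg(2)[OF that] by simp
  qed
  have k'n: "k' y \<noteq> 0" if "y \<in> B" for y using sn[OF that] by (simp add: k'_def)
  have k'2: "(k' y)\<^sup>2 \<noteq> 1" if "y \<in> B" for y
  proof
    assume "(k' y)\<^sup>2 = 1"
    hence "k' y = 1 \<or> k' y = -1" by (simp add: power2_eq_1_iff)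
    moreover have "1 + k' y \<noteq> 0" using invol(2)[OF sn(2)[OF that]] by (simp add: k'_def)
    moreover have "(1 - k' y) / (1 + k' y) = \<sigma> y" using invol(1)[OF sn(2)[OF that]] by (simp add: k'_def)
    ultimately show False using sn(1)[OF that] by auto
  qed
  have k'x: "k' (\<phi> x) = \<kappa> x'"
    using invol(1)[of "\<kappa> x'"] k by (simp add: k'_def sg(3) s_def)
  have pow: "a ^ (2 ^ Suc n) = (a ^ (2 ^ n))\<^sup>2" for a :: complex by (simp flip: power_mult add: mult.commute)
  show ?case unfolding landen_chain_def
  proof (intro exI[of _ "\<lambda>y. (k' y)\<^sup>2"] conjI allI impI)
    show "(\<lambda>y. (k' y)\<^sup>2) holomorphic_on B" by (intro holomorphic_intros k'h)
    show "(\<lambda>y. (k' y)\<^sup>2) ` B \<subseteq> - {0, 1}" using k'n k'2 by auto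
    show "(k' (\<phi> x))\<^sup>2 = \<phi> (x ^ 2 ^ Suc n)" unfolding k'x pow using k by (simp add: x'_def)
    fix S g
    assume "connected S \<and> S \<subseteq> B \<and> \<phi> x \<in> S \<and> continuous_on S g \<and> g ` S \<subseteq> ball 0 1 \<and> g (\<phi> x) = x \<and>
        (\<forall>y\<in>S. \<phi> (g y ^ 2 ^ Suc n) = (k' y)\<^sup>2)"
    hence S: "connected S" "S \<subseteq> B" "\<phi> x \<in> S" and g: "continuous_on S g" "g ` S \<subseteq> ball 0 1" "g (\<phi> x) = x"
      "\<And>y. y \<in> S \<Longrightarrow> \<phi> (g y ^ 2 ^ Suc n) = (k' y)\<^sup>2" by auto
    have gn: "norm (g y ^ 2 ^ n) < 1" if "y \<in> S" for y
      using g(2) that by (auto simp: norm_power power_less_one_iff)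
    \<comment> \<open>The assumption on \<open>g\<close> gives equal squares, and the value at
      \<open>\<phi> x\<close> fixes the sign on all of \<open>S\<close>. Applying
      \<open>landen\<close> to both sides leads to the assumption for \<open>n\<close>.\<close>
    have "\<kappa> (g y ^ 2 ^ n) = k' y" if "y \<in> S" for y
    proof (rule eq_if_squares_eq[where S = S and s = "\<phi> x" and y = y, OF S(1)])
      show "continuous_on S (\<lambda>y. \<kappa> (g y ^ 2 ^ n))"
        by (rule continuous_on_compose2[OF holomorphic_on_imp_continuous_on[OF kappa_hol]])
           (use gn in \<open>auto intro!: continuous_intros g(1)\<close>)
      show "continuous_on S k'"
        using holomorphic_on_imp_continuous_on[OF k'h] S(2) by (rule continuous_on_subset)
      show "(\<kappa> (g y ^ 2 ^ n))\<^sup>2 = (k' y)\<^sup>2" if "y \<in> S" for y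
        using phi_landen[OF gn[OF that]] g(4)[OF that] unfolding pow by simp
    qed (use that S k'n k'x g(3) in \<open>auto simp: x'_def\<close>)
    hence "\<phi> (g y ^ 2 ^ n) = f y" if "y \<in> S" for y
      using phi_landen[OF gn[OF that]] k'l[OF subsetD[OF S(2) that]] that by simp
    thus "\<forall>y\<in>S. \<phi> (g y) = y" using landen_chain_lift[OF chain S g(1-3)] by blast
  qed
qed

lemma phi_local_inverse:
  obtains g \<rho> \<epsilon> where "0 < \<rho>" "\<rho> \<le> 1" "0 < \<epsilon>" "\<epsilon> \<le> 1" "g holomorphic_on ball 0 \<epsilon>"
    "\<And>w. norm w < \<rho> \<Longrightarrow> g (\<phi> w) = w" "\<And>z. norm z < \<epsilon> \<Longrightarrow> norm (g z) < \<rho> \<and> \<phi> (g z) = z"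
proof -
  have "deriv \<phi> 0 \<noteq> 0" using DERIV_imp_deriv[OF phi_deriv] by simp
  show thesis by (rule local_inverse[OF phi_hol phi_0 \<open>deriv \<phi> 0 \<noteq> 0\<close>]) (rule that)
qed

text \<open>The number of descents depends on \<open>x\<close>, but the disk of radius R / 4 does
  not: every point over it has a branch on the whole of it. This uniformity is what makes
  \<open>\<phi>\<close> a covering.\<close>

lemma phi_branch:
  assumes R: "R > 0" "ball c R \<subseteq> - {0, 1}" and x: "norm x < 1" "\<phi> x \<in> ball c (R / 4)"
  obtains g where "g holomorphic_on ball c (R / 4)" "g ` ball c (R / 4) \<subseteq> ball 0 1 - {0}"
    "\<And>y. y \<in> ball c (R / 4) \<Longrightarrow> \<phi> (g y) = y" "g (\<phi> x) = x"
proof -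
  let ?S = "ball c (R / 4)"
  have SR: "?S \<subseteq> ball c R" using R(1) by auto
  have x0: "x \<noteq> 0" using subsetD[OF R(2) subsetD[OF SR x(2)]] phi_0 by auto
  obtain g0 \<rho> \<epsilon> where e: "0 < \<rho>" "\<rho> \<le> 1" "0 < \<epsilon>" "\<epsilon> \<le> 1" and g0: "g0 holomorphic_on ball 0 \<epsilon>"
    "\<And>w. norm w < \<rho> \<Longrightarrow> g0 (\<phi> w) = w" "\<And>z. norm z < \<epsilon> \<Longrightarrow> norm (g0 z) < \<rho> \<and> \<phi> (g0 z) = z"
    by (rule phi_local_inverse) (rule that)
  obtain d where d: "d > 0"
    "\<And>f y s. f holomorphic_on ball c R \<Longrightarrow> f ` ball c R \<subseteq> - {0, 1} \<Longrightarrow> s \<in> ball c (R / 4) \<Longrightarrow> norm (f s) < d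
      \<Longrightarrow> y \<in> ball c (R / 4) \<Longrightarrow> norm (f y) < \<epsilon>"
    using schottky_small[OF R(1) e(3), of c] by blast
  have "(\<lambda>n. x ^ (2 ^ n)) \<longlonglongrightarrow> 0"
    using LIMSEQ_subseq_LIMSEQ[OF LIMSEQ_power_zero[OF x(1)], of "\<lambda>n. 2 ^ n"]
    by (simp add: o_def strict_mono_def)
  moreover from this have "(\<lambda>n. \<phi> (x ^ (2 ^ n))) \<longlonglongrightarrow> 0"
    using isCont_tendsto_compose[OF isCont_phi[of 0]] phi_0 by fastforce
  ultimately have "eventually (\<lambda>n. norm (x ^ (2 ^ n)) < \<rho> \<and> norm (\<phi> (x ^ (2 ^ n))) < d) sequentially"
    using e(1) d(1) by (intro eventually_conj) (auto dest: tendstoD simp: dist_norm)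
  then obtain n where n: "norm (x ^ (2 ^ n)) < \<rho>" "norm (\<phi> (x ^ (2 ^ n))) < d"
    by (auto simp: eventually_sequentially)
  obtain f where chain: "landen_chain (ball c R) x n f"
    using landen_chain_exists[of "ball c R" x n] R x x0 SR by auto
  hence f: "f holomorphic_on ball c R" "f ` ball c R \<subseteq> - {0, 1}" "f (\<phi> x) = \<phi> (x ^ (2 ^ n))"
    by (simp_all add: landen_chain_def)
  have fS: "norm (f y) < \<epsilon>" if "y \<in> ?S" for y
    using d(2)[OF f(1,2) x(2) _ that] n(2) f(3) by simp
  have h1: "(g0 \<circ> f) holomorphic_on ?S"
    by (rule holomorphic_on_compose_gen[OF holomorphic_on_subset[OF f(1) SR] g0(1)]) (use fS in auto)
  have h2: "g0 (f y) \<noteq> 0" if "y \<in> ?S" for y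
    using g0(3)[OF fS[OF that]] phi_0 subsetD[OF f(2) imageI[OF subsetD[OF SR that]]] by auto
  \<comment> \<open>\<open>x ^ (2 ^ n)\<close> lies where \<open>g0\<close> inverts
    \<open>\<phi>\<close>, so \<open>x\<close> is a 2^n-th root of \<open>g0 (f (\<phi> x))\<close>;
    prescribing it selects the branch.\<close>
  have h3: "x ^ (2 ^ n) = g0 (f (\<phi> x))" using g0(2)[OF n(1)] f(3) by simp
  obtain g where g: "g holomorphic_on ?S" "\<And>y. y \<in> ?S \<Longrightarrow> g y ^ (2 ^ n) = (g0 \<circ> f) y" "g (\<phi> x) = x"
    by (rule holomorphic_nth_root[OF h1 convex_ball _ _ x(2), of "2 ^ n" x]) (use h2 h3 in auto)
  have gS: "g ` ?S \<subseteq> ball 0 1"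
  proof -
    have "norm (g y) < 1" if "y \<in> ?S" for y
    proof -
      have "norm (g y) ^ (2 ^ n) < 1"
        using g0(3)[OF fS[OF that]] g(2)[OF that] e(2) by (simp flip: norm_power)
      thus ?thesis by (simp add: power_less_one_iff)
    qed
    thus ?thesis by auto
  qed
  \<comment> \<open>So far only \<phi>(g(y)^(2^n)) = f(y) is known; the last clause of the chain
    undoes the descents.\<close>
  have inv: "\<phi> (g y) = y" if "y \<in> ?S" for y
    by (rule landen_chain_lift[OF chain _ SR x(2) holomorphic_on_imp_continuous_on[OF g(1)] gS g(3)])
       (use g(2) g0(3) fS that in auto)
  have gn: "g y \<noteq> 0" if "y \<in> ?S" for y using inv[OF that] phi_0 subsetD[OF R(2) subsetD[OF SR that]] by auto
  show ?thesis
  proof (rule that[OF g(1) _ inv g(3)])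
    show "g ` ?S \<subseteq> ball 0 1 - {0}"
    proof (rule image_subsetI)
      fix y assume y: "y \<in> ?S"
      show "g y \<in> ball 0 1 - {0}" using subsetD[OF gS imageI[OF y]] gn[OF y] by simp
    qed
  qed
qed

end

section \<open>The covering and its lifts\<close>

lemma avoiding_ball:
  assumes "w \<in> - {0, 1::complex}" obtains R where "R > 0" "ball w R \<subseteq> - {0, 1}"
proof -
  have "open (- {0, 1::complex})" by (intro open_Compl) auto
  thus thesis using assms that open_contains_ball by blast
qed

lemma connected_avoiding: "connected (- {0, 1::complex})"
  unfolding Compl_eq_Diff_UNIV
  by (rule connected_open_delete_finite) (auto intro: convex_connected)

context inverse_nome
begin

definition is_branch :: "complex set \<Rightarrow> (complex \<Rightarrow> complex) \<Rightarrow> bool" where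
  "is_branch T g \<longleftrightarrow> g holomorphic_on T \<and> g ` T \<subseteq> ball 0 1 - {0} \<and> (\<forall>y\<in>T. \<phi> (g y) = y)"

lemma is_branchD:
  assumes "is_branch T g"
  shows "g holomorphic_on T" "\<And>y. y \<in> T \<Longrightarrow> norm (g y) < 1" "\<And>y. y \<in> T \<Longrightarrow> g y \<noteq> 0"
    "\<And>y. y \<in> T \<Longrightarrow> \<phi> (g y) = y" "inj_on g T" "continuous_on T g"
proof -
  show 1: "g holomorphic_on T" and 2: "\<And>y. y \<in> T \<Longrightarrow> \<phi> (g y) = y" using assms by (simp_all add: is_branch_def)
  show "norm (g y) < 1" "g y \<noteq> 0" if "y \<in> T" for y
    using assms imageI[OF that, of g] unfolding is_branch_def by auto
  show "inj_on g T" using 2 by (metis inj_onI)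
  show "continuous_on T g" using 1 by (rule holomorphic_on_imp_continuous_on)
qed

lemma is_branch_open: "is_branch T g \<Longrightarrow> open U \<Longrightarrow> U \<subseteq> T \<Longrightarrow> open (g ` U)"
  using is_branchD(1,5) open_mapping_thm3 holomorphic_on_subset inj_on_subset by meson

text \<open>The image of a branch is open, so \<open>m\<close> takes values in it near
  \<open>y\<close>, and \<open>\<phi>\<close> is injective there. This serves uniqueness of branches
  as well as holomorphy of continuous lifts.\<close>

lemma continuous_right_inverse_eq_branch:
  assumes T: "open T" "is_branch T g" and m: "isCont m y" "y \<in> T" "m y = g y"
    and inv: "eventually (\<lambda>u. \<phi> (m u) = u) (nhds y)"
  shows "eventually (\<lambda>u. m u = g u) (nhds y)"
proof -
  have "open (g ` T)" using T by (intro is_branch_open) auto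
  moreover have "(m \<longlongrightarrow> g y) (nhds y)" using m by (simp add: continuous_within tendsto_nhds_iff)
  ultimately have "eventually (\<lambda>u. m u \<in> g ` T) (nhds y)"
    using m(2) by (intro topological_tendstoD) auto
  with inv show ?thesis
  proof eventually_elim
    case (elim u)
    then obtain v where v: "v \<in> T" "m u = g v" by blast
    have "\<phi> (g v) = v" by (rule is_branchD(4)[OF T(2) v(1)])
    hence "v = u" using v(2) elim(1) by simp
    thus ?case using v by simp
  qed
qed

lemma is_branch_unique:
  assumes T: "open T" "connected T" and g: "is_branch T g" "is_branch T h" and y: "y \<in> T" "g y = h y" and u: "u \<in> T"
  shows "g u = h u"
proof -
  have "eventually (\<lambda>u. u \<in> T) (nhds y)" using T(1) y(1) by (rule eventually_nhds_in_open)
  hence ev: "eventually (\<lambda>u. \<phi> (g u) = u) (nhds y)"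
    by eventually_elim (rule is_branchD(4)[OF g(1)])
  have "isCont g y"
    using is_branchD(6)[OF g(1)] T(1) y(1) by (simp add: continuous_on_eq_continuous_at)
  from continuous_right_inverse_eq_branch[OF T(1) g(2) this y ev]
  have "eventually (\<lambda>u. g u = h u) (nhds y)" .
  then obtain U where U: "open U" "y \<in> U" "\<And>u. u \<in> U \<Longrightarrow> g u = h u"
    by (auto simp: eventually_nhds)
  show ?thesis
  proof (rule analytic_continuation_open[of "U \<inter> T" T g h])
    show "open (U \<inter> T)" using U(1) T(1) by (rule open_Int)
    show "U \<inter> T \<noteq> {}" using U(2) y(1) by auto
  qed (use T u U(3) is_branchD(1)[OF g(1)] is_branchD(1)[OF g(2)] in simp_all)
qed

lemma branch_exists:
  assumes "R > 0" "ball c R \<subseteq> - {0, 1}" "norm x < 1" "\<phi> x \<in> ball c (R / 4)"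
  obtains g where "is_branch (ball c (R / 4)) g" "g (\<phi> x) = x"
proof -
  obtain g where g: "g holomorphic_on ball c (R / 4)" "g ` ball c (R / 4) \<subseteq> ball 0 1 - {0}"
    "\<And>y. y \<in> ball c (R / 4) \<Longrightarrow> \<phi> (g y) = y" "g (\<phi> x) = x"
    by (rule phi_branch[OF assms]) (rule that)
  have "is_branch (ball c (R / 4)) g" using g by (simp add: is_branch_def)
  thus thesis using g(4) by (rule that)
qed

text \<open>One preimage over a quarter disk yields a branch on all of it, so such a disk lies in
  the image or misses it. The image is therefore open and closed in the connected, twice punctured
  plane.\<close>

lemma phi_image: "\<phi> ` (ball 0 1 - {0}) = - {0, 1}"
proof -
  let ?I = "\<phi> ` (ball 0 1 - {0})"
  have sub: "?I \<subseteq> - {0, 1}" using phi_avoids by auto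
  have dich: "ball w (R / 4) \<subseteq> ?I \<or> ball w (R / 4) \<inter> ?I = {}" if R: "R > 0" "ball w R \<subseteq> - {0, 1}" for w R
  proof (rule disjCI)
    assume "ball w (R / 4) \<inter> ?I \<noteq> {}"
    then obtain x where "x \<in> ball 0 1 - {0}" and x: "\<phi> x \<in> ball w (R / 4)" by blast
    hence "norm x < 1" by simp
    then obtain g where g: "is_branch (ball w (R / 4)) g" by (rule branch_exists[OF R _ x])
    show "ball w (R / 4) \<subseteq> ?I"
    proof
      fix y assume y: "y \<in> ball w (R / 4)"
      show "y \<in> ?I" using is_branchD(2-4)[OF g y] by (intro image_eqI[of _ _ "g y"]) auto
    qed
  qed
  have "open ?I"
  proof (subst open_contains_ball, rule ballI)
    fix w assume w: "w \<in> ?I"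
    hence "w \<in> - {0, 1}" using sub by blast
    then obtain R where R: "R > 0" "ball w R \<subseteq> - {0, 1}" by (rule avoiding_ball)
    have "w \<in> ball w (R / 4)" using R by simp
    hence "ball w (R / 4) \<subseteq> ?I" using dich[OF R] w by blast
    thus "\<exists>e>0. ball w e \<subseteq> ?I" using R by (intro exI[of _ "R / 4"]) simp
  qed
  moreover have "open (- {0, 1} - ?I)"
  proof (subst open_contains_ball, rule ballI)
    fix w assume w: "w \<in> - {0, 1} - ?I"
    then obtain R where R: "R > 0" "ball w R \<subseteq> - {0, 1}" using avoiding_ball by blast
    have "w \<in> ball w (R / 4)" using R by simp
    hence "ball w (R / 4) \<inter> ?I = {}" using dich[OF R] w by blast
    moreover have "ball w (R / 4) \<subseteq> ball w R" using R by auto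
    ultimately have "ball w (R / 4) \<subseteq> - {0, 1} - ?I" using R(2) by blast
    thus "\<exists>e>0. ball w e \<subseteq> - {0, 1} - ?I" using R by (intro exI[of _ "R / 4"]) simp
  qed
  moreover have "?I \<noteq> {}"
  proof -
    have "\<phi> (1/2) \<in> ?I" by (intro imageI) (simp add: norm_divide)
    thus ?thesis by blast
  qed
  ultimately have "- {0, 1} - ?I = {}"
    using connectedD[OF connected_avoiding, of ?I "- {0, 1} - ?I"] sub by auto
  thus ?thesis using sub by blast
qed

text \<open>The sheets over a quarter disk are the images of the branches on it. If two of them
  meet, the branches have a common value at the same point and agree by uniqueness.\<close>

lemma phi_covering: "covering_space (ball 0 1 - {0}) \<phi> (- {0, 1})"
proof
  show cont: "continuous_on (ball 0 1 - {0}) \<phi>"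
    using holomorphic_on_imp_continuous_on[OF phi_hol] by (rule continuous_on_subset) auto
  show "\<phi> ` (ball 0 1 - {0}) = - {0, 1}" by (rule phi_image)
  fix w :: complex assume "w \<in> - {0, 1}"
  then obtain R where R: "R > 0" "ball w R \<subseteq> - {0, 1}" by (rule avoiding_ball)
  define T where "T = ball w (R / 4)"
  define v where "v = {g ` T | g. is_branch T g}"
  have "T \<subseteq> ball w R" using R(1) by (auto simp: T_def)
  hence TR: "T \<subseteq> - {0, 1}" using R(2) by (rule subset_trans)
  have T: "open T" "connected T" by (auto simp: T_def)
  have 1: "\<Union>v = (ball 0 1 - {0}) \<inter> \<phi> -` T"
  proof
    show "\<Union>v \<subseteq> (ball 0 1 - {0}) \<inter> \<phi> -` T"
      using is_branchD(2-4) by (fastforce simp: v_def)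
    show "(ball 0 1 - {0}) \<inter> \<phi> -` T \<subseteq> \<Union>v"
    proof
      fix x assume x: "x \<in> (ball 0 1 - {0}) \<inter> \<phi> -` T"
      then obtain g where g: "is_branch T g" "g (\<phi> x) = x"
        using branch_exists[OF R, of x] by (auto simp: T_def)
      have "x \<in> g ` T" using g(2) x by (metis IntD2 imageI vimageE)
      thus "x \<in> \<Union>v" using g(1) by (auto simp: v_def)
    qed
  qed
  have 2: "\<forall>u\<in>v. openin (top_of_set (ball 0 1 - {0})) u"
  proof
    fix u assume "u \<in> v"
    then obtain g where g: "is_branch T g" "u = g ` T" by (auto simp: v_def)
    have "open u" unfolding g(2) using g(1) T(1) by (rule is_branch_open) simp
    moreover have "u \<subseteq> ball 0 1 - {0}" using g by (simp add: is_branch_def)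
    ultimately show "openin (top_of_set (ball 0 1 - {0})) u" by (rule open_subset[rotated])
  qed
  have 3: "pairwise disjnt v"
  proof (rule pairwiseI)
    fix a b assume ab: "a \<in> v" "b \<in> v" "a \<noteq> b"
    then obtain g h where g: "is_branch T g" "a = g ` T" and h: "is_branch T h" "b = h ` T" by (auto simp: v_def)
    show "disjnt a b"
    proof (rule ccontr)
      assume "\<not> disjnt a b"
      then obtain y y' where y: "y \<in> T" "y' \<in> T" "g y = h y'" by (auto simp: disjnt_def g h)
      have "y = y'" using is_branchD(4)[OF g(1) y(1)] is_branchD(4)[OF h(1) y(2)] y(3) by simp
      hence "g u = h u" if "u \<in> T" for u
        using is_branch_unique[OF T g(1) h(1) y(1) _ that] y(3) by simp
      hence "a = b" unfolding g h by (intro image_cong) auto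
      thus False using ab by simp
    qed
  qed
  have 4: "\<forall>u\<in>v. \<exists>q. homeomorphism u T \<phi> q"
  proof
    fix u assume "u \<in> v"
    then obtain g where g: "is_branch T g" "u = g ` T" by (auto simp: v_def)
    have "homeomorphism u T \<phi> g"
      unfolding homeomorphism_def
    proof (intro conjI ballI)
      show "continuous_on u \<phi>" using cont by (rule continuous_on_subset) (use g in \<open>simp add: is_branch_def\<close>)
      show "continuous_on T g" by (rule is_branchD(6)[OF g(1)])
      show "g ` T = u" using g by simp
      have "\<phi> ` g ` T = (\<lambda>y. y) ` T" unfolding image_image
        by (rule image_cong[OF refl]) (rule is_branchD(4)[OF g(1)])
      thus "\<phi> ` u = T" by (simp add: g)
      show "\<phi> (g y) = y" if "y \<in> T" for y using is_branchD(4)[OF g(1) that] .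
      show "g (\<phi> x) = x" if "x \<in> u" for x using that is_branchD(4)[OF g(1)] by (auto simp: g(2))
    qed
    thus "\<exists>q. homeomorphism u T \<phi> q" by blast
  qed
  have 5: "openin (top_of_set (- {0, 1})) T" using T(1) TR by (rule open_subset[rotated])
  have 6: "w \<in> T" using R by (simp add: T_def)
  show "\<exists>T. w \<in> T \<and> openin (top_of_set (- {0, 1})) T \<and>
          (\<exists>v. \<Union>v = (ball 0 1 - {0}) \<inter> \<phi> -` T \<and> (\<forall>u\<in>v. openin (top_of_set (ball 0 1 - {0})) u) \<and>
             pairwise disjnt v \<and> (\<forall>u\<in>v. \<exists>q. homeomorphism u T \<phi> q))"
    by (rule exI[of _ T], intro conjI 5 6, rule exI[of _ v]) (intro conjI 1 2 3 4)
qed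

section \<open>Lifting curves that start at the puncture\<close>

definition is_lift :: "(real \<Rightarrow> complex) \<Rightarrow> (real \<Rightarrow> complex) \<Rightarrow> bool" where
  "is_lift \<gamma> \<eta> \<longleftrightarrow> path \<eta> \<and> \<eta> 0 = 0 \<and> (\<forall>t\<in>{0..1}. norm (\<eta> t) < 1 \<and> \<phi> (\<eta> t) = \<gamma> t)"

lemma phi_eq_0_iff: "norm z < 1 \<Longrightarrow> \<phi> z = 0 \<longleftrightarrow> z = 0"
  using phi_avoids phi_0 by auto

text \<open>Near \<open>0\<close> both lifts are the local inverse of \<open>\<phi>\<close> at \<open>0\<close> composed with \<open>\<gamma>\<close>.\<close>

lemma is_lift_unique:
  assumes \<gamma>: "\<And>t. t \<in> {0<..1} \<Longrightarrow> \<gamma> t \<notin> {0, 1}" and \<eta>: "is_lift \<gamma> \<eta>" "is_lift \<gamma> \<eta>'" and t: "t \<in> {0..1}"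
  shows "\<eta> t = \<eta>' t"
proof -
  obtain g \<rho> \<epsilon> where e: "0 < \<rho>" "\<rho> \<le> 1" "0 < \<epsilon>" "\<epsilon> \<le> 1" and g: "g holomorphic_on ball 0 \<epsilon>"
    "\<And>w. norm w < \<rho> \<Longrightarrow> g (\<phi> w) = w" "\<And>z. norm z < \<epsilon> \<Longrightarrow> norm (g z) < \<rho> \<and> \<phi> (g z) = z"
    by (rule phi_local_inverse) (rule that)
  have near: "\<exists>d>0. \<forall>t\<in>{0..1}. t < d \<longrightarrow> norm (\<zeta> t) < \<rho>" if "is_lift \<gamma> \<zeta>" for \<zeta>
  proof -
    have "continuous_on {0..1} \<zeta>" "\<zeta> 0 = 0" using that by (simp_all add: is_lift_def path_def)
    thus ?thesis using e(1) unfolding continuous_on_iff by (force simp: dist_norm)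
  qed
  obtain d where d: "d > 0" "\<And>t. t \<in> {0..1} \<Longrightarrow> t < d \<Longrightarrow> norm (\<eta> t) < \<rho>" using near[OF \<eta>(1)] by blast
  obtain d' where d': "d' > 0" "\<And>t. t \<in> {0..1} \<Longrightarrow> t < d' \<Longrightarrow> norm (\<eta>' t) < \<rho>" using near[OF \<eta>(2)] by blast
  define a where "a = min (min (d / 2) (d' / 2)) 1"
  have a: "0 < a" "a \<le> 1" "a < d" "a < d'" using d(1) d'(1) by (auto simp: a_def)
  have "\<eta> a = g (\<gamma> a)" "\<eta>' a = g (\<gamma> a)"
    using g(2)[OF d(2)[of a]] g(2)[OF d'(2)[of a]] \<eta> a by (auto simp: is_lift_def)
  hence eq: "\<eta> a = \<eta>' a" by simp
  have c: "continuous_on {0<..1} \<zeta>" "\<zeta> \<in> {0<..1} \<rightarrow> ball 0 1 - {0}" "\<And>t. t \<in> {0<..1} \<Longrightarrow> \<gamma> t = \<phi> (\<zeta> t)"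
    if z: "is_lift \<gamma> \<zeta>" for \<zeta>
  proof -
    show "continuous_on {0<..1} \<zeta>"
      using z unfolding is_lift_def path_def by (auto elim: continuous_on_subset)
    show *: "\<gamma> t = \<phi> (\<zeta> t)" if "t \<in> {0<..1}" for t using z that by (simp add: is_lift_def)
    show "\<zeta> \<in> {0<..1} \<rightarrow> ball 0 1 - {0}"
    proof
      fix t :: real assume t: "t \<in> {0<..1}"
      hence "norm (\<zeta> t) < 1" using z by (simp add: is_lift_def)
      moreover have "\<zeta> t \<noteq> 0" using *[OF t] \<gamma>[OF t] phi_0 by auto
      ultimately show "\<zeta> t \<in> ball 0 1 - {0}" by simp
    qed
  qed
  have \<gamma>c: "continuous_on {0<..1} \<gamma>"
  proof -
    have "continuous_on {0<..1} (\<lambda>t. \<phi> (\<eta> t))"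
      by (rule continuous_on_compose2[OF covering_space_imp_continuous[OF phi_covering] c(1)[OF \<eta>(1)]])
         (rule funcset_image[OF c(2)[OF \<eta>(1)]])
    thus ?thesis using c(3)[OF \<eta>(1)] by (subst continuous_on_cong[OF refl]) auto
  qed
  show ?thesis
  proof (cases "t = 0")
    case True thus ?thesis using \<eta> by (simp add: is_lift_def)
  next
    case False
    show ?thesis
      by (rule covering_space_lift_unique[OF phi_covering eq \<gamma>c _ c(1,2)[OF \<eta>(1)] c(3)[OF \<eta>(1)] c(1,2)[OF \<eta>(2)] c(3)[OF \<eta>(2)]])
         (use \<gamma> a t False in auto)
  qed
qed

text \<open>The covering says nothing at time 0, where all curves sit at the puncture. Uniform
  continuity provides one time \<open>a\<close> up to which all of them stay in the domain of the
  local inverse \<open>g\<close> at 0; from then on the homotopy lifting property continues the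
  values \<open>g (h (s, a))\<close>.\<close>

lemma lift_family:
  fixes h :: "real \<times> real \<Rightarrow> complex"
  assumes h: "continuous_on ({0..1} \<times> {0..1}) h" "\<And>s. s \<in> {0..1} \<Longrightarrow> h (s, 0) = 0"
    "\<And>s t. s \<in> {0..1} \<Longrightarrow> t \<in> {0<..1} \<Longrightarrow> h (s, t) \<notin> {0, 1}"
  obtains k :: "real \<times> real \<Rightarrow> complex" where "continuous_on ({0..1} \<times> {0..1}) k"
    "\<And>s. s \<in> {0..1} \<Longrightarrow> is_lift (\<lambda>t. h (s, t)) (\<lambda>t. k (s, t))"
proof -
  obtain g \<rho> \<epsilon> where e: "0 < \<rho>" "\<rho> \<le> 1" "0 < \<epsilon>" "\<epsilon> \<le> 1" and g: "g holomorphic_on ball 0 \<epsilon>"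
    "\<And>w. norm w < \<rho> \<Longrightarrow> g (\<phi> w) = w" "\<And>z. norm z < \<epsilon> \<Longrightarrow> norm (g z) < \<rho> \<and> \<phi> (g z) = z"
    by (rule phi_local_inverse) (rule that)
  have g0: "g 0 = 0" using g(2)[of 0] e(1) phi_0 by simp
  have "uniformly_continuous_on ({0..1} \<times> {0..1}) h"
    by (intro compact_uniformly_continuous h(1) compact_Times compact_Icc)
  then obtain d where d: "d > 0"
    "\<And>x x'. x \<in> {0..1} \<times> {0..1} \<Longrightarrow> x' \<in> {0..1} \<times> {0..1} \<Longrightarrow> dist x' x < d \<Longrightarrow> dist (h x') (h x) < \<epsilon>"
    unfolding uniformly_continuous_on_def using e(3) by metis
  define a where "a = min (d / 2) (1 / 2)"
  have a: "0 < a" "a < 1" "a < d" using d(1) by (auto simp: a_def)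
  have near: "norm (h (s, t)) < \<epsilon>" if "s \<in> {0..1}" "t \<in> {0..a}" for s t
    using d(2)[of "(s, 0)" "(s, t)"] that a h(2)[of s] by (auto simp: dist_Pair_Pair)
  \<comment> \<open>Time becomes the first argument and is rescaled from [a, 1] to [0, 1], as
    homotopies are lifted from the value 0 of their first argument.\<close>
  define H where "H = (\<lambda>(t, s). h (s, a + (1 - a) * t))"
  have aI: "a + (1 - a) * t \<in> {0<..1}" if "t \<in> {0..1}" for t
  proof -
    have "(1 - a) * t \<le> 1 - a" "0 \<le> (1 - a) * t" using a that by (auto intro: mult_left_le)
    thus ?thesis using a(1) by auto
  qed
  have Hc: "continuous_on ({0..1} \<times> {0..1}) H"
    unfolding H_def case_prod_unfold
    by (rule continuous_on_compose2[OF h(1)]) (use aI in \<open>force intro!: continuous_intros\<close>)+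
  have Him: "H \<in> ({0..1} \<times> {0..1}) \<rightarrow> - {0, 1}" using h(3) aI by (force simp: H_def)
  have fc: "continuous_on {0..1} (\<lambda>s. g (h (s, a)))"
  proof (rule continuous_on_compose2[OF holomorphic_on_imp_continuous_on[OF g(1)]])
    show "continuous_on {0..1} (\<lambda>s. h (s, a))"
      by (rule continuous_on_compose2[OF h(1)]) (use a in \<open>auto intro!: continuous_intros\<close>)
    show "(\<lambda>s. h (s, a)) ` {0..1} \<subseteq> ball 0 \<epsilon>" using near a by auto
  qed
  have inD: "norm (g (h (s, t))) < 1 \<and> \<phi> (g (h (s, t))) = h (s, t)" if "s \<in> {0..1}" "t \<in> {0..a}" for s t
    using g(3)[OF near[OF that]] e by auto
  have fim: "(\<lambda>s. g (h (s, a))) \<in> {0..1} \<rightarrow> ball 0 1 - {0}"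
  proof
    fix s :: real assume s: "s \<in> {0..1}"
    have "h (s, a) \<noteq> 0" using h(3)[OF s, of a] a by auto
    hence "g (h (s, a)) \<noteq> 0" using inD[OF s, of a] a phi_0 by auto
    thus "g (h (s, a)) \<in> ball 0 1 - {0}" using inD[OF s, of a] a by simp
  qed
  have Heq: "H (0, s) = \<phi> (g (h (s, a)))" if "s \<in> {0..1}" for s
    using inD[OF that, of a] a by (simp add: H_def)
  obtain K where K: "continuous_on ({0..1} \<times> {0..1}) K" "K \<in> ({0..1} \<times> {0..1}) \<rightarrow> ball 0 1 - {0}"
    "\<And>s. s \<in> {0..1} \<Longrightarrow> K (0, s) = g (h (s, a))" "\<And>z. z \<in> {0..1} \<times> {0..1} \<Longrightarrow> H z = \<phi> (K z)"
    by (rule covering_space_lift_homotopy[OF phi_covering Hc Him Heq fc fim]) (assumption | rule that)+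
  define k where "k = (\<lambda>x. if snd x \<le> a then g (h x) else K ((snd x - a) / (1 - a), fst x))"
  have tI: "(t - a) / (1 - a) \<in> {0..1}" if "t \<in> {a..1}" for t using that a by (simp add: divide_le_eq)
  show ?thesis
  proof
    have split: "{0..1} \<times> {0..1} = ({0..1} \<times> {0..a}) \<union> ({0..1} \<times> {a..1::real})" using a by auto
    show kc: "continuous_on ({0..1} \<times> {0..1}) k"
      unfolding k_def split
    proof (rule continuous_on_cases)
      show "closed ({0..1::real} \<times> {0..a})" "closed ({0..1::real} \<times> {a..1})" by (intro closed_Times closed_atLeastAtMost)+
      show "continuous_on ({0..1} \<times> {0..a}) (\<lambda>x. g (h x))"
        by (rule continuous_on_compose2[OF holomorphic_on_imp_continuous_on[OF g(1)] continuous_on_subset[OF h(1)]])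
           (use near a in auto)
      show "continuous_on ({0..1} \<times> {a..1}) (\<lambda>x. K ((snd x - a) / (1 - a), fst x))"
        by (rule continuous_on_compose2[OF K(1)]) (use tI a in \<open>auto intro!: continuous_intros\<close>)
      show "\<forall>x. x \<in> {0..1} \<times> {0..a} \<and> \<not> snd x \<le> a \<or> x \<in> {0..1} \<times> {a..1} \<and> snd x \<le> a \<longrightarrow>
          g (h x) = K ((snd x - a) / (1 - a), fst x)"
        using K(3) by auto
    qed
    fix s :: real assume s: "s \<in> {0..1}"
    show "is_lift (\<lambda>t. h (s, t)) (\<lambda>t. k (s, t))"
      unfolding is_lift_def
    proof (intro conjI ballI)
      show "path (\<lambda>t. k (s, t))" unfolding path_def
        by (rule continuous_on_compose2[OF kc]) (use s in \<open>auto intro!: continuous_intros\<close>)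
      show "k (s, 0) = 0" using h(2)[OF s] g0 a by (simp add: k_def)
      fix t :: real assume t: "t \<in> {0..1}"
      have "norm (k (s, t)) < 1 \<and> \<phi> (k (s, t)) = h (s, t)"
      proof (cases "t \<le> a")
        case True thus ?thesis using inD[OF s, of t] t by (simp add: k_def)
      next
        case False
        define t' where "t' = (t - a) / (1 - a)"
        have t': "t' \<in> {0..1}" "a + (1 - a) * t' = t" using tI[of t] False t a by (auto simp: t'_def)
        have "K (t', s) \<in> ball 0 1 - {0}" using K(2) t' s by blast
        moreover have "\<phi> (K (t', s)) = h (s, t)" using K(4)[of "(t', s)"] t' s by (simp add: H_def)
        moreover have "k (s, t) = K (t', s)" using False by (simp add: k_def t'_def)
        ultimately show ?thesis by simp
      qed
      thus "norm (k (s, t)) < 1" "\<phi> (k (s, t)) = h (s, t)" by auto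
    qed
  qed
qed

end

section \<open>Classes of curves and endpoints of lifts\<close>

lemma origin_curvesD:
  assumes "\<gamma> \<in> origin_curves"
  shows "path \<gamma>" "\<gamma> 0 = 0" "pathfinish \<gamma> \<noteq> 1"
    "pathfinish \<gamma> = 0 \<Longrightarrow> t \<in> {0..1} \<Longrightarrow> \<gamma> t = 0"
    "pathfinish \<gamma> \<noteq> 0 \<Longrightarrow> t \<in> {0<..1} \<Longrightarrow> \<gamma> t \<notin> {0, 1}"
  using assms by (force simp: origin_curves_def pathstart_def pathfinish_def)+

lemma origin_curvesI:
  assumes "path \<gamma>" "\<gamma> 0 = 0" "\<And>t. t \<in> {0<..1} \<Longrightarrow> \<gamma> t \<notin> {0, 1}"
  shows "\<gamma> \<in> origin_curves"
  using assms by (simp add: origin_curves_def pathstart_def)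

lemma origin_curves_zero: "(\<lambda>t. 0) \<in> origin_curves"
  by (simp add: origin_curves_def path_def pathstart_def)

text \<open>Membership depends on the values on the unit interval only; this is the congruence under
  which \<open>homotopic_with\<close> unfolds to an explicit homotopy.\<close>

lemma origin_curves_cong:
  assumes "\<And>t. t \<in> {0..1} \<Longrightarrow> h t = k t"
  shows "h \<in> origin_curves \<and> pathfinish h = c \<longleftrightarrow> k \<in> origin_curves \<and> pathfinish k = c"
proof -
  have "path h \<longleftrightarrow> path k" unfolding path_def by (rule continuous_on_cong[OF refl]) (rule assms)
  moreover have "h 0 = k 0" "h 1 = k 1" using assms by auto
  moreover have "(\<forall>t\<in>{0<..1}. h t \<notin> {0, 1}) \<longleftrightarrow> (\<forall>t\<in>{0<..1}. k t \<notin> {0, 1})"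
    by (rule ball_cong[OF refl]) (simp add: assms)
  moreover have "(\<forall>t\<in>{0..1}. h t = 0) \<longleftrightarrow> (\<forall>t\<in>{0..1}. k t = 0)"
    by (rule ball_cong[OF refl]) (simp add: assms)
  ultimately show ?thesis by (simp add: origin_curves_def pathstart_def pathfinish_def)
qed

lemma curve_rel_iff:
  "(\<gamma>, \<delta>) \<in> curve_rel \<longleftrightarrow>
    (\<exists>h. continuous_on ({0..1::real} \<times> {0..1}) h \<and> (\<forall>t\<in>{0..1}. h (0, t) = \<gamma> t) \<and> (\<forall>t\<in>{0..1}. h (1, t) = \<delta> t) \<and>
       (\<forall>s\<in>{0..1}. (\<lambda>t. h (s, t)) \<in> origin_curves \<and> pathfinish (\<lambda>t. h (s, t)) = pathfinish \<gamma>))"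
proof -
  have top: "prod_topology (top_of_set {0..1::real}) (top_of_set {0..1::real}) = top_of_set ({0..1} \<times> {0..1})"
    by (rule prod_topology_subtopology_eu)
  have "(\<gamma>, \<delta>) \<in> curve_rel \<longleftrightarrow> homotopic_with_canon
      (\<lambda>\<eta>. \<eta> \<in> origin_curves \<and> pathfinish \<eta> = pathfinish \<gamma>) {0..1} UNIV \<gamma> \<delta>"
    by (simp add: curve_rel_def)
  also have "\<dots> \<longleftrightarrow> (\<exists>h. continuous_on ({0..1::real} \<times> {0..1}) h \<and> (\<forall>t\<in>{0..1}. h (0, t) = \<gamma> t) \<and> (\<forall>t\<in>{0..1}. h (1, t) = \<delta> t) \<and>
       (\<forall>s\<in>{0..1}. (\<lambda>t. h (s, t)) \<in> origin_curves \<and> pathfinish (\<lambda>t. h (s, t)) = pathfinish \<gamma>))"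
    by (subst homotopic_with, rule origin_curves_cong) (simp_all add: top)
  finally show ?thesis .
qed

lemma curve_class_eq_iff:
  assumes "\<gamma> \<in> origin_curves" "\<delta> \<in> origin_curves"
  shows "curve_class \<gamma> = curve_class \<delta> \<longleftrightarrow> (\<gamma>, \<delta>) \<in> curve_rel"
  unfolding curve_class_def using eq_equiv_class_iff[OF equiv_curve_rel assms] .

lemma Omega_cases:
  assumes "P \<in> Omega" obtains \<gamma> where "\<gamma> \<in> origin_curves" "P = curve_class \<gamma>"
  using assms unfolding Omega_def curve_class_def by (rule quotientE)

text \<open>On \<open>(0, 1]\<close> both paths have logarithms, which are joined by the straight-line homotopy; the real parts tend
  to \<open>-\<infinity>\<close> at \<open>0\<close>, so the resulting homotopy extends continuously by \<open>0\<close>.\<close>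

lemma punctured_disk_homotopy:
  fixes \<eta> \<eta>' :: "real \<Rightarrow> complex"
  assumes \<eta>: "path \<eta>" "\<eta> 0 = 0" "\<And>t. t \<in> {0<..1} \<Longrightarrow> \<eta> t \<noteq> 0"
    and \<eta>': "path \<eta>'" "\<eta>' 0 = 0" "\<And>t. t \<in> {0<..1} \<Longrightarrow> \<eta>' t \<noteq> 0"
    and fin: "\<eta> 1 = \<eta>' 1"
  obtains m :: "real \<times> real \<Rightarrow> complex" where "continuous_on ({0..1} \<times> {0..1}) m" "\<And>t. t \<in> {0..1} \<Longrightarrow> m (0, t) = \<eta> t"
    "\<And>t. t \<in> {0..1} \<Longrightarrow> m (1, t) = \<eta>' t" "\<And>s. s \<in> {0..1} \<Longrightarrow> m (s, 1) = \<eta> 1" "\<And>s. m (s, 0) = 0"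
    "\<And>s t. t \<in> {0<..1} \<Longrightarrow> m (s, t) \<noteq> 0"
    "\<And>s t. s \<in> {0..1} \<Longrightarrow> t \<in> {0..1} \<Longrightarrow> norm (m (s, t)) \<le> max (norm (\<eta> t)) (norm (\<eta>' t))"
proof -
  have con: "contractible {0<..1::real}" by (intro convex_imp_contractible convex_real_interval)
  have log: "\<exists>z. continuous_on {0<..1} z \<and> (\<forall>t\<in>{0<..1}. f t = exp (z t))"
    if "path f" "\<And>t. t \<in> {0<..1} \<Longrightarrow> f t \<noteq> 0" for f :: "real \<Rightarrow> complex"
  proof -
    have "continuous_on {0<..1} f" using that(1) unfolding path_def by (rule continuous_on_subset) auto
    from continuous_logarithm_on_contractible[OF this con that(2)] show ?thesis by metis
  qed
  obtain z where z: "continuous_on {0<..1} z" "\<And>t. t \<in> {0<..1} \<Longrightarrow> \<eta> t = exp (z t)"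
    using log[OF \<eta>(1,3)] by blast
  obtain z0 where z0: "continuous_on {0<..1} z0" "\<And>t. t \<in> {0<..1} \<Longrightarrow> \<eta>' t = exp (z0 t)"
    using log[OF \<eta>'(1,3)] by blast
  \<comment> \<open>Shifted by a multiple of 2 pi i, the second logarithm agrees with the first at
    time 1, so that the straight-line homotopy fixes the endpoint.\<close>
  define z' where "z' = (\<lambda>t. z0 t + (z 1 - z0 1))"
  have z'c: "continuous_on {0<..1} z'" unfolding z'_def by (intro continuous_intros z0)
  have "exp (z 1 - z0 1) = 1" using z(2)[of 1] z0(2)[of 1] fin by (simp add: exp_diff)
  hence z': "\<eta>' t = exp (z' t)" if "t \<in> {0<..1}" for t
    using z0(2)[OF that] by (simp add: z'_def exp_add)
  define m where "m = (\<lambda>(s, t). if t \<le> 0 then 0 else exp (of_real (1 - s) * z t + of_real s * z' t))"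
  \<comment> \<open>|m| is a weighted geometric mean of the two moduli. The bound gives continuity
    at t = 0 and keeps the homotopy of two paths in the unit disk inside it.\<close>
  have bound: "norm (m (s, t)) \<le> max (norm (\<eta> t)) (norm (\<eta>' t))" if "s \<in> {0..1}" "t \<in> {0..1}" for s t
  proof (cases "t = 0")
    case True thus ?thesis by (simp add: m_def le_max_iff_disj)
  next
    case False
    hence t: "t \<in> {0<..1}" using that by auto
    have "norm (m (s, t)) = exp ((1 - s) * Re (z t) + s * Re (z' t))" using t by (simp add: m_def)
    also have "(1 - s) * Re (z t) + s * Re (z' t) \<le> (1 - s) * max (Re (z t)) (Re (z' t)) + s * max (Re (z t)) (Re (z' t))"
      using that(1) by (intro add_mono mult_left_mono) auto
    hence "exp ((1 - s) * Re (z t) + s * Re (z' t)) \<le> exp (max (Re (z t)) (Re (z' t)))" by (simp add: algebra_simps)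
    also have "\<dots> = max (norm (\<eta> t)) (norm (\<eta>' t))"
      using z(2)[OF t] z'[OF t] by (simp add: max_def)
    finally show ?thesis .
  qed
  show ?thesis
  proof
    show "continuous_on ({0..1} \<times> {0..1}) m"
      unfolding continuous_on_eq_continuous_within
    proof
      fix x :: "real \<times> real" assume x: "x \<in> {0..1} \<times> {0..1}"
      show "continuous (at x within {0..1} \<times> {0..1}) m"
      proof (cases "snd x = 0")
        case True
        have c: "continuous_on ({0..1::real} \<times> {0..1}) (\<lambda>x. max (norm (f (snd x))) (norm (g (snd x))))"
          if "path f" "path g" for f g :: "real \<Rightarrow> complex"
          by (intro continuous_on_max continuous_on_norm continuous_on_compose2[OF that(1)[unfolded path_def]]
                continuous_on_compose2[OF that(2)[unfolded path_def]] continuous_on_snd continuous_on_id) auto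
        have "((\<lambda>x. max (norm (\<eta> (snd x))) (norm (\<eta>' (snd x)))) \<longlongrightarrow> max (norm (\<eta> (snd x))) (norm (\<eta>' (snd x))))
            (at x within {0..1} \<times> {0..1})"
          using c[OF \<eta>(1) \<eta>'(1)] x unfolding continuous_on_def by blast
        hence "((\<lambda>x. max (norm (\<eta> (snd x))) (norm (\<eta>' (snd x)))) \<longlongrightarrow> 0) (at x within {0..1} \<times> {0..1})"
          using True \<eta>(2) \<eta>'(2) by simp
        moreover have "eventually (\<lambda>y. norm (m y) \<le> max (norm (\<eta> (snd y))) (norm (\<eta>' (snd y)))) (at x within {0..1} \<times> {0..1})"
          unfolding eventually_at_filter using bound by (intro always_eventually) auto
        ultimately have "(m \<longlongrightarrow> 0) (at x within {0..1} \<times> {0..1})"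
          by (rule Lim_null_comparison[rotated])
        moreover have "m x = 0" using True by (simp add: m_def case_prod_unfold)
        ultimately show ?thesis by (simp add: continuous_within)
      next
        case False
        have "continuous_on ({0..1::real} \<times> {0<..1::real}) (\<lambda>x. exp (of_real (1 - fst x) * z (snd x) + of_real (fst x) * z' (snd x)))"
          by (intro continuous_intros continuous_on_compose2[OF z(1)] continuous_on_compose2[OF z'c]) auto
        hence "continuous_on ({0..1::real} \<times> {0<..1::real}) m"
          by (subst continuous_on_cong[OF refl]) (auto simp: m_def)
        hence "continuous (at x within {0..1} \<times> {0<..1}) m"
          unfolding continuous_on_eq_continuous_within
          by (rule bspec) (use x False in \<open>auto simp: mem_Times_iff\<close>)
        \<comment> \<open>The removed edge t = 0 has positive distance from \<open>x\<close>, so the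
          filter is the same.\<close>
        moreover have "at x within {0..1} \<times> {0<..1} = at x within {0..1} \<times> {0..1}"
          by (rule at_within_nhd[of x "UNIV \<times> {0<..}"])
             (use x False in \<open>auto simp: mem_Times_iff intro!: open_Times\<close>)
        ultimately show ?thesis by simp
      qed
    qed
    show "m (0, t) = \<eta> t" if "t \<in> {0..1}" for t using that z(2) \<eta>(2) by (auto simp: m_def)
    show "m (1, t) = \<eta>' t" if "t \<in> {0..1}" for t using that z' \<eta>'(2) by (auto simp: m_def)
    show "m (s, 1) = \<eta> 1" for s
    proof -
      have "of_real (1 - s) * z 1 + of_real s * z' 1 = z 1" by (simp add: z'_def algebra_simps)
      thus ?thesis using z(2)[of 1] by (simp add: m_def)
    qed
    show "m (s, 0) = 0" for s by (simp add: m_def)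
    show "m (s, t) \<noteq> 0" if "t \<in> {0<..1}" for s t using that by (simp add: m_def)
  qed (rule bound)
qed

section \<open>The bijection between homotopy classes and points of the disk\<close>

context inverse_nome
begin

definition lift_end :: "(real \<Rightarrow> complex) \<Rightarrow> complex" where
  "lift_end \<gamma> = (SOME \<eta>. is_lift \<gamma> \<eta>) 1"

lemma is_lift_exists:
  assumes "\<gamma> \<in> origin_curves" shows "\<exists>\<eta>. is_lift \<gamma> \<eta>"
proof (cases "pathfinish \<gamma> = 0")
  case True
  have "is_lift \<gamma> (\<lambda>t. 0)"
    using origin_curvesD(4)[OF assms True] by (simp add: is_lift_def path_def phi_0)
  thus ?thesis by blast
next
  case False
  note \<gamma> = origin_curvesD(1,2)[OF assms] origin_curvesD(5)[OF assms False]
  have "continuous_on ({0..1::real} \<times> {0..1}) (\<lambda>x. \<gamma> (snd x))"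
    by (rule continuous_on_compose2[OF \<gamma>(1)[unfolded path_def]]) (auto intro!: continuous_intros)
  then obtain k :: "real \<times> real \<Rightarrow> complex" where "\<And>s. s \<in> {0..1} \<Longrightarrow> is_lift (\<lambda>t. \<gamma> (snd (s, t))) (\<lambda>t. k (s, t))"
    by (rule lift_family) (use \<gamma> in auto)
  from this[of 0] show ?thesis by auto
qed

lemma lift_end_eq:
  assumes \<gamma>: "\<gamma> \<in> origin_curves" and \<eta>: "is_lift \<gamma> \<eta>"
  shows "lift_end \<gamma> = \<eta> 1"
proof -
  define \<eta>' where "\<eta>' = (SOME \<eta>. is_lift \<gamma> \<eta>)"
  have \<eta>': "is_lift \<gamma> \<eta>'" unfolding \<eta>'_def by (rule someI[of "is_lift \<gamma>", OF \<eta>])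
  have "\<eta>' 1 = \<eta> 1"
  proof (cases "pathfinish \<gamma> = 0")
    case True
    hence "\<gamma> 1 = 0" by (simp add: pathfinish_def)
    hence "\<zeta> 1 = 0" if "is_lift \<gamma> \<zeta>" for \<zeta>
      using that phi_eq_0_iff[of "\<zeta> 1"] by (simp add: is_lift_def)
    from this[OF \<eta>] this[OF \<eta>'] show ?thesis by simp
  next
    case False
    show ?thesis by (rule is_lift_unique[OF origin_curvesD(5)[OF \<gamma> False] \<eta>' \<eta>]) auto
  qed
  thus ?thesis by (simp add: lift_end_def \<eta>'_def)
qed

lemma lift_end_in_disk:
  assumes "\<gamma> \<in> origin_curves" shows "norm (lift_end \<gamma>) < 1" "\<phi> (lift_end \<gamma>) = pathfinish \<gamma>"
proof -
  obtain \<eta> where "is_lift \<gamma> \<eta>" using is_lift_exists[OF assms] by blast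
  with lift_end_eq[OF assms this] show "norm (lift_end \<gamma>) < 1" "\<phi> (lift_end \<gamma>) = pathfinish \<gamma>"
    by (auto simp: is_lift_def pathfinish_def)
qed

lemma lift_end_eq_0_iff: "\<gamma> \<in> origin_curves \<Longrightarrow> lift_end \<gamma> = 0 \<longleftrightarrow> pathfinish \<gamma> = 0"
  using lift_end_in_disk phi_eq_0_iff by metis

lemma is_lift_nonzero:
  assumes "\<gamma> \<in> origin_curves" "pathfinish \<gamma> \<noteq> 0" "is_lift \<gamma> \<eta>" "t \<in> {0<..1}"
  shows "\<eta> t \<noteq> 0"
proof
  assume 0: "\<eta> t = 0"
  have "\<phi> (\<eta> t) = \<gamma> t" using assms(3,4) by (simp add: is_lift_def)
  thus False using origin_curvesD(5)[OF assms(1,2,4)] phi_0 0 by simp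
qed

lemma image_origin_curve:
  assumes "path \<eta>" "\<eta> 0 = 0" "\<And>t. t \<in> {0..1} \<Longrightarrow> norm (\<eta> t) < 1" "\<And>t. t \<in> {0<..1} \<Longrightarrow> \<eta> t \<noteq> 0"
  shows "(\<lambda>t. \<phi> (\<eta> t)) \<in> origin_curves" "lift_end (\<lambda>t. \<phi> (\<eta> t)) = \<eta> 1"
proof -
  have "path (\<lambda>t. \<phi> (\<eta> t))"
    unfolding path_def
    by (rule continuous_on_compose2[OF holomorphic_on_imp_continuous_on[OF phi_hol] assms(1)[unfolded path_def]])
       (use assms(3) in auto)
  moreover have "\<phi> (\<eta> t) \<notin> {0, 1}" if "t \<in> {0<..1}" for t
    by (rule phi_avoids) (use assms(3)[of t] assms(4)[OF that] that in auto)
  ultimately show 1: "(\<lambda>t. \<phi> (\<eta> t)) \<in> origin_curves"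
    by (intro origin_curvesI) (auto simp: assms(2) phi_0)
  show "lift_end (\<lambda>t. \<phi> (\<eta> t)) = \<eta> 1"
    by (rule lift_end_eq[OF 1]) (use assms in \<open>simp add: is_lift_def\<close>)
qed

text \<open>During the homotopy the endpoint of the lift moves continuously in the fibre over a
  fixed point; being a lift of a constant path, it does not move. Curves ending at 0 lie outside the
  covering, but their lifts end at 0.\<close>

lemma curve_rel_imp_lift_end_eq:
  assumes "(\<gamma>, \<delta>) \<in> curve_rel" shows "lift_end \<gamma> = lift_end \<delta>"
proof -
  have \<gamma>: "\<gamma> \<in> origin_curves" "\<delta> \<in> origin_curves"
    using assms equiv_curve_rel by (auto simp: equiv_def)
  obtain h :: "real \<times> real \<Rightarrow> complex" where h: "continuous_on ({0..1} \<times> {0..1}) h" "\<And>t. t \<in> {0..1} \<Longrightarrow> h (0, t) = \<gamma> t"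
    "\<And>t. t \<in> {0..1} \<Longrightarrow> h (1, t) = \<delta> t" "\<And>s. s \<in> {0..1} \<Longrightarrow> (\<lambda>t. h (s, t)) \<in> origin_curves"
    "\<And>s. s \<in> {0..1} \<Longrightarrow> pathfinish (\<lambda>t. h (s, t)) = pathfinish \<gamma>"
    using assms unfolding curve_rel_iff by blast
  show ?thesis
  proof (cases "pathfinish \<gamma> = 0")
    case True
    have "pathfinish \<delta> = 0" using h(3)[of 1] h(5)[of 1] True by (simp add: pathfinish_def)
    thus ?thesis using lift_end_eq_0_iff \<gamma> True by metis
  next
    case False
    have h01: "h (s, t) \<notin> {0, 1}" if "s \<in> {0..1}" "t \<in> {0<..1}" for s t
      by (rule origin_curvesD(5)[OF h(4)[OF that(1)]]) (use h(5)[OF that(1)] False that(2) in auto)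
    have h0: "h (s, 0) = 0" if "s \<in> {0..1}" for s
      using origin_curvesD(2)[OF h(4)[OF that]] .
    obtain k :: "real \<times> real \<Rightarrow> complex" where k: "continuous_on ({0..1} \<times> {0..1}) k"
      "\<And>s. s \<in> {0..1} \<Longrightarrow> is_lift (\<lambda>t. h (s, t)) (\<lambda>t. k (s, t))"
      by (rule lift_family[OF h(1) h0 h01]) (assumption | rule that)+
    have kphi: "\<phi> (k (s, 1)) = pathfinish \<gamma>" "norm (k (s, 1)) < 1" if "s \<in> {0..1}" for s
      using k(2)[OF that] h(5)[OF that] by (simp_all add: is_lift_def pathfinish_def)
    have c: "continuous_on {0..1} (\<lambda>s. k (s, 1))"
      by (rule continuous_on_compose2[OF k(1)]) (auto intro!: continuous_intros)
    have kD: "k (s, 1) \<in> ball 0 1 - {0}" if "s \<in> {0..1}" for s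
      using kphi[OF that] False phi_0 by auto
    have "k (0, 1) = k (1, 1)"
      by (rule covering_space_lift_unique[OF phi_covering, of "\<lambda>s. k (s, 1)" 0 "\<lambda>s. k (0, 1)" "{0..1}" "\<lambda>s. pathfinish \<gamma>" 1, symmetric])
         (use kD kphi origin_curvesD(3)[OF \<gamma>(1)] False c in auto)
    moreover have "is_lift \<gamma> (\<lambda>t. k (0, t))" using k(2)[of 0] h(2) by (simp add: is_lift_def)
    moreover have "is_lift \<delta> (\<lambda>t. k (1, t))" using k(2)[of 1] h(3) by (simp add: is_lift_def)
    ultimately show ?thesis using lift_end_eq \<gamma> by metis
  qed
qed

text \<open>The lifts run from 0 to a common point of the disk and may wind around 0 differently. As
  both start at 0, \<open>punctured_disk_homotopy\<close> deforms one into the other while avoiding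
  0 at positive times, and \<open>\<phi>\<close> maps the deformation down.\<close>

lemma lift_end_eq_imp_curve_rel:
  assumes \<gamma>: "\<gamma> \<in> origin_curves" "\<delta> \<in> origin_curves" and eq: "lift_end \<gamma> = lift_end \<delta>"
  shows "(\<gamma>, \<delta>) \<in> curve_rel"
proof (cases "pathfinish \<gamma> = 0")
  case True
  hence "pathfinish \<delta> = 0" using lift_end_eq_0_iff \<gamma> eq by metis
  hence 0: "\<gamma> t = 0" "\<delta> t = 0" if "t \<in> {0..1}" for t using origin_curvesD(4) \<gamma> True that by blast+
  show ?thesis unfolding curve_rel_iff
    by (rule exI[of _ "\<lambda>_. 0"]) (use 0 True origin_curves_zero in \<open>auto simp: pathfinish_def\<close>)
next
  case False
  hence False': "pathfinish \<delta> \<noteq> 0" using lift_end_eq_0_iff \<gamma> eq by metis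
  obtain \<eta> \<eta>' where \<eta>: "is_lift \<gamma> \<eta>" "is_lift \<delta> \<eta>'" using is_lift_exists \<gamma> by blast
  have nz: "\<eta> t \<noteq> 0" "\<eta>' t \<noteq> 0" if "t \<in> {0<..1}" for t
    using is_lift_nonzero[OF \<gamma>(1) False \<eta>(1) that] is_lift_nonzero[OF \<gamma>(2) False' \<eta>(2) that] .
  have p: "path \<eta>" "\<eta> 0 = 0" "path \<eta>'" "\<eta>' 0 = 0" using \<eta> by (simp_all add: is_lift_def)
  have fin: "\<eta> 1 = \<eta>' 1" using lift_end_eq[OF \<gamma>(1) \<eta>(1)] lift_end_eq[OF \<gamma>(2) \<eta>(2)] eq by simp
  obtain m :: "real \<times> real \<Rightarrow> complex" where m: "continuous_on ({0..1} \<times> {0..1}) m" "\<And>t. t \<in> {0..1} \<Longrightarrow> m (0, t) = \<eta> t"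
    "\<And>t. t \<in> {0..1} \<Longrightarrow> m (1, t) = \<eta>' t" "\<And>s. s \<in> {0..1} \<Longrightarrow> m (s, 1) = \<eta> 1" "\<And>s. m (s, 0) = 0"
    "\<And>s t. t \<in> {0<..1} \<Longrightarrow> m (s, t) \<noteq> 0"
    "\<And>s t. s \<in> {0..1} \<Longrightarrow> t \<in> {0..1} \<Longrightarrow> norm (m (s, t)) \<le> max (norm (\<eta> t)) (norm (\<eta>' t))"
    by (rule punctured_disk_homotopy[OF p(1,2) nz(1) p(3,4) nz(2) fin]) (assumption | rule that)+
  have m1: "norm (m (s, t)) < 1" if "s \<in> {0..1}" "t \<in> {0..1}" for s t
  proof -
    have "norm (\<eta> t) < 1" "norm (\<eta>' t) < 1" using \<eta> that(2) by (simp_all add: is_lift_def)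
    thus ?thesis using m(7)[OF that] by linarith
  qed
  show ?thesis unfolding curve_rel_iff
  proof (rule exI[of _ "\<lambda>x. \<phi> (m x)"], intro conjI ballI)
    show "continuous_on ({0..1} \<times> {0..1}) (\<lambda>x. \<phi> (m x))"
      by (rule continuous_on_compose2[OF holomorphic_on_imp_continuous_on[OF phi_hol] m(1)]) (use m1 in auto)
    show "\<phi> (m (0, t)) = \<gamma> t" if "t \<in> {0..1}" for t using m(2)[OF that] \<eta>(1) that by (simp add: is_lift_def)
    show "\<phi> (m (1, t)) = \<delta> t" if "t \<in> {0..1}" for t using m(3)[OF that] \<eta>(2) that by (simp add: is_lift_def)
    fix s :: real assume s: "s \<in> {0..1}"
    have "path (\<lambda>t. m (s, t))" unfolding path_def
      by (rule continuous_on_compose2[OF m(1)]) (use s in \<open>auto intro!: continuous_intros\<close>)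
    thus "(\<lambda>t. \<phi> (m (s, t))) \<in> origin_curves"
      by (rule image_origin_curve(1)) (use m(5,6) m1[OF s] in auto)
    show "pathfinish (\<lambda>t. \<phi> (m (s, t))) = pathfinish \<gamma>"
      using m(4)[OF s] \<eta>(1) by (simp add: pathfinish_def is_lift_def)
  qed
qed

lemma curve_class_eq_lift_end:
  "\<gamma> \<in> origin_curves \<Longrightarrow> \<delta> \<in> origin_curves \<Longrightarrow> curve_class \<gamma> = curve_class \<delta> \<longleftrightarrow> lift_end \<gamma> = lift_end \<delta>"
  using curve_class_eq_iff curve_rel_imp_lift_end_eq lift_end_eq_imp_curve_rel by blast

definition nome :: "(real \<Rightarrow> complex) set \<Rightarrow> complex" where
  "nome P = lift_end (SOME \<gamma>. \<gamma> \<in> P)"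

text \<open>The inverse of \<open>nome\<close>: a point of the disk is reached along its radius, and
  the class is that of the image curve.\<close>

definition nome_point :: "complex \<Rightarrow> (real \<Rightarrow> complex) set" where
  "nome_point z = curve_class (\<lambda>t. \<phi> (linepath 0 z t))"

lemma nome_curve_class:
  assumes "\<gamma> \<in> origin_curves" shows "nome (curve_class \<gamma>) = lift_end \<gamma>"
proof -
  have "\<gamma> \<in> curve_class \<gamma>"
    unfolding curve_class_def using equiv_class_self[OF equiv_curve_rel assms] .
  hence "(SOME \<delta>. \<delta> \<in> curve_class \<gamma>) \<in> curve_class \<gamma>" by (rule someI[of "\<lambda>\<delta>. \<delta> \<in> curve_class \<gamma>"])
  hence "(\<gamma>, SOME \<delta>. \<delta> \<in> curve_class \<gamma>) \<in> curve_rel" by (simp add: curve_class_def)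
  thus ?thesis unfolding nome_def by (rule curve_rel_imp_lift_end_eq[symmetric])
qed

lemma ray_origin_curve:
  assumes "norm z < 1"
  shows "(\<lambda>t. \<phi> (linepath 0 z t)) \<in> origin_curves" "lift_end (\<lambda>t. \<phi> (linepath 0 z t)) = z"
proof -
  have "(\<lambda>t. \<phi> (linepath 0 z t)) \<in> origin_curves \<and> lift_end (\<lambda>t. \<phi> (linepath 0 z t)) = z"
  proof (cases "z = 0")
    case True
    have "is_lift (\<lambda>t. 0) (\<lambda>t. 0)" by (simp add: is_lift_def path_def phi_0)
    from lift_end_eq[OF origin_curves_zero this] show ?thesis
      using True origin_curves_zero by (simp add: linepath_def phi_0)
  next
    case False
    have 1: "norm (linepath 0 z t) < 1" if "t \<in> {0..1}" for t
      using that assms mult_left_le_one_le[of "norm z" t] by (auto simp: linepath_def)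
    have 2: "linepath 0 z t \<noteq> 0" if "t \<in> {0<..1}" for t using that False by (simp add: linepath_def)
    show ?thesis
      using image_origin_curve[of "linepath 0 z", OF path_linepath _ 1 2] by (simp add: linepath_def)
  qed
  thus "(\<lambda>t. \<phi> (linepath 0 z t)) \<in> origin_curves" "lift_end (\<lambda>t. \<phi> (linepath 0 z t)) = z" by auto
qed

lemma nome_point_in_Omega: "norm z < 1 \<Longrightarrow> nome_point z \<in> Omega"
  unfolding nome_point_def by (intro curve_class_in_Omega ray_origin_curve)

lemma nome_nome_point:
  assumes "norm z < 1" shows "nome (nome_point z) = z"
  unfolding nome_point_def nome_curve_class[OF ray_origin_curve(1)[OF assms]]
  by (rule ray_origin_curve(2)[OF assms])

lemma norm_nome: "P \<in> Omega \<Longrightarrow> norm (nome P) < 1"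
  by (elim Omega_cases) (simp add: nome_curve_class lift_end_in_disk)

lemma nome_inj: "inj_on nome Omega"
proof (rule inj_onI)
  fix P Q assume "P \<in> Omega" "Q \<in> Omega" and eq: "nome P = nome Q"
  obtain \<gamma> where \<gamma>: "\<gamma> \<in> origin_curves" "P = curve_class \<gamma>" using \<open>P \<in> Omega\<close> by (rule Omega_cases)
  obtain \<delta> where \<delta>: "\<delta> \<in> origin_curves" "Q = curve_class \<delta>" using \<open>Q \<in> Omega\<close> by (rule Omega_cases)
  show "P = Q" using eq \<gamma> \<delta> by (simp add: nome_curve_class curve_class_eq_lift_end)
qed

lemma nome_image: "nome ` Omega = ball 0 1"
proof
  show "nome ` Omega \<subseteq> ball 0 1" using norm_nome by auto
  show "ball 0 1 \<subseteq> nome ` Omega"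
  proof
    fix z :: complex assume "z \<in> ball 0 1"
    hence "norm z < 1" by simp
    from nome_nome_point[OF this, symmetric] nome_point_in_Omega[OF this] show "z \<in> nome ` Omega" by (rule image_eqI)
  qed
qed

lemma nome_point_nome: "P \<in> Omega \<Longrightarrow> nome_point (nome P) = P"
  using nome_inj nome_nome_point[OF norm_nome] nome_point_in_Omega[OF norm_nome] by (meson inj_onD)

lemma the_inv_nome: "norm z < 1 \<Longrightarrow> the_inv_into Omega nome z = nome_point z"
  by (rule the_inv_into_f_eq[OF nome_inj nome_nome_point nome_point_in_Omega])

lemma Omega_proj_nome_point:
  assumes "norm z < 1" shows "Omega_proj (nome_point z) = \<phi> z"
  unfolding nome_point_def Omega_proj_curve_class[OF ray_origin_curve(1)[OF assms]]
  by (simp add: pathfinish_def)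

end

section \<open>Charts, conformality and uniqueness\<close>

text \<open>By the second equation K^2 is even: its coefficient at 3 gives K_2 = 0, that at 4 gives
  F_2 = 8 K_3. At 2 and 3 the first equation then reads F_2 + 128 = 0 and F_3 + 8 F_2 + 256 = 4
  K_3.\<close>

lemma landen_fps_coeffs:
  fixes F K :: "complex fps"
  assumes F: "fps_nth F 0 = 0" "fps_nth F 1 = 16" and K: "fps_nth K 0 = 0" "fps_nth K 1 = 4"
    and e1: "F * (1 + K)\<^sup>2 = 4 * K" and e2: "fps_compose F (fps_X\<^sup>2) = K\<^sup>2"
  shows "fps_nth F 2 = - 128" "fps_nth F 3 = 704"
proof -
  have s: "{0..2} = {0, 1, 2::nat}" "{0..3} = {0, 1, 2, 3::nat}" "{0..4} = {0, 1, 2, 3, 4::nat}" by auto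
  have X: "fps_nth ((fps_X\<^sup>2) ^ i) n = (if n = 2 * i then 1 else 0 :: complex)" for i n
    by (simp flip: power_mult)
  have sq: "(\<Sum>i=0..n. fps_nth F i * (if n = 2 * i then 1 else 0)) = (\<Sum>i=0..n. fps_nth K i * fps_nth K (n - i))" for n
    using arg_cong[OF e2, of "\<lambda>f. fps_nth f n"]
    by (simp only: fps_compose_nth X power2_eq_square[of K] fps_mult_nth)
  have K2: "fps_nth K 2 = 0"
    using sq[of 3] F K by (simp add: s)
  have K3: "fps_nth F 2 = 8 * fps_nth K 3"
    using sq[of 4] F K K2 by (simp add: s)
  have e1': "F + 2 * (F * K) + F * (K * K) = 4 * K"
    using e1 by (simp add: power2_eq_square algebra_simps)
  have nth: "fps_nth F n + 2 * fps_nth (F * K) n + fps_nth (F * (K * K)) n = 4 * fps_nth K n" for n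
    using arg_cong[OF e1', of "\<lambda>f. fps_nth f n"] by (simp add: numeral_fps_const)
  have "- fps_nth F 2 = 128"
    using nth[of 2] F K K2 by (simp add: fps_mult_nth s add_eq_0_iff)
  thus F2: "fps_nth F 2 = - 128" by (metis minus_minus)
  show "fps_nth F 3 = 704"
    using nth[of 3] F K K2 K3 F2 by (simp add: fps_mult_nth s)
qed

section \<open>Charts of the surface and conformality of the nome\<close>

context inverse_nome
begin

text \<open>In the coordinate \<open>w\<close>, \<open>nome\<close> is locally a right inverse
  \<open>g\<close> of \<open>\<phi>\<close>, since the appended segment is lifted by following
  \<open>g\<close> along it. At the origin \<open>g\<close> is the local inverse at 0. Openness,
  continuity and holomorphy of \<open>nome\<close> all come from this.\<close>

lemma curve_chart:
  assumes \<gamma>: "\<gamma> \<in> origin_curves"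
  obtains r g where "r > 0" "g holomorphic_on ball (pathfinish \<gamma>) r" "g (pathfinish \<gamma>) = lift_end \<gamma>"
    "\<And>w. w \<in> ball (pathfinish \<gamma>) r \<Longrightarrow> norm (g w) < 1 \<and> \<phi> (g w) = w"
    "\<And>w. w \<in> ball (pathfinish \<gamma>) r \<Longrightarrow> curve_extend \<gamma> w \<in> origin_curves \<and> lift_end (curve_extend \<gamma> w) = g w"
proof (cases "pathfinish \<gamma> = 0")
  case True
  obtain g \<rho> \<epsilon> where e: "0 < \<rho>" "\<rho> \<le> 1" "0 < \<epsilon>" "\<epsilon> \<le> 1" and g: "g holomorphic_on ball 0 \<epsilon>"
    "\<And>w. norm w < \<rho> \<Longrightarrow> g (\<phi> w) = w" "\<And>z. norm z < \<epsilon> \<Longrightarrow> norm (g z) < \<rho> \<and> \<phi> (g z) = z"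
    by (rule phi_local_inverse) (rule that)
  have g0: "g 0 = 0" using g(2)[of 0] e(1) phi_0 by simp
  show thesis
  proof
    show "\<epsilon> > 0" by (rule e)
    show "g holomorphic_on ball (pathfinish \<gamma>) \<epsilon>" using g(1) True by simp
    show "g (pathfinish \<gamma>) = lift_end \<gamma>" using True lift_end_eq_0_iff[OF \<gamma>] g0 by simp
    fix w assume "w \<in> ball (pathfinish \<gamma>) \<epsilon>"
    hence w: "norm w < \<epsilon>" using True by simp
    show "norm (g w) < 1 \<and> \<phi> (g w) = w" using g(3)[OF w] e by simp
    have tw: "norm (linepath 0 w t) < \<epsilon>" if "t \<in> {0..1}" for t
      using that w mult_left_le_one_le[of "norm w" t] by (auto simp: linepath_def)
    have oc: "linepath 0 w \<in> origin_curves"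
    proof (cases "w = 0")
      case True
      have "linepath 0 (0::complex) = (\<lambda>t. 0)" by (simp add: linepath_def fun_eq_iff)
      thus ?thesis using True origin_curves_zero by simp
    next
      case False
      show ?thesis
      proof (rule origin_curvesI)
        fix t :: real assume t: "t \<in> {0<..1}"
        hence "norm (linepath 0 w t) < 1" using tw[of t] e by simp
        hence "linepath 0 w t \<noteq> 1" by (metis less_irrefl norm_one)
        moreover have "linepath 0 w t \<noteq> 0" using False t by (simp add: linepath_def)
        ultimately show "linepath 0 w t \<notin> {0, 1}" by simp
      next
        show "linepath 0 w 0 = 0" by (simp add: linepath_def)
      qed (rule path_linepath)
    qed
    have "is_lift (linepath 0 w) (\<lambda>t. g (linepath 0 w t))"
      unfolding is_lift_def
    proof (intro conjI ballI)
      show "path (\<lambda>t. g (linepath 0 w t))" unfolding path_def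
        by (rule continuous_on_compose2[OF holomorphic_on_imp_continuous_on[OF g(1)] continuous_on_linepath])
           (use tw in auto)
      show "g (linepath 0 w 0) = 0" by (simp add: linepath_def g0)
      fix t :: real assume "t \<in> {0..1}"
      from g(3)[OF tw[OF this]] e show "norm (g (linepath 0 w t)) < 1" "\<phi> (g (linepath 0 w t)) = linepath 0 w t" by auto
    qed
    from lift_end_eq[OF oc this] have "lift_end (linepath 0 w) = g w" by (simp add: linepath_def)
    thus "curve_extend \<gamma> w \<in> origin_curves \<and> lift_end (curve_extend \<gamma> w) = g w"
      using oc True by (simp add: curve_extend_def)
  qed
next
  case False
  define p where "p = pathfinish \<gamma>"
  have "p \<in> - {0, 1}" using False origin_curvesD(3)[OF \<gamma>] by (simp add: p_def)
  then obtain R where R: "R > 0" "ball p R \<subseteq> - {0, 1}" by (rule avoiding_ball)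
  have pin: "\<phi> (lift_end \<gamma>) \<in> ball p (R / 4)" using lift_end_in_disk(2)[OF \<gamma>] R(1) by (simp add: p_def)
  obtain g where g: "is_branch (ball p (R / 4)) g" "g (\<phi> (lift_end \<gamma>)) = lift_end \<gamma>"
    by (rule branch_exists[OF R lift_end_in_disk(1)[OF \<gamma>] pin]) (rule that)
  have gp: "g p = lift_end \<gamma>" using g(2) lift_end_in_disk(2)[OF \<gamma>] by (simp add: p_def)
  obtain \<eta> where \<eta>: "is_lift \<gamma> \<eta>" using is_lift_exists[OF \<gamma>] by blast
  have e1: "\<eta> 1 = lift_end \<gamma>" using lift_end_eq[OF \<gamma> \<eta>] by simp
  have sub: "ball p (R / 4) \<subseteq> ball p R" using R(1) by auto
  show thesis
  proof
    show "R / 4 > 0" using R by simp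
    show "g holomorphic_on ball (pathfinish \<gamma>) (R / 4)" using is_branchD(1)[OF g(1)] by (simp add: p_def)
    show "g (pathfinish \<gamma>) = lift_end \<gamma>" using gp by (simp add: p_def)
    fix w assume "w \<in> ball (pathfinish \<gamma>) (R / 4)"
    hence w: "w \<in> ball p (R / 4)" by (simp add: p_def)
    show "norm (g w) < 1 \<and> \<phi> (g w) = w" using is_branchD(2,4)[OF g(1) w] by simp
    have ext: "curve_extend \<gamma> w = \<gamma> +++ linepath p w" using False by (simp add: curve_extend_def p_def)
    have seg: "linepath p w t \<in> ball p (R / 4)" if "t \<in> {0..1}" for t
    proof -
      have "closed_segment p w \<subseteq> ball p (R / 4)" using w R(1) by (intro closed_segment_subset) auto
      thus ?thesis using linepath_in_path[OF that, of p w] by blast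
    qed
    have oc: "\<gamma> +++ linepath p w \<in> origin_curves"
    proof (rule origin_curvesI)
      show "path (\<gamma> +++ linepath p w)" using origin_curvesD(1)[OF \<gamma>] by (simp add: p_def)
      show "(\<gamma> +++ linepath p w) 0 = 0" using origin_curvesD(2)[OF \<gamma>] by (simp add: joinpaths_def)
      fix t :: real assume t: "t \<in> {0<..1}"
      show "(\<gamma> +++ linepath p w) t \<notin> {0, 1}"
      proof (cases "t \<le> 1/2")
        case True
        thus ?thesis using origin_curvesD(5)[OF \<gamma> False, of "2 * t"] t by (simp add: joinpaths_def)
      next
        case gt: False
        hence "linepath p w (2 * t - 1) \<in> - {0, 1}"
          using subsetD[OF R(2) subsetD[OF sub seg[of "2 * t - 1"]]] t by simp
        thus ?thesis using gt by (simp add: joinpaths_def)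
      qed
    qed
    define \<theta> where "\<theta> = (\<lambda>t. g (linepath p w t))"
    have "path \<theta>" unfolding path_def \<theta>_def
      by (rule continuous_on_compose2[OF is_branchD(6)[OF g(1)] continuous_on_linepath]) (use seg in blast)
    moreover have "pathfinish \<eta> = pathstart \<theta>"
      by (simp add: pathfinish_def pathstart_def \<theta>_def linepath_def gp e1)
    ultimately have "path (\<eta> +++ \<theta>)" using \<eta> by (simp add: is_lift_def)
    moreover have "norm ((\<eta> +++ \<theta>) t) < 1 \<and> \<phi> ((\<eta> +++ \<theta>) t) = (\<gamma> +++ linepath p w) t" if t: "t \<in> {0..1}" for t
    proof (cases "t \<le> 1/2")
      case True
      thus ?thesis using \<eta> t by (simp add: is_lift_def joinpaths_def)
    next
      case gt: False
      thus ?thesis using is_branchD(2,4)[OF g(1) seg[of "2 * t - 1"]] t by (simp add: joinpaths_def \<theta>_def)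
    qed
    ultimately have "is_lift (\<gamma> +++ linepath p w) (\<eta> +++ \<theta>)"
      using \<eta> by (simp add: is_lift_def joinpaths_def)
    from lift_end_eq[OF oc this] have "lift_end (\<gamma> +++ linepath p w) = g w"
      by (simp add: joinpaths_def \<theta>_def linepath_def)
    thus "curve_extend \<gamma> w \<in> origin_curves \<and> lift_end (curve_extend \<gamma> w) = g w" using oc ext by simp
  qed
qed

lemma right_inverse_open_image:
  assumes "g holomorphic_on T" "\<And>w. w \<in> T \<Longrightarrow> \<phi> (g w) = w" "open U" "U \<subseteq> T"
  shows "open (g ` U)"
proof (rule open_mapping_thm3)
  show "g holomorphic_on U" using assms(1,4) by (rule holomorphic_on_subset)
  show "inj_on g U" using assms(2,4) by (metis inj_onI subsetD)
qed (rule assms)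

text \<open>In one direction \<open>g\<close> from the chart is an open map; in the other
  \<open>g\<close> is continuous and \<open>nome\<close> injective. Hence the topology defined by
  extending curves is the one pulled back from the disk.\<close>

lemma Omega_open_iff:
  assumes W: "W \<subseteq> Omega" shows "Omega_open W \<longleftrightarrow> open (nome ` W)"
proof
  assume op: "Omega_open W"
  show "open (nome ` W)"
  proof (subst open_subopen, rule ballI)
    fix z assume "z \<in> nome ` W"
    then obtain P where P: "P \<in> W" "z = nome P" by blast
    then obtain \<gamma> where \<gamma>: "\<gamma> \<in> origin_curves" "P = curve_class \<gamma>" using W Omega_cases by blast
    define p where "p = pathfinish \<gamma>"
    obtain s where s: "s > 0" "\<And>w. w \<in> ball p s \<Longrightarrow> curve_class (curve_extend \<gamma> w) \<in> W"
      using op \<gamma> P(1) unfolding Omega_open_def p_def by blast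
    obtain r g where r: "r > 0" and g: "g holomorphic_on ball p r" "g p = lift_end \<gamma>"
      "\<And>w. w \<in> ball p r \<Longrightarrow> norm (g w) < 1 \<and> \<phi> (g w) = w"
      "\<And>w. w \<in> ball p r \<Longrightarrow> curve_extend \<gamma> w \<in> origin_curves \<and> lift_end (curve_extend \<gamma> w) = g w"
      by (rule curve_chart[OF \<gamma>(1), folded p_def]) (rule that)
    define T where "T = g ` ball p (min r s)"
    have "open T" unfolding T_def
      by (rule right_inverse_open_image[OF g(1)]) (use g(3) in auto)
    moreover have "z \<in> T"
      unfolding T_def by (rule image_eqI[of _ _ p]) (use r s P \<gamma> g(2) in \<open>simp_all add: nome_curve_class\<close>)
    moreover have "T \<subseteq> nome ` W"
    proof
      fix y assume "y \<in> T"
      then obtain w where w: "y = g w" "w \<in> ball p (min r s)" unfolding T_def by blast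
      hence "nome (curve_class (curve_extend \<gamma> w)) = y" using g(4)[of w] by (simp add: nome_curve_class)
      moreover have "curve_class (curve_extend \<gamma> w) \<in> W" using s(2) w by simp
      ultimately show "y \<in> nome ` W" by blast
    qed
    ultimately show "\<exists>T. open T \<and> z \<in> T \<and> T \<subseteq> nome ` W" by blast
  qed
next
  assume op: "open (nome ` W)"
  show "Omega_open W"
    unfolding Omega_open_def
  proof (intro conjI ballI impI W)
    fix \<gamma> assume \<gamma>: "\<gamma> \<in> origin_curves" "curve_class \<gamma> \<in> W"
    define p where "p = pathfinish \<gamma>"
    obtain r g where r: "r > 0" and g: "g holomorphic_on ball p r" "g p = lift_end \<gamma>"
      "\<And>w. w \<in> ball p r \<Longrightarrow> norm (g w) < 1 \<and> \<phi> (g w) = w"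
      "\<And>w. w \<in> ball p r \<Longrightarrow> curve_extend \<gamma> w \<in> origin_curves \<and> lift_end (curve_extend \<gamma> w) = g w"
      by (rule curve_chart[OF \<gamma>(1), folded p_def]) (rule that)
    have "lift_end \<gamma> \<in> nome ` W" using \<gamma> nome_curve_class by (metis image_eqI)
    then obtain e where e: "e > 0" "ball (lift_end \<gamma>) e \<subseteq> nome ` W" using op open_contains_ball by blast
    have "isCont g p"
      using holomorphic_on_imp_continuous_on[OF g(1)] r by (simp add: continuous_on_eq_continuous_at)
    then obtain d where d: "d > 0" "\<And>w. dist w p < d \<Longrightarrow> dist (g w) (g p) < e"
      using e(1) unfolding continuous_at_eps_delta by blast
    have "curve_class (curve_extend \<gamma> w) \<in> W" if w: "w \<in> ball p (min r d)" for w
    proof -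
      note gw = g(4)[of w]
      have "dist (g w) (g p) < e" using d(2)[of w] w by (simp add: dist_commute)
      hence "g w \<in> ball (lift_end \<gamma>) e" using g(2) by (simp add: dist_commute)
      then obtain Q where Q: "Q \<in> W" "g w = nome Q" using e(2) by blast
      have "nome (curve_class (curve_extend \<gamma> w)) = nome Q" using gw w Q by (simp add: nome_curve_class)
      moreover have "curve_class (curve_extend \<gamma> w) \<in> Omega" using gw w by (intro curve_class_in_Omega) simp
      ultimately have "curve_class (curve_extend \<gamma> w) = Q" using nome_inj W Q(1) by (meson inj_onD subsetD)
      thus ?thesis using Q(1) by simp
    qed
    thus "\<exists>r>0. \<forall>w\<in>ball (pathfinish \<gamma>) r. curve_class (curve_extend \<gamma> w) \<in> W"
      using r d(1) by (intro exI[of _ "min r d"]) (simp add: p_def)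
  qed
qed

lemma homeomorphic_map_nome: "homeomorphic_map Omega_topology (top_of_set (ball 0 1)) nome"
proof (rule bijective_open_imp_homeomorphic_map)
  show "nome ` topspace Omega_topology = topspace (top_of_set (ball 0 1))"
    by (simp add: topspace_Omega_topology nome_image)
  show "inj_on nome (topspace Omega_topology)" by (simp add: topspace_Omega_topology nome_inj)
  show "open_map Omega_topology (top_of_set (ball 0 1)) nome"
    unfolding open_map_def openin_Omega_topology
  proof (intro allI impI)
    fix W assume W: "Omega_open W"
    hence sub: "W \<subseteq> Omega" by (simp add: Omega_open_def)
    have "open (nome ` W)" using W Omega_open_iff[OF sub] by simp
    moreover have "nome ` W \<subseteq> ball 0 1" using image_mono[OF sub, of nome] nome_image by simp
    ultimately show "openin (top_of_set (ball 0 1)) (nome ` W)" by (rule open_subset[rotated])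
  qed
  show "continuous_map Omega_topology (top_of_set (ball 0 1)) nome"
    unfolding continuous_map topspace_Omega_topology
  proof (intro conjI allI impI)
    show "nome ` Omega \<subseteq> topspace (top_of_set (ball 0 1))" by (simp add: nome_image)
    fix U assume "openin (top_of_set (ball (0::complex) 1)) U"
    hence U: "open U" "U \<subseteq> ball 0 1" by (auto simp: openin_open_eq)
    have "nome ` {P \<in> Omega. nome P \<in> U} = nome ` Omega \<inter> U" by auto
    hence "nome ` {P \<in> Omega. nome P \<in> U} = U" using U(2) nome_image by auto
    thus "openin Omega_topology {P \<in> Omega. nome P \<in> U}"
      unfolding openin_Omega_topology using U(1) by (subst Omega_open_iff) auto
  qed
qed

lemma Omega_holomorphic_nome: "Omega_holomorphic nome"
  unfolding Omega_holomorphic_def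
proof
  fix \<gamma> assume \<gamma>: "\<gamma> \<in> origin_curves"
  define p where "p = pathfinish \<gamma>"
  obtain r g where r: "r > 0" and g: "g holomorphic_on ball p r" "g p = lift_end \<gamma>"
      "\<And>w. w \<in> ball p r \<Longrightarrow> norm (g w) < 1 \<and> \<phi> (g w) = w"
      "\<And>w. w \<in> ball p r \<Longrightarrow> curve_extend \<gamma> w \<in> origin_curves \<and> lift_end (curve_extend \<gamma> w) = g w"
    by (rule curve_chart[OF \<gamma>, folded p_def]) (rule that)
  have "(\<lambda>w. nome (curve_class (curve_extend \<gamma> w))) holomorphic_on ball p r"
    using g(1) by (subst holomorphic_cong[OF refl, of _ _ g]) (use g(4) nome_curve_class in auto)
  thus "(\<lambda>w. nome (curve_class (curve_extend \<gamma> w))) analytic_on {pathfinish \<gamma>}"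
    unfolding analytic_at p_def[symmetric] using r by (intro exI[of _ "ball p r"]) simp
qed

text \<open>In the coordinate \<open>z\<close> the projection is \<open>\<phi>\<close>, so near
  \<open>lift_end \<gamma>\<close> the point with nome \<open>z\<close> is reached by extending
  \<open>\<gamma>\<close> to \<open>\<phi> z\<close>. This translates charts of the surface into the
  coordinate of the disk.\<close>

lemma nome_point_eq_curve_extend:
  assumes "\<gamma> \<in> origin_curves"
  shows "eventually (\<lambda>z. nome_point z = curve_class (curve_extend \<gamma> (\<phi> z))) (nhds (lift_end \<gamma>))"
proof -
  define p where "p = pathfinish \<gamma>"
  obtain r g where r: "r > 0" and g: "g holomorphic_on ball p r" "g p = lift_end \<gamma>"
      "\<And>w. w \<in> ball p r \<Longrightarrow> norm (g w) < 1 \<and> \<phi> (g w) = w"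
      "\<And>w. w \<in> ball p r \<Longrightarrow> curve_extend \<gamma> w \<in> origin_curves \<and> lift_end (curve_extend \<gamma> w) = g w"
    by (rule curve_chart[OF assms, folded p_def]) (rule that)
  have "open (g ` ball p r)" by (rule right_inverse_open_image[OF g(1)]) (use g(3) in auto)
  moreover have "lift_end \<gamma> \<in> g ` ball p r" by (rule image_eqI[of _ _ p]) (use r g(2) in auto)
  ultimately have "eventually (\<lambda>z. z \<in> g ` ball p r) (nhds (lift_end \<gamma>))" by (rule eventually_nhds_in_open)
  thus ?thesis
  proof eventually_elim
    case (elim z)
    then obtain w where w: "w \<in> ball p r" "z = g w" by blast
    have "curve_class (curve_extend \<gamma> w) \<in> Omega" "nome (curve_class (curve_extend \<gamma> w)) = z"
      using g(4)[OF w(1)] w(2) by (auto simp: nome_curve_class intro: curve_class_in_Omega)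
    hence "nome_point z = curve_class (curve_extend \<gamma> w)" using nome_point_nome by metis
    thus ?case using g(3)[OF w(1)] w(2) by simp
  qed
qed

text \<open>Locally the function is its chart expression composed with \<open>\<phi>\<close>. This
  opens the surface to the identity theorem and Schwarz's lemma.\<close>

lemma Omega_holomorphic_imp_holomorphic:
  assumes "Omega_holomorphic f"
  shows "(\<lambda>z. f (nome_point z)) holomorphic_on ball 0 1"
proof -
  have "(\<lambda>z. f (nome_point z)) analytic_on {z}" if z: "norm z < 1" for z
  proof -
    define \<gamma> where "\<gamma> = (\<lambda>t. \<phi> (linepath 0 z t))"
    have \<gamma>: "\<gamma> \<in> origin_curves" "lift_end \<gamma> = z" using ray_origin_curve[OF z] by (simp_all only: \<gamma>_def)
    have p: "pathfinish \<gamma> = \<phi> z" using lift_end_in_disk(2)[OF \<gamma>(1)] \<gamma>(2) by simp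
    define h where "h = (\<lambda>w. f (curve_class (curve_extend \<gamma> w)))"
    have "h analytic_on {\<phi> z}" using assms \<gamma>(1) unfolding Omega_holomorphic_def h_def p[symmetric] by blast
    moreover have "\<phi> analytic_on {z}"
      unfolding analytic_at using phi_hol z by (intro exI[of _ "ball 0 1"]) simp
    ultimately have "(h \<circ> \<phi>) analytic_on {z}" by (intro analytic_on_compose) auto
    moreover have "eventually (\<lambda>u. f (nome_point u) = (h \<circ> \<phi>) u) (nhds z)"
      using nome_point_eq_curve_extend[OF \<gamma>(1)] unfolding \<gamma>(2) by eventually_elim (simp add: h_def)
    ultimately show ?thesis by (subst analytic_at_cong[OF _ refl])
  qed
  hence "(\<lambda>z. f (nome_point z)) analytic_on ball 0 1"
    by (subst analytic_on_analytic_at) simp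
  thus ?thesis by (rule analytic_imp_holomorphic)
qed

lemma conformal_nome: "conformal_onto_disk nome"
  unfolding conformal_onto_disk_def
proof (intro conjI homeomorphic_map_nome Omega_holomorphic_nome)
  show "(\<lambda>z. Omega_proj (the_inv_into Omega nome z)) holomorphic_on ball 0 1"
    using phi_hol by (subst holomorphic_cong[OF refl, of _ _ \<phi>]) (auto simp: the_inv_nome Omega_proj_nome_point)
qed

section \<open>Normalization and uniqueness\<close>

lemma nome_origin: "nome Omega_origin = 0"
proof -
  have "lift_end (\<lambda>t. 0) = 0"
    using lift_end_eq_0_iff[OF origin_curves_zero] by (simp add: pathfinish_def)
  thus ?thesis by (simp add: Omega_origin_def nome_curve_class origin_curves_zero)
qed

lemma nome_point_0: "nome_point 0 = Omega_origin"
proof -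
  have "Omega_origin \<in> Omega" unfolding Omega_origin_def by (rule curve_class_in_Omega[OF origin_curves_zero])
  thus ?thesis using nome_point_nome[of Omega_origin] nome_origin by simp
qed

lemma nome_point_near_0: "eventually (\<lambda>z. nome_point z = curve_class (linepath 0 (\<phi> z))) (nhds 0)"
proof -
  have "lift_end (\<lambda>t. 0) = 0"
    using lift_end_eq_0_iff[OF origin_curves_zero] by (simp add: pathfinish_def)
  thus ?thesis using nome_point_eq_curve_extend[OF origin_curves_zero] by (simp add: curve_extend_def pathfinish_def)
qed

lemma normalized_nome: "normalized_at_origin nome"
  unfolding normalized_at_origin_def
proof (intro conjI nome_origin exI[of _ "1/16"])
  define \<gamma> where "\<gamma> = (\<lambda>t::real. 0::complex)"
  have \<gamma>: "\<gamma> \<in> origin_curves" unfolding \<gamma>_def by (rule origin_curves_zero)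
  have p: "pathfinish \<gamma> = 0" by (simp add: \<gamma>_def pathfinish_def)
  obtain r g where r: "r > 0" and g: "g holomorphic_on ball (pathfinish \<gamma>) r" "g (pathfinish \<gamma>) = lift_end \<gamma>"
      "\<And>w. w \<in> ball (pathfinish \<gamma>) r \<Longrightarrow> norm (g w) < 1 \<and> \<phi> (g w) = w"
      "\<And>w. w \<in> ball (pathfinish \<gamma>) r \<Longrightarrow> curve_extend \<gamma> w \<in> origin_curves \<and> lift_end (curve_extend \<gamma> w) = g w"
    by (rule curve_chart[OF \<gamma>]) (rule that)
  have g0: "g 0 = 0" using g(2) lift_end_eq_0_iff[OF \<gamma>] p by simp
  have gd: "(g has_field_derivative deriv g 0) (at 0)"
    using holomorphic_derivI[OF g(1) open_ball, of 0 UNIV] r p by simp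
  have "((\<lambda>w. \<phi> (g w)) has_field_derivative 16 * deriv g 0) (at 0)"
    by (rule DERIV_chain2[where f = \<phi>]) (simp_all add: g0 phi_deriv gd)
  hence "((\<lambda>w. w) has_field_derivative 16 * deriv g 0) (at 0)"
    by (rule has_field_derivative_transform_within_open[of _ _ _ "ball 0 r"]) (use r g(3) p in auto)
  hence "16 * deriv g 0 = 1" using DERIV_unique DERIV_ident by blast
  hence d: "deriv g 0 = of_real (1 / 16)" by (simp add: field_simps)
  have "(g has_field_derivative of_real (1/16)) (at 0)" using gd unfolding d .
  moreover have "g w = nome (curve_class (linepath 0 w))" if "w \<in> ball 0 r" for w
    using g(4)[of w] that p by (simp add: curve_extend_def nome_curve_class)
  ultimately show "((\<lambda>w. nome (curve_class (linepath 0 w))) has_field_derivative of_real (1/16)) (at 0)"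
    using has_field_derivative_transform_within_open[of g _ 0 "ball 0 r"] r by auto
qed simp

text \<open>\<open>h\<close> is \<psi> after the inverse of \<open>nome\<close>, an automorphism of
  the disk fixing 0. Schwarz's lemma for \<open>h\<close> and its inverse makes it a rotation, and a
  rotation with positive derivative is the identity.\<close>

lemma conformal_unique:
  assumes \<psi>: "conformal_onto_disk \<psi>" "normalized_at_origin \<psi>" and P: "P \<in> Omega"
  shows "\<psi> P = nome P"
proof -
  define h where "h = (\<lambda>z. \<psi> (nome_point z))"
  have homeo: "homeomorphic_map Omega_topology (top_of_set (ball 0 1)) \<psi>" and "Omega_holomorphic \<psi>"
    using \<psi>(1) by (simp_all add: conformal_onto_disk_def)
  have hh: "h holomorphic_on ball 0 1" unfolding h_def by (rule Omega_holomorphic_imp_holomorphic) fact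
  have inj: "inj_on \<psi> Omega" and im: "\<psi> ` Omega = ball 0 1"
    using homeomorphic_imp_injective_map[OF homeo] homeomorphic_imp_surjective_map[OF homeo]
    by (simp_all add: topspace_Omega_topology)
  have npim: "nome_point ` ball 0 1 = Omega"
  proof
    show "nome_point ` ball 0 1 \<subseteq> Omega" using nome_point_in_Omega by auto
    show "Omega \<subseteq> nome_point ` ball 0 1"
    proof
      fix Q assume "Q \<in> Omega"
      thus "Q \<in> nome_point ` ball 0 1"
        by (intro image_eqI[of _ _ "nome Q"]) (simp_all add: nome_point_nome norm_nome)
    qed
  qed
  have "h ` ball 0 1 = \<psi> ` nome_point ` ball 0 1" by (simp add: h_def image_image)
  hence him: "h ` ball 0 1 = ball 0 1" by (simp only: npim im)
  have hinj: "inj_on h (ball 0 1)"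
  proof (rule inj_onI)
    fix x y :: complex assume xy: "x \<in> ball 0 1" "y \<in> ball 0 1" "h x = h y"
    hence "nome_point x = nome_point y"
      using inj_onD[OF inj, of "nome_point x" "nome_point y"] nome_point_in_Omega by (simp add: h_def)
    hence "nome (nome_point x) = nome (nome_point y)" by (rule arg_cong)
    thus "x = y" using xy(1,2) by (simp add: nome_nome_point)
  qed
  have h0: "h 0 = 0" using \<psi>(2) by (simp add: h_def nome_point_0 normalized_at_origin_def)
  obtain k where k: "k holomorphic_on h ` ball 0 1" "\<And>z. z \<in> ball 0 1 \<Longrightarrow> k (h z) = z"
    by (rule holomorphic_has_inverse[OF hh open_ball hinj]) (rule that)
  have k0: "k 0 = 0" using k(2)[of 0] h0 by simp
  have h1: "norm (h z) < 1" if "norm z < 1" for z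
    using imageI[of z "ball 0 1" h] that unfolding him by simp
  have k1: "norm (k w) < 1" if "norm w < 1" for w
  proof -
    have "w \<in> h ` ball 0 1" using him that by simp
    then obtain z where "z \<in> ball 0 1" "w = h z" by blast
    thus ?thesis using k(2) by simp
  qed
  have eq: "norm (h z) = norm z" if z: "norm z < 1" for z
  proof (rule antisym)
    show "norm (h z) \<le> norm z" by (rule Schwarz_Lemma(1)[OF hh h0 h1 z])
    have "norm (k (h z)) \<le> norm (h z)"
      by (rule Schwarz_Lemma(1)[OF k(1)[unfolded him] k0 k1 h1[OF z]])
    thus "norm z \<le> norm (h z)" using k(2) z by simp
  qed
  \<comment> \<open>Equality of moduli at one nonzero point, here 1/2, is the rigid case of
    Schwarz's lemma.\<close>
  have "norm (1/2 :: complex) < 1 \<and> (1/2 :: complex) \<noteq> 0 \<and> norm (h (1/2)) = norm (1/2 :: complex)"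
    using eq[of "1/2"] by (simp add: norm_divide)
  hence "(\<exists>z. norm z < 1 \<and> z \<noteq> 0 \<and> norm (h z) = norm z) \<or> norm (deriv h 0) = 1" by blast
  from Schwarz_Lemma(3)[OF hh h0 h1 _ this, where \<xi> = 0]
  have "\<exists>\<alpha>. (\<forall>z. norm z < 1 \<longrightarrow> h z = \<alpha> * z) \<and> norm \<alpha> = 1" by simp
  then obtain \<alpha> where \<alpha>: "\<And>z. norm z < 1 \<Longrightarrow> h z = \<alpha> * z" "norm \<alpha> = 1" by blast
  obtain c :: real where c: "c > 0" "((\<lambda>w. \<psi> (curve_class (linepath 0 w))) has_field_derivative of_real c) (at 0)"
    using \<psi>(2) by (auto simp: normalized_at_origin_def)
  have "((\<lambda>z. \<psi> (curve_class (linepath 0 (\<phi> z)))) has_field_derivative of_real c * 16) (at 0)"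
    by (rule DERIV_chain2[where f = "\<lambda>w. \<psi> (curve_class (linepath 0 w))"]) (simp_all add: phi_0 phi_deriv c)
  moreover have "eventually (\<lambda>z. \<psi> (curve_class (linepath 0 (\<phi> z))) = \<alpha> * z) (nhds 0)"
  proof -
    have "eventually (\<lambda>z. norm z < 1) (nhds (0::complex))"
      using eventually_norm_less[of "\<lambda>z. z" 1] by simp
    with nome_point_near_0 show ?thesis
      by eventually_elim (metis \<alpha>(1) h_def)
  qed
  ultimately have "((\<lambda>z. \<alpha> * z) has_field_derivative of_real c * 16) (at 0)"
    by (subst (asm) DERIV_cong_ev[OF refl _ refl])
  moreover have "((\<lambda>z. \<alpha> * z) has_field_derivative \<alpha>) (at 0)" by (auto intro!: derivative_eq_intros)
  ultimately have "of_real c * 16 = \<alpha>" by (rule DERIV_unique)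
  hence a: "\<alpha> = of_real (c * 16)" by simp
  have "c * 16 = 1" using \<alpha>(2) c(1) unfolding a norm_of_real by simp
  hence "\<alpha> = 1" unfolding a by simp
  hence "h (nome P) = nome P" using \<alpha>(1)[OF norm_nome[OF P]] by simp
  thus ?thesis by (simp add: h_def nome_point_nome[OF P])
qed

text \<open>That \<open>\<psi>0\<close> inverts \<open>\<phi>\<close> is known only near 0, and a
  priori \<open>\<psi>0\<close> might leave the unit disk on the lens. The lens is simply connected
  and avoids 0 and 1, so the identity lifts to a map \<open>M\<close> from it into the disk, which
  agrees with \<open>\<psi>0\<close> near 0 and hence on the whole lens.\<close>

lemma lens_lift:
  assumes \<psi>0: "\<psi>0 holomorphic_on ball 0 1" "\<psi>0 0 = 0" "eventually (\<lambda>w. \<phi> (\<psi>0 w) = w) (nhds 0)"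
    and w: "w \<in> ball 0 1 \<inter> ball 1 1"
  shows "linepath 0 w \<in> origin_curves" "lift_end (linepath 0 w) = \<psi>0 w" "\<phi> (\<psi>0 w) = w"
proof -
  let ?L = "ball 0 1 \<inter> ball (1::complex) 1"
  have L: "open ?L" "convex ?L" by (auto intro: convex_Int)
  have L01: "?L \<subseteq> - {0, 1}" by auto
  obtain g \<rho> \<epsilon> where e: "0 < \<rho>" "\<rho> \<le> 1" "0 < \<epsilon>" "\<epsilon> \<le> 1" and g: "g holomorphic_on ball 0 \<epsilon>"
    "\<And>w. norm w < \<rho> \<Longrightarrow> g (\<phi> w) = w" "\<And>z. norm z < \<epsilon> \<Longrightarrow> norm (g z) < \<rho> \<and> \<phi> (g z) = z"
    by (rule phi_local_inverse) (rule that)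
  have "isCont \<psi>0 0"
    using holomorphic_on_imp_continuous_on[OF \<psi>0(1)] by (simp add: continuous_on_eq_continuous_at)
  hence "eventually (\<lambda>w. norm (\<psi>0 w) < \<rho>) (nhds 0)" using \<psi>0(2) e(1) by (intro eventually_norm_less)
  with \<psi>0(3) have "eventually (\<lambda>w. \<psi>0 w = g w) (nhds 0)"
  proof eventually_elim
    case (elim w)
    thus ?case using g(2)[of "\<psi>0 w"] by simp
  qed
  then obtain d' where d': "d' > 0" "\<And>w. norm w < d' \<Longrightarrow> \<psi>0 w = g w"
    unfolding eventually_nhds_metric by (auto simp: dist_norm)
  define d where "d = min d' \<epsilon>"
  have d: "d > 0" "d \<le> 1" using d'(1) e by (auto simp: d_def)
  \<comment> \<open>0 is a boundary point of the lens; \<open>S\<close> is the part of the lens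
    close to it, where \<open>\<psi>0\<close> is the local inverse \<open>g\<close>.\<close>
  define S where "S = ?L \<inter> ball 0 d"
  have S: "open S" "connected S" "S \<subseteq> ?L"
    by (auto simp: S_def intro!: convex_connected convex_Int)
  define z0 where "z0 = complex_of_real (d / 2)"
  have z0: "z0 \<in> S"
    using d by (simp add: S_def z0_def dist_norm norm_one_minus_of_real del: of_real_divide)
  have gS: "is_branch S g"
    unfolding is_branch_def
  proof (intro conjI ballI subsetI)
    show "g holomorphic_on S" using g(1) by (rule holomorphic_on_subset) (auto simp: S_def d_def)
    show inv: "\<phi> (g y) = y" if "y \<in> S" for y using g(3)[of y] that by (auto simp: S_def d_def)
    fix x assume "x \<in> g ` S"
    then obtain y where y: "y \<in> S" "x = g y" by blast
    have "norm (g y) < \<rho>" using g(3)[of y] y(1) by (auto simp: S_def d_def)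
    moreover have "g y \<noteq> 0" using inv[OF y(1)] y(1) phi_0 L01 by (auto simp: S_def)
    ultimately show "x \<in> ball 0 1 - {0}" using y(2) e(2) by simp
  qed
  have a: "g z0 \<in> ball 0 1 - {0}" using is_branchD(2,3)[OF gS z0] by simp
  have "z0 \<in> ?L" using z0 S(3) by blast
  have lpc: "locally path_connected ?L"
    by (rule convex_imp_locally_path_connected[OF L(2)])
  have feq: "z0 = \<phi> (g z0)" using is_branchD(4)[OF gS z0] by simp
  obtain M where M: "continuous_on ?L M" "M \<in> ?L \<rightarrow> ball 0 1 - {0}" "M z0 = g z0" "\<And>y. y \<in> ?L \<Longrightarrow> \<phi> (M y) = y"
    by (rule covering_space_lift_strong[OF phi_covering a \<open>z0 \<in> ?L\<close> convex_imp_simply_connected[OF L(2)] lpc continuous_on_id _ feq])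
       (use L01 in \<open>auto intro: that\<close>)
  \<comment> \<open>The lifting theorem gives continuity only; near each point the lift coincides
    with a branch and so is holomorphic.\<close>
  have Mh: "M field_differentiable (at y)" if y: "y \<in> ?L" for y
  proof -
    have "y \<in> - {0, 1}" using y L01 by blast
    then obtain R where R: "R > 0" "ball y R \<subseteq> - {0, 1}" by (rule avoiding_ball)
    have My: "M y \<in> ball 0 1 - {0}" using M(2) y by blast
    hence "norm (M y) < 1" by simp
    moreover have "\<phi> (M y) \<in> ball y (R / 4)" using M(4)[OF y] R by simp
    ultimately obtain f where f: "is_branch (ball y (R / 4)) f" "f (\<phi> (M y)) = M y" using branch_exists[OF R] by blast
    have "isCont M y" using M(1) L(1) y by (simp add: continuous_on_eq_continuous_at)
    moreover have "eventually (\<lambda>u. \<phi> (M u) = u) (nhds y)"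
      using eventually_nhds_in_open[OF L(1) y] by eventually_elim (rule M(4))
    ultimately have ev: "eventually (\<lambda>u. M u = f u) (nhds y)"
      using continuous_right_inverse_eq_branch[OF open_ball f(1), where m = M and y = y] R f(2) M(4)[OF y] by simp
    have "(f has_field_derivative deriv f y) (at y)"
      using holomorphic_derivI[OF is_branchD(1)[OF f(1)] open_ball, of y UNIV] R by simp
    hence "(M has_field_derivative deriv f y) (at y)"
      using ev by (subst DERIV_cong_ev[OF refl _ refl])
    thus ?thesis unfolding field_differentiable_def by (rule exI)
  qed
  have Mhol: "M holomorphic_on ?L" by (simp add: holomorphic_on_def Mh field_differentiable_at_within)
  have MS: "is_branch S M"
    unfolding is_branch_def
  proof (intro conjI ballI)
    show "M holomorphic_on S" using Mhol S(3) by (rule holomorphic_on_subset)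
    show "M ` S \<subseteq> ball 0 1 - {0}"
      using image_mono[OF S(3), of M] funcset_image[OF M(2)] by (rule subset_trans)
    show "\<phi> (M y) = y" if "y \<in> S" for y using M(4) S(3) that by blast
  qed
  have MS_eq: "M y = \<psi>0 y" if y: "y \<in> S" for y
  proof -
    have "M y = g y" by (rule is_branch_unique[OF S(1,2) MS gS z0 M(3) y])
    moreover have "norm y < d'" using y by (simp add: S_def d_def)
    ultimately show ?thesis using d'(2) by simp
  qed
  have M_eq: "M y = \<psi>0 y" if "y \<in> ?L" for y
  proof (rule analytic_continuation_open[of S ?L M \<psi>0])
    show "S \<noteq> {}" using z0 by blast
    show "\<psi>0 holomorphic_on ?L" using \<psi>0(1) by (rule holomorphic_on_subset) auto
  qed (use S L Mhol MS_eq that convex_connected in auto)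
  show inv: "\<phi> (\<psi>0 w) = w" using M(4)[OF w] M_eq[OF w] by simp
  have tw: "linepath 0 w t \<in> ?L" if t: "t \<in> {0<..1}" for t
  proof -
    have n: "norm w < 1" "norm (1 - w) < 1" using w by (auto simp: dist_norm)
    have "norm (linepath 0 w t) = t * norm w" using t by (simp add: linepath_def)
    also have "\<dots> \<le> norm w" using t mult_left_le_one_le[of "norm w" t] by simp
    finally have "norm (linepath 0 w t) < 1" using n by simp
    moreover have "norm (1 - linepath 0 w t) < 1"
    proof -
      have "1 - linepath 0 w t = of_real (1 - t) + of_real t * (1 - w)"
        by (simp add: linepath_def scaleR_conv_of_real algebra_simps)
      hence "norm (1 - linepath 0 w t) \<le> norm (complex_of_real (1 - t)) + norm (of_real t * (1 - w))"
        by (metis norm_triangle_ineq)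
      also have "\<dots> = (1 - t) + t * norm (1 - w)" using t unfolding norm_mult norm_of_real by simp
      also have "t * norm (1 - w) < t * 1" using t n(2) by (intro mult_strict_left_mono) auto
      finally show ?thesis by simp
    qed
    ultimately show ?thesis by (simp add: dist_norm)
  qed
  show oc: "linepath 0 w \<in> origin_curves"
  proof (rule origin_curvesI)
    show "linepath 0 w t \<notin> {0, 1}" if "t \<in> {0<..1}" for t using subsetD[OF L01 tw[OF that]] by simp
    show "linepath 0 w 0 = 0" by (simp add: linepath_def)
  qed (rule path_linepath)
  have tw1: "norm (linepath 0 w t) < 1" if "t \<in> {0..1}" for t
    using tw[of t] that by (cases "t = 0") (auto simp: linepath_def)
  have "is_lift (linepath 0 w) (\<lambda>t. \<psi>0 (linepath 0 w t))"
    unfolding is_lift_def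
  proof (intro conjI ballI)
    show "path (\<lambda>t. \<psi>0 (linepath 0 w t))" unfolding path_def
      by (rule continuous_on_compose2[OF holomorphic_on_imp_continuous_on[OF \<psi>0(1)] continuous_on_linepath])
         (use tw1 in auto)
    show "\<psi>0 (linepath 0 w 0) = 0" by (simp add: linepath_def \<psi>0(2))
    fix t :: real assume t: "t \<in> {0..1}"
    have "norm (\<psi>0 (linepath 0 w t)) < 1 \<and> \<phi> (\<psi>0 (linepath 0 w t)) = linepath 0 w t"
    proof (cases "t = 0")
      case True thus ?thesis by (simp add: linepath_def \<psi>0(2) phi_0)
    next
      case False
      hence "linepath 0 w t \<in> ?L" using tw t by simp
      moreover from this have "M (linepath 0 w t) \<in> ball 0 1 - {0}" using M(2) by blast
      ultimately show ?thesis using M_eq M(4) by fastforce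
    qed
    thus "norm (\<psi>0 (linepath 0 w t)) < 1" "\<phi> (\<psi>0 (linepath 0 w t)) = linepath 0 w t" by auto
  qed
  from lift_end_eq[OF oc this] show "lift_end (linepath 0 w) = \<psi>0 w" by (simp add: linepath_def)
qed

lemma nome_lens:
  assumes "\<psi>0 holomorphic_on ball 0 1" "\<psi>0 0 = 0" "eventually (\<lambda>w. \<phi> (\<psi>0 w) = w) (nhds 0)"
    and "w \<in> ball 0 1 \<inter> ball 1 1"
  shows "nome (curve_class (linepath 0 w)) = \<psi>0 w"
  using nome_curve_class[OF lens_lift(1)[OF assms]] lens_lift(2)[OF assms] by simp

text \<open>The nomes of the points over the lens fill an open subset of the disk. There
  \<open>q\<close>, written in the coordinate of the disk, is the identity, and so it is on the
  whole disk.\<close>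

lemma holomorphic_determined_on_lens:
  assumes \<psi>0: "\<psi>0 holomorphic_on ball 0 1" "\<psi>0 0 = 0" "eventually (\<lambda>w. \<phi> (\<psi>0 w) = w) (nhds 0)"
    and q: "Omega_holomorphic q" "\<And>w. w \<in> ball 0 1 \<inter> ball 1 1 \<Longrightarrow> q (curve_class (linepath 0 w)) = \<psi>0 w"
    and P: "P \<in> Omega"
  shows "q P = nome P"
proof -
  let ?L = "ball 0 1 \<inter> ball (1::complex) 1"
  have op: "open (\<psi>0 ` ?L)"
  proof (rule right_inverse_open_image)
    show "\<psi>0 holomorphic_on ?L" using \<psi>0(1) by (rule holomorphic_on_subset) auto
    show "\<phi> (\<psi>0 w) = w" if "w \<in> ?L" for w by (rule lens_lift(3)[OF \<psi>0 that])
  qed auto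
  have eq: "nome_point z = curve_class (linepath 0 w)" if "w \<in> ?L" "z = \<psi>0 w" for w z
    using nome_lens[OF \<psi>0 that(1)] nome_point_nome[OF curve_class_in_Omega[OF lens_lift(1)[OF \<psi>0 that(1)]]] that(2)
    by simp
  have "q (nome_point (nome P)) = nome P"
  proof (rule analytic_continuation_open[where s = "\<psi>0 ` ?L" and s' = "ball 0 1" and g = "\<lambda>z. z" and f = "\<lambda>z. q (nome_point z)"])
    show "\<psi>0 ` ?L \<subseteq> ball 0 1"
    proof
      fix z assume "z \<in> \<psi>0 ` ?L"
      then obtain w where w: "w \<in> ?L" "z = \<psi>0 w" by blast
      show "z \<in> ball 0 1"
        using norm_nome[OF curve_class_in_Omega[OF lens_lift(1)[OF \<psi>0 w(1)]]] nome_lens[OF \<psi>0 w(1)] w(2) by simp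
    qed
    have "1/2 \<in> ?L" by (simp add: norm_divide dist_norm)
    thus "\<psi>0 ` ?L \<noteq> {}" by blast
    show "(\<lambda>z. q (nome_point z)) holomorphic_on ball 0 1" by (rule Omega_holomorphic_imp_holomorphic[OF q(1)])
    show "q (nome_point z) = z" if z: "z \<in> \<psi>0 ` ?L" for z
    proof -
      obtain w where w: "w \<in> ?L" "z = \<psi>0 w" using z by blast
      show ?thesis unfolding eq[OF w] using q(2)[OF w(1)] w(2) by simp
    qed
  qed (use op norm_nome[OF P] in auto)
  thus ?thesis by (simp add: nome_point_nome[OF P])
qed

lemma phi_fps:
  obtains F where "\<phi> has_fps_expansion F" "fps_nth F 0 = 0" "fps_nth F 1 = 16" "fps_nth F 2 = - 128" "fps_nth F 3 = 704"
proof -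
  define F where "F = fps_expansion \<phi> 0"
  define K where "K = fps_expansion \<kappa> 0"
  have F: "\<phi> has_fps_expansion F" unfolding F_def
    by (rule has_fps_expansion_fps_expansion[OF open_ball _ phi_hol]) simp
  have K: "\<kappa> has_fps_expansion K" unfolding K_def
    by (rule has_fps_expansion_fps_expansion[OF open_ball _ kappa_hol]) simp
  have k0: "\<kappa> 0 = 0" using phi_landen[of 0] phi_0 by simp
  have F0: "fps_nth F 0 = 0" using has_fps_expansion_imp_0_eq_fps_nth_0[OF F] phi_0 by simp
  have K0: "fps_nth K 0 = 0" using has_fps_expansion_imp_0_eq_fps_nth_0[OF K] k0 by simp
  have F1: "fps_nth F 1 = 16" by (simp add: F_def fps_expansion_def DERIV_imp_deriv[OF phi_deriv])
  have K1: "fps_nth K 1 = 4" by (simp add: K_def fps_expansion_def DERIV_imp_deriv[OF kappa_deriv])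
  have near: "eventually (\<lambda>z. norm z < 1) (nhds (0::complex))" using eventually_norm_less[of "\<lambda>z. z" 1] by simp
  have "(\<lambda>z. \<phi> z * (1 + \<kappa> z)\<^sup>2 - 4 * \<kappa> z) has_fps_expansion F * (1 + K)\<^sup>2 - 4 * K"
    by (intro fps_expansion_intros F K)
  moreover have "eventually (\<lambda>z. \<phi> z * (1 + \<kappa> z)\<^sup>2 - 4 * \<kappa> z = 0) (nhds 0)"
    using near by eventually_elim (use phi_landen in \<open>simp add: landen_def\<close>)
  ultimately have "(\<lambda>z. 0) has_fps_expansion F * (1 + K)\<^sup>2 - 4 * K"
    by (subst (asm) has_fps_expansion_cong[OF _ refl])
  from fps_expansion_unique_complex[OF this has_fps_expansion_0] have e1: "F * (1 + K)\<^sup>2 = 4 * K" by simp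
  have "(\<lambda>z. \<phi> (z\<^sup>2) - (\<kappa> z)\<^sup>2) has_fps_expansion fps_compose F (fps_X\<^sup>2) - K\<^sup>2"
    using has_fps_expansion_compose[OF F, of "\<lambda>z. z\<^sup>2" "fps_X\<^sup>2"]
    by (intro fps_expansion_intros K) (auto simp: o_def intro!: fps_expansion_intros)
  moreover have "eventually (\<lambda>z. \<phi> (z\<^sup>2) - (\<kappa> z)\<^sup>2 = 0) (nhds 0)"
    using near by eventually_elim (use phi_landen in simp)
  ultimately have "(\<lambda>z. 0) has_fps_expansion fps_compose F (fps_X\<^sup>2) - K\<^sup>2"
    by (subst (asm) has_fps_expansion_cong[OF _ refl])
  from fps_expansion_unique_complex[OF this has_fps_expansion_0] have e2: "fps_compose F (fps_X\<^sup>2) = K\<^sup>2" by simp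
  show thesis
    by (rule that[OF F F0 F1]) (use landen_fps_coeffs[OF F0 F1 K0 K1 e1 e2] in auto)
qed

end

theorem mainTheorem2:
  shows "\<exists>q. elliptic_nome q \<and>
           (\<forall>q'. elliptic_nome q' \<longrightarrow> (\<forall>P\<in>Omega. q' P = q P)) \<and>
           conformal_onto_disk q \<and> normalized_at_origin q \<and>
           (\<forall>\<psi>. conformal_onto_disk \<psi> \<and> normalized_at_origin \<psi> \<longrightarrow> (\<forall>P\<in>Omega. \<psi> P = q P)) \<and>
           (\<exists>F. (\<lambda>z. Omega_proj (the_inv_into Omega q z)) has_fps_expansion F \<and>
                fps_nth F 0 = 0 \<and> fps_nth F 1 = 16 \<and> fps_nth F 2 = - 128 \<and> fps_nth F 3 = 704)"
proof -
  obtain \<psi>0 where psi: "\<psi>0 holomorphic_on ball 0 1" "\<psi>0 0 = 0" "deriv \<psi>0 0 = 1 / 16"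
    "\<And>w. w \<in> ball 0 1 \<inter> ball 1 1 \<Longrightarrow> \<psi>0 w = exp (- of_real pi * (ellipticK (1 - w) / ellipticK w))"
    "\<And>x. norm x < 1 / 8 \<Longrightarrow> \<psi>0 (x\<^sup>2) = (\<psi>0 (landen x))\<^sup>2"
    by (rule nome_near_0) (rule that)
  have "deriv \<psi>0 0 \<noteq> 0" unfolding psi(3) by simp
  then obtain \<phi>0 \<rho> \<epsilon> where loc: "0 < \<rho>" "\<rho> \<le> 1" "0 < \<epsilon>" "\<epsilon> \<le> 1" "\<phi>0 holomorphic_on ball 0 \<epsilon>"
    "\<And>w. norm w < \<rho> \<Longrightarrow> \<phi>0 (\<psi>0 w) = w" "\<And>z. norm z < \<epsilon> \<Longrightarrow> norm (\<phi>0 z) < \<rho> \<and> \<psi>0 (\<phi>0 z) = z"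
    by (rule local_inverse[OF psi(1,2)]) (rule that)
  interpret nome_germ \<psi>0 \<phi>0 \<rho> \<epsilon>
    by (rule nome_germ.intro) (fact psi loc)+
  obtain \<phi> \<kappa> where phi: "\<phi> holomorphic_on ball 0 1" "\<kappa> holomorphic_on ball 0 1"
    "\<And>z. norm z < 1 \<Longrightarrow> \<phi> z = landen (\<kappa> z) \<and> 1 + \<kappa> z \<noteq> 0 \<and> (\<kappa> z)\<^sup>2 = \<phi> (z\<^sup>2)"
    "\<And>z. norm z < 1 \<Longrightarrow> z \<noteq> 0 \<Longrightarrow> \<phi> z \<notin> {0, 1}" "\<phi> 0 = 0"
    "(\<phi> has_field_derivative 16) (at 0)" "(\<kappa> has_field_derivative 4) (at 0)"
    "eventually (\<lambda>w. \<phi> (\<psi>0 w) = w) (nhds 0)"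
    by (rule inverse_nome_exists) (rule that)
  interpret inv: inverse_nome \<phi> \<kappa>
    by (rule inverse_nome.intro) (fact phi)+
  have formula: "elliptic_nome q \<longleftrightarrow> Omega_holomorphic q \<and> q Omega_origin = 0 \<and>
      (\<forall>w\<in>ball 0 1 \<inter> ball 1 1. q (curve_class (linepath 0 w)) = \<psi>0 w)" for q
    unfolding elliptic_nome_def by (intro conj_cong refl ball_cong) (simp only: psi(4))
  have nome: "elliptic_nome inv.nome"
    unfolding formula using inv.Omega_holomorphic_nome inv.nome_origin inv.nome_lens[OF psi(1,2) phi(8)] by blast
  have unique: "\<forall>q'. elliptic_nome q' \<longrightarrow> (\<forall>P\<in>Omega. q' P = inv.nome P)"
    unfolding formula using inv.holomorphic_determined_on_lens[OF psi(1,2) phi(8)] by blast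
  obtain F where F: "\<phi> has_fps_expansion F" "fps_nth F 0 = 0" "fps_nth F 1 = 16" "fps_nth F 2 = - 128" "fps_nth F 3 = 704"
    by (rule inv.phi_fps) (rule that)
  have "eventually (\<lambda>z. norm z < 1) (nhds (0::complex))"
    using eventually_norm_less[of "\<lambda>z. z" 1] by simp
  hence "eventually (\<lambda>z. Omega_proj (the_inv_into Omega inv.nome z) = \<phi> z) (nhds 0)"
    by eventually_elim (simp add: inv.the_inv_nome inv.Omega_proj_nome_point)
  hence "(\<lambda>z. Omega_proj (the_inv_into Omega inv.nome z)) has_fps_expansion F"
    using F(1) by (subst has_fps_expansion_cong[OF _ refl])
  with F(2-5) have fps: "\<exists>F. (\<lambda>z. Omega_proj (the_inv_into Omega inv.nome z)) has_fps_expansion F \<and>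
      fps_nth F 0 = 0 \<and> fps_nth F 1 = 16 \<and> fps_nth F 2 = - 128 \<and> fps_nth F 3 = 704" by blast
  have conformal: "\<forall>\<psi>. conformal_onto_disk \<psi> \<and> normalized_at_origin \<psi> \<longrightarrow> (\<forall>P\<in>Omega. \<psi> P = inv.nome P)"
    using inv.conformal_unique by blast
  show ?thesis
    by (rule exI[of _ inv.nome]) (intro conjI nome unique inv.conformal_nome inv.normalized_nome conformal fps)
qed

end
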